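(* Every quantum homogeneous Kähler space is diagonalisable. That is: let $M=G^{\mathrm{co}(H)}$ be a quantum homogeneous space of compact quantum group algebras, let $\Omega^\bullet$ be a left $G$-covariant differential $*$-calculus over $M$ with a positive definite $G$-covariant Kähler structure $(\Omega^{(\bullet,\bullet)},\kappa)$ such that the integral $\int=\mathbf h\circ\mathrm{vol}_\kappa$ associated with the Haar state $\mathbf h$ is closed. Then for every $G$-covariant left holomorphic vector bundle $(\mathcal F,\bar\partial_{\mathcal F})$ over $M$ (with $\mathcal F$ satisfying the conventions for quantum homogeneous spaces) equipped with a positive definite $G$-covariant Hermitian structure, the Dirac operator $D_{\bar\partial_{\mathcal F}}=\bar\partial_{\mathcal F}+\bar\partial_{\mathcal F}^\dagger$ on $\Omega^\bullet\otimes_M\mathcal F$ is diagonalisable as a $\mathbb C$-linear operator.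
   Context: **Quantum homogeneous spaces.** A compact quantum group algebra is a cosemisimple Hopf $*$-algebra $G$ whose Haar functional $\mathbf h$ satisfies $\mathbf h(g^*g)>0$ for $g\ne0$. Let $\pi:G\to H$ be a surjective Hopf $*$-algebra map of compact quantum group algebras; $M=G^{\mathrm{co}(H)}=\{g\in G:(\mathrm{id}\otimes\pi)\Delta(g)=g\otimes1\}$, a $*$-subalgebra and left $G$-comodule algebra; $M^+=M\cap\ker\varepsilon$. The Haar functional restricts to a state on $M$. All calculi and bundles are left $G$-covariant $M$-bimodules $\mathcal F$, finitely generated as left $M$-modules, with $\mathcal FM^+\subseteq M^+\mathcal F$; in particular $\Omega^\bullet$ satisfies these conditions. **Calculi.** A left $G$-covariant differential $*$-calculus over $M$ is a graded algebra $\Omega^\bullet=\bigoplus_{k\ge 0}\Omega^k$ (product $\wedge$) with $\Omega^0=M$, a degree one map $d$ with $d^2=0$ satisfying the graded Leibniz rule, generated by $M$ as a dg algebra, with a conjugate-linear involution $*$ extending that of $M$, $(d\omega)^*=d(\omega^* )$, $(\omega\wedge\nu)^*=(-1)^{|\omega||\nu|}\nu^*\wedge\omega^*$, and a graded left $G$-coaction compatible with product, $d$ and $*$. A complex structure is an algebra $\mathbb N_0^2$-grading $\Omega^{(a,b)}$ with $\Omega^k=\bigoplus_{a+b=k}\Omega^{(a,b)}$ (as $G$-comodules and $M$-bimodules), $(\Omega^{(a,b)})^*=\Omega^{(b,a)}$ and $d=\partial+\bar\partial$, where $\partial,\bar\partial$ are the components of $d$ of bidegree $(1,0),(0,1)$.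 **Kähler structures.** Let $\Omega^\bullet$ have total dimension $2n$ ($\Omega^{2n}\neq0$, $\Omega^k=0$ for $k>2n$). A covariant Kähler structure is a complex structure together with a closed, central, real, left $G$-coinvariant form $\kappa\in\Omega^{(1,1)}$ such that, for $L(\omega)=\kappa\wedge\omega$, the maps $L^{n-k}:\Omega^k\to\Omega^{2n-k}$ are isomorphisms for $0\le k<n$. Put $P^k=\{\alpha\in\Omega^k: L^{n-k+1}\alpha=0\}$ for $k\le n$, $P^k=0$ for $k>n$, $P^{(a,b)}=P^{a+b}\cap\Omega^{(a,b)}$. The Hodge map is determined by $\ast_H(L^j\alpha)=(-1)^{k(k+1)/2}i^{a-b}\frac{j!}{(n-j-k)!}L^{n-j-k}(\alpha)$ for $\alpha\in P^{(a,b)}$, $k=a+b$, $0\le j\le n-k$; $\mathrm{vol}_\kappa=\ast_H|_{\Omega^{2n}}:\Omega^{2n}\to M$ (zero on lower degrees). $M_{>0}$ is the set of non-zero finite sums $\sum\lambda_im_im_i^*$, $\lambda_i\ge0$. The structure is positive definite if $\mathrm{vol}_\kappa(\omega\wedge\ast_H(\omega^* ))\in M_{>0}$ for all non-zero $\omega\in\Omega^\bullet$. The integral is closed if $\int d\omega=0$ for $\omega\in\Omega^{2n-1}$. **Bundles.** ${}^\vee\mathcal F$ is the right $M$-module of left $M$-linear maps $\mathcal F\to M$. A left holomorphic structure is a $G$-comodule map $\bar\partial_{\mathcal F}:\mathcal F\to\Omega^{(0,1)}\otimes_M\mathcal F$ with $\bar\partial_{\mathcal F}(mf)=\bar\partial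 m\otimes f+m\bar\partial_{\mathcal F}f$ whose extension $\bar\partial_{\mathcal F}(\omega\otimes f)=\bar\partial\omega\otimes f+(-1)^{|\omega|}\omega\wedge\bar\partial_{\mathcal F}f$ squares to zero. A covariant Hermitian structure is an isomorphism of right $M$-modules and left $G$-comodules $h:\overline{\mathcal F}\to{}^\vee\mathcal F$ with $h(\overline f)(g)=h(\overline g)(f)^*$; $\overline{\mathcal F}$ is the conjugate vector space with $\overline f\,m=\overline{m^*f}$ and coaction $\overline f\mapsto(f_{(-1)})^*\otimes\overline{f_{(0)}}$, and ${}^\vee\mathcal F$ has coaction $\phi_{(-1)}\otimes\phi_{(0)}(f)=S(f_{(-1)})\phi(f_{(0)})_{(-1)}\otimes\phi(f_{(0)})_{(0)}$. It is positive definite if $h(\overline f)(f)\in M_{>0}$ for all non-zero $f$. With $(\omega\otimes f)\wedge_{\mathrm{ev}}(\phi\otimes\nu)=\omega\phi(f)\wedge\nu$ and $\bar\ast_{\mathcal F}(\omega\otimes f)=h(\overline f)\otimes\ast_H(\omega^* )$, the inner product on $\Omega^\bullet\otimes_M\mathcal F$ is $\langle\alpha,\beta\rangle_{\mathcal F}=\mathbf h(\mathrm{vol}_\kappa(\alpha\wedge_{\mathrm{ev}}\bar\ast_{\mathcal F}\beta))$, and $\bar\partial_{\mathcal F}^\dagger$ is the adjoint of $\bar\partial_{\mathcal F}$. *)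

theory Defs
  imports Complex_Main "HOL-Library.Poly_Mapping" "HOL-Library.Function_Algebras"
begin

section \<open>Complex vector spaces and algebras\<close>

class complex_vector = ab_group_add +
  fixes scaleC :: "complex \<Rightarrow> 'a \<Rightarrow> 'a"  (infixr \<open>*\<^sub>C\<close> 75)
  assumes scaleC_add_right: "c *\<^sub>C (x + y) = c *\<^sub>C x + c *\<^sub>C y"
    and scaleC_add_left: "(c + e) *\<^sub>C x = c *\<^sub>C x + e *\<^sub>C x"
    and scaleC_scaleC: "c *\<^sub>C (e *\<^sub>C x) = (c * e) *\<^sub>C x"
    and scaleC_one: "1 *\<^sub>C x = x"

class complex_algebra_1 = complex_vector + ring_1 +
  assumes mult_scaleC_left: "(c *\<^sub>C x) * y = c *\<^sub>C (x * y)"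
    and mult_scaleC_right: "x * (c *\<^sub>C y) = c *\<^sub>C (x * y)"

global_interpretation cvec: vector_space "scaleC :: complex \<Rightarrow> 'a \<Rightarrow> 'a::complex_vector"
  by unfold_locales (simp_all add: scaleC_add_right scaleC_add_left scaleC_scaleC scaleC_one)

abbreviation clinear :: "('a::complex_vector \<Rightarrow> 'b::complex_vector) \<Rightarrow> bool" where
  "clinear \<equiv> Vector_Spaces.linear scaleC scaleC"

definition cbilinear :: "('a::complex_vector \<Rightarrow> 'b::complex_vector \<Rightarrow> 'c::complex_vector) \<Rightarrow> bool" where
  "cbilinear \<beta> \<longleftrightarrow> (\<forall>a. clinear (\<beta> a)) \<and> (\<forall>b. clinear (\<lambda>a. \<beta> a b))"

definition antilinear :: "('a::complex_vector \<Rightarrow> 'b::complex_vector) \<Rightarrow> bool" where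
  "antilinear f \<longleftrightarrow> (\<forall>x y. f (x + y) = f x + f y) \<and> (\<forall>c x. f (c *\<^sub>C x) = cnj c *\<^sub>C f x)"

lemma clinear_iff:
  "clinear f \<longleftrightarrow> (\<forall>x y. f (x + y) = f x + f y) \<and> (\<forall>c x. f (c *\<^sub>C x) = c *\<^sub>C f x)"
  unfolding Vector_Spaces.linear_iff by (auto simp: cvec.vector_space_axioms)

instantiation complex :: complex_algebra_1
begin
definition scaleC_complex :: "complex \<Rightarrow> complex \<Rightarrow> complex" where "scaleC_complex = (*)"
instance by standard (simp_all add: scaleC_complex_def algebra_simps)
end

instantiation "fun" :: (type, complex_vector) complex_vector
begin
definition scaleC_fun :: "complex \<Rightarrow> ('a \<Rightarrow> 'b) \<Rightarrow> 'a \<Rightarrow> 'b" where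
  "scaleC_fun c f = (\<lambda>x. c *\<^sub>C f x)"
instance
  by standard
    (simp_all add: scaleC_fun_def fun_eq_iff scaleC_add_right scaleC_add_left scaleC_scaleC scaleC_one)
end

instantiation poly_mapping :: (type, complex_vector) complex_vector
begin
definition scaleC_poly_mapping :: "complex \<Rightarrow> ('a \<Rightarrow>\<^sub>0 'b) \<Rightarrow> ('a \<Rightarrow>\<^sub>0 'b)" where
  "scaleC_poly_mapping c = Poly_Mapping.map (scaleC c)"

lemma lookup_scaleC: "Poly_Mapping.lookup (c *\<^sub>C p) x = c *\<^sub>C Poly_Mapping.lookup p x"
  by (simp add: scaleC_poly_mapping_def Poly_Mapping.map.rep_eq when_def)

instance
  by standard
    (simp_all add: poly_mapping_eq_iff fun_eq_iff lookup_scaleC lookup_add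
      scaleC_add_right scaleC_add_left scaleC_scaleC scaleC_one)
end

datatype 'a conj_space = Conj (unConj: 'a)

instantiation conj_space :: (complex_vector) complex_vector
begin
definition "0 = Conj 0"
definition "x + y = Conj (unConj x + unConj y)"
definition "- x = Conj (- unConj x)"
definition "x - y = Conj (unConj x - unConj y)"
definition "c *\<^sub>C x = Conj (cnj c *\<^sub>C unConj x)"
instance
  by standard
    (simp_all add: zero_conj_space_def plus_conj_space_def uminus_conj_space_def
      minus_conj_space_def scaleC_conj_space_def scaleC_add_right scaleC_add_left
      scaleC_scaleC scaleC_one algebra_simps)
end

definition decomposition :: "('i \<Rightarrow> 'v::complex_vector set) \<Rightarrow> 'i set \<Rightarrow> 'v \<Rightarrow> ('i \<Rightarrow> 'v) \<Rightarrow> bool" where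
  "decomposition A I v c \<longleftrightarrow> (\<forall>i\<in>I. c i \<in> A i) \<and> (\<forall>i. i \<notin> I \<longrightarrow> c i = 0)
     \<and> finite {i. c i \<noteq> 0} \<and> v = (\<Sum>i | c i \<noteq> 0. c i)"

definition direct_sum :: "('i \<Rightarrow> 'v::complex_vector set) \<Rightarrow> 'i set \<Rightarrow> 'v set \<Rightarrow> bool" where
  "direct_sum A I V \<longleftrightarrow> cvec.subspace V \<and> (\<forall>i\<in>I. cvec.subspace (A i) \<and> A i \<subseteq> V)
     \<and> (\<forall>v\<in>V. \<exists>!c. decomposition A I v c)"

definition component :: "('i \<Rightarrow> 'v::complex_vector set) \<Rightarrow> 'i set \<Rightarrow> 'i \<Rightarrow> 'v \<Rightarrow> 'v" where
  "component A I i v = (THE c. decomposition A I v c) i"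

definition diagonalisable :: "('v::complex_vector \<Rightarrow> 'v) \<Rightarrow> bool" where
  "diagonalisable T \<longleftrightarrow> clinear T \<and>
     (\<exists>B. cvec.independent B \<and> cvec.span B = UNIV \<and> (\<forall>b\<in>B. \<exists>c. T b = c *\<^sub>C b))"


section \<open>Tensor products over the complex numbers\<close>

definition tensor_relations ::
    "(('a::complex_vector \<times> 'b::complex_vector) \<Rightarrow>\<^sub>0 complex) set" where
  "tensor_relations = cvec.span
     ({Poly_Mapping.single (a + a', b) 1 - Poly_Mapping.single (a, b) 1 - Poly_Mapping.single (a', b) 1
         | a a' b. True} \<union>
      {Poly_Mapping.single (a, b + b') 1 - Poly_Mapping.single (a, b) 1 - Poly_Mapping.single (a, b') 1
         | a b b'. True} \<union>
      {Poly_Mapping.single (c *\<^sub>C a, b) 1 - c *\<^sub>C Poly_Mapping.single (a, b) 1 | c a b. True} \<union>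
      {Poly_Mapping.single (a, c *\<^sub>C b) 1 - c *\<^sub>C Poly_Mapping.single (a, b) 1 | c a b. True})"

quotient_type (overloaded) ('a, 'b) tensor (infixr \<open>\<otimes>\<^sub>C\<close> 70) =
    "('a::complex_vector \<times> 'b::complex_vector) \<Rightarrow>\<^sub>0 complex" /
    "\<lambda>p q. p - q \<in> tensor_relations"
proof (rule equivpI)
  show "reflp (\<lambda>p q :: ('a \<times> 'b) \<Rightarrow>\<^sub>0 complex. p - q \<in> tensor_relations)"
    by (auto simp: reflp_def tensor_relations_def cvec.span_zero)
  show "symp (\<lambda>p q :: ('a \<times> 'b) \<Rightarrow>\<^sub>0 complex. p - q \<in> tensor_relations)"
  proof (rule sympI)
    fix p q :: "('a \<times> 'b) \<Rightarrow>\<^sub>0 complex"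
    assume "p - q \<in> tensor_relations"
    then have "- (p - q) \<in> tensor_relations"
      unfolding tensor_relations_def by (rule cvec.span_neg)
    then show "q - p \<in> tensor_relations" by simp
  qed
  show "transp (\<lambda>p q :: ('a \<times> 'b) \<Rightarrow>\<^sub>0 complex. p - q \<in> tensor_relations)"
  proof (rule transpI)
    fix p q r :: "('a \<times> 'b) \<Rightarrow>\<^sub>0 complex"
    assume "p - q \<in> tensor_relations" "q - r \<in> tensor_relations"
    then have "(p - q) + (q - r) \<in> tensor_relations"
      unfolding tensor_relations_def by (rule cvec.span_add)
    then show "p - r \<in> tensor_relations" by simp
  qed
qed

lemma tensor_relations_subspace: "cvec.subspace tensor_relations"
  unfolding tensor_relations_def by (rule cvec.subspace_span)

instantiation tensor :: (complex_vector, complex_vector) complex_vector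
begin

lift_definition zero_tensor :: "'a \<otimes>\<^sub>C 'b" is 0 .

lift_definition plus_tensor :: "'a \<otimes>\<^sub>C 'b \<Rightarrow> 'a \<otimes>\<^sub>C 'b \<Rightarrow> 'a \<otimes>\<^sub>C 'b" is "(+)"
  by (drule (1) cvec.subspace_add[OF tensor_relations_subspace]) (simp add: algebra_simps)

lift_definition uminus_tensor :: "'a \<otimes>\<^sub>C 'b \<Rightarrow> 'a \<otimes>\<^sub>C 'b" is uminus
  by (drule cvec.subspace_neg[OF tensor_relations_subspace]) (simp add: algebra_simps)

lift_definition minus_tensor :: "'a \<otimes>\<^sub>C 'b \<Rightarrow> 'a \<otimes>\<^sub>C 'b \<Rightarrow> 'a \<otimes>\<^sub>C 'b" is "(-)"
  by (drule (1) cvec.subspace_diff[OF tensor_relations_subspace]) (simp add: algebra_simps)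

lift_definition scaleC_tensor :: "complex \<Rightarrow> 'a \<otimes>\<^sub>C 'b \<Rightarrow> 'a \<otimes>\<^sub>C 'b" is scaleC
  by (drule cvec.subspace_scale[OF tensor_relations_subspace])
    (simp add: cvec.scale_right_diff_distrib)

instance
  by (standard; transfer)
    (simp_all add: algebra_simps scaleC_add_right scaleC_add_left scaleC_scaleC scaleC_one
      cvec.subspace_0[OF tensor_relations_subspace])
end

lift_definition tens :: "'a::complex_vector \<Rightarrow> 'b::complex_vector \<Rightarrow> 'a \<otimes>\<^sub>C 'b"  (infixr \<open>\<otimes>\<close> 72)
  is "\<lambda>a b. Poly_Mapping.single (a, b) 1" .

definition free_lift ::
    "('a \<Rightarrow> 'b \<Rightarrow> 'c::complex_vector) \<Rightarrow> (('a \<times> 'b) \<Rightarrow>\<^sub>0 complex) \<Rightarrow> 'c" where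
  "free_lift \<beta> p = (\<Sum>x\<in>Poly_Mapping.keys p. Poly_Mapping.lookup p x *\<^sub>C \<beta> (fst x) (snd x))"

text \<open>The linear map induced by a bilinear map \<open>\<beta>\<close>; see \<open>tlift_tens\<close> and \<open>clinear_tlift\<close> below.
  It is computed on a chosen representative, hence meaningful for bilinear \<open>\<beta>\<close> only.\<close>

definition tlift :: "('a::complex_vector \<Rightarrow> 'b::complex_vector \<Rightarrow> 'c::complex_vector) \<Rightarrow> 'a \<otimes>\<^sub>C 'b \<Rightarrow> 'c" where
  "tlift \<beta> t = free_lift \<beta> (rep_tensor t)"

lemma free_lift_superset:
  assumes "finite A" "Poly_Mapping.keys p \<subseteq> A"
  shows "free_lift \<beta> p = (\<Sum>x\<in>A. Poly_Mapping.lookup p x *\<^sub>C \<beta> (fst x) (snd x))"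
  unfolding free_lift_def
  by (rule sum.mono_neutral_left) (use assms in \<open>auto simp: in_keys_iff\<close>)

lemma clinear_free_lift: "clinear (free_lift \<beta>)"
  unfolding clinear_iff
proof (intro conjI allI)
  fix p q :: "('a \<times> 'b) \<Rightarrow>\<^sub>0 complex" and c :: complex
  let ?A = "Poly_Mapping.keys p \<union> Poly_Mapping.keys q"
  have "Poly_Mapping.keys (p + q) \<subseteq> ?A"
    by (rule Poly_Mapping.keys_add)
  then show "free_lift \<beta> (p + q) = free_lift \<beta> p + free_lift \<beta> q"
    by (simp add: free_lift_superset[of ?A] lookup_add scaleC_add_left sum.distrib)
  have "Poly_Mapping.keys (c *\<^sub>C p) \<subseteq> Poly_Mapping.keys p"
    by (auto simp: in_keys_iff lookup_scaleC)
  then show "free_lift \<beta> (c *\<^sub>C p) = c *\<^sub>C free_lift \<beta> p"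
    by (simp add: free_lift_superset[of "Poly_Mapping.keys p"] lookup_scaleC cvec.scale_sum_right
        scaleC_scaleC scaleC_complex_def)
qed

lemma free_lift_single: "free_lift \<beta> (Poly_Mapping.single (a, b) 1) = \<beta> a b"
  by (simp add: free_lift_def scaleC_one)

lemma free_lift_relations:
  assumes "cbilinear \<beta>" "p \<in> tensor_relations"
  shows "free_lift \<beta> p = 0"
proof -
  interpret L: Vector_Spaces.linear scaleC scaleC "free_lift \<beta>" by (rule clinear_free_lift)
  have add: "\<beta> (a + a') b = \<beta> a b + \<beta> a' b" "\<beta> a (b + b') = \<beta> a b + \<beta> a b'"
    and sc: "\<beta> (c *\<^sub>C a) b = c *\<^sub>C \<beta> a b" "\<beta> a (c *\<^sub>C b) = c *\<^sub>C \<beta> a b" for a a' b b' c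
    using assms(1) by (simp_all add: cbilinear_def clinear_iff)
  show ?thesis
    using assms(2) unfolding tensor_relations_def
  proof (induction rule: cvec.span_induct_alt)
    case base
    then show ?case by (rule L.zero)
  next
    case (step c x y)
    then have "free_lift \<beta> x = 0"
      by (auto simp: L.diff L.scale free_lift_single add sc)
    with step show ?case by (simp add: L.add L.scale)
  qed
qed

lemma tlift_abs: "cbilinear \<beta> \<Longrightarrow> tlift \<beta> (abs_tensor p) = free_lift \<beta> p"
proof -
  assume b: "cbilinear \<beta>"
  interpret L: Vector_Spaces.linear scaleC scaleC "free_lift \<beta>" by (rule clinear_free_lift)
  have "abs_tensor (rep_tensor (abs_tensor p)) = abs_tensor p"
    by (rule Quotient_abs_rep[OF Quotient_tensor])
  then have "rep_tensor (abs_tensor p) - p \<in> tensor_relations"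
    using tensor.abs_eq_iff by blast
  from free_lift_relations[OF b this] show ?thesis
    by (simp add: tlift_def L.diff)
qed

lemma tlift_tens: "cbilinear \<beta> \<Longrightarrow> tlift \<beta> (a \<otimes> b) = \<beta> a b"
  by (simp add: tens.abs_eq tlift_abs free_lift_single)

lemma clinear_tlift:
  assumes "cbilinear \<beta>"
  shows "clinear (tlift \<beta>)"
proof -
  interpret L: Vector_Spaces.linear scaleC scaleC "free_lift \<beta>" by (rule clinear_free_lift)
  have "tlift \<beta> (s + t) = tlift \<beta> s + tlift \<beta> t" "tlift \<beta> (c *\<^sub>C s) = c *\<^sub>C tlift \<beta> s" for s t c
    by (induction s; induction t;
        simp add: plus_tensor.abs_eq scaleC_tensor.abs_eq tlift_abs[OF assms] L.add L.scale)+
  then show ?thesis by (simp add: clinear_iff)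
qed

definition tensor_map ::
    "('a::complex_vector \<Rightarrow> 'c::complex_vector) \<Rightarrow> ('b::complex_vector \<Rightarrow> 'd::complex_vector)
      \<Rightarrow> 'a \<otimes>\<^sub>C 'b \<Rightarrow> 'c \<otimes>\<^sub>C 'd" where
  "tensor_map f g = tlift (\<lambda>a b. f a \<otimes> g b)"

text \<open>The map \<open>f \<otimes> g\<close> for antilinear \<open>f\<close> and \<open>g\<close>.\<close>

definition tensor_antimap ::
    "('a::complex_vector \<Rightarrow> 'c::complex_vector) \<Rightarrow> ('b::complex_vector \<Rightarrow> 'd::complex_vector)
      \<Rightarrow> 'a \<otimes>\<^sub>C 'b \<Rightarrow> 'c \<otimes>\<^sub>C 'd" where
  "tensor_antimap f g t = unConj (tlift (\<lambda>a b. Conj (f a \<otimes> g b)) t)"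

text \<open>\<open>(a \<otimes> b, c \<otimes> e) \<mapsto> p a c \<otimes> q b e\<close> for bilinear \<open>p\<close> and \<open>q\<close>.\<close>

definition tensor_map2 ::
    "('a::complex_vector \<Rightarrow> 'c::complex_vector \<Rightarrow> 'e::complex_vector)
      \<Rightarrow> ('b::complex_vector \<Rightarrow> 'd::complex_vector \<Rightarrow> 'f::complex_vector)
      \<Rightarrow> 'a \<otimes>\<^sub>C 'b \<Rightarrow> 'c \<otimes>\<^sub>C 'd \<Rightarrow> 'e \<otimes>\<^sub>C 'f" where
  "tensor_map2 p q s t = tlift (\<lambda>a b. tlift (\<lambda>c e. p a c \<otimes> q b e) t) s"

definition tensor_assoc ::
    "('a::complex_vector \<otimes>\<^sub>C 'b::complex_vector) \<otimes>\<^sub>C 'c::complex_vector \<Rightarrow> 'a \<otimes>\<^sub>C ('b \<otimes>\<^sub>C 'c)" where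
  "tensor_assoc = tlift (\<lambda>s c. tlift (\<lambda>a b. a \<otimes> b \<otimes> c) s)"

definition subtensor :: "'a::complex_vector set \<Rightarrow> 'b::complex_vector set \<Rightarrow> ('a \<otimes>\<^sub>C 'b) set" where
  "subtensor A B = cvec.span {a \<otimes> b | a b. a \<in> A \<and> b \<in> B}"


section \<open>Compact quantum group algebras\<close>

record (overloaded) 'g hopf =
  comult :: "'g::complex_algebra_1 \<Rightarrow> 'g \<otimes>\<^sub>C 'g"
  counit :: "'g \<Rightarrow> complex"
  antipode :: "'g \<Rightarrow> 'g"
  star :: "'g \<Rightarrow> 'g"
  haar :: "'g \<Rightarrow> complex"

definition comodule ::
    "'g::complex_algebra_1 hopf \<Rightarrow> ('v::complex_vector \<Rightarrow> 'g \<otimes>\<^sub>C 'v) \<Rightarrow> bool" where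
  "comodule G \<delta> \<longleftrightarrow> clinear \<delta>
     \<and> (\<forall>v. tensor_assoc (tensor_map (comult G) id (\<delta> v)) = tensor_map id \<delta> (\<delta> v))
     \<and> (\<forall>v. tlift (\<lambda>g w. counit G g *\<^sub>C w) (\<delta> v) = v)"

definition comodule_map ::
    "('v::complex_vector \<Rightarrow> 'g::complex_vector \<otimes>\<^sub>C 'v)
      \<Rightarrow> ('w::complex_vector \<Rightarrow> 'g \<otimes>\<^sub>C 'w) \<Rightarrow> ('v \<Rightarrow> 'w) \<Rightarrow> bool" where
  "comodule_map \<delta> \<delta>' f \<longleftrightarrow> clinear f \<and> (\<forall>v. \<delta>' (f v) = tensor_map id f (\<delta> v))"

locale hopf_star_algebra =
  fixes G :: "'g::complex_algebra_1 hopf"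
  assumes comult_linear: "clinear (comult G)"
    and comult_mult: "comult G (a * b) = tensor_map2 (*) (*) (comult G a) (comult G b)"
    and comult_one: "comult G 1 = 1 \<otimes> 1"
    and counit_linear: "clinear (counit G)"
    and counit_mult: "counit G (a * b) = counit G a * counit G b"
    and counit_one: "counit G 1 = 1"
    and coassoc: "tensor_assoc (tensor_map (comult G) id (comult G a)) = tensor_map id (comult G) (comult G a)"
    and counit_left: "tlift (\<lambda>x y. counit G x *\<^sub>C y) (comult G a) = a"
    and counit_right: "tlift (\<lambda>x y. counit G y *\<^sub>C x) (comult G a) = a"
    and antipode_linear: "clinear (antipode G)"
    and antipode_left: "tlift (\<lambda>x y. antipode G x * y) (comult G a) = counit G a *\<^sub>C 1"
    and antipode_right: "tlift (\<lambda>x y. x * antipode G y) (comult G a) = counit G a *\<^sub>C 1"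
    and star_antilinear: "antilinear (star G)"
    and star_star: "star G (star G a) = a"
    and star_mult: "star G (a * b) = star G b * star G a"
    and star_comult: "comult G (star G a) = tensor_antimap (star G) (star G) (comult G a)"

definition subcoalgebra :: "'g::complex_algebra_1 hopf \<Rightarrow> 'g set \<Rightarrow> bool" where
  "subcoalgebra G C \<longleftrightarrow> cvec.subspace C \<and> comult G ` C \<subseteq> subtensor C C"

definition simple_subcoalgebra :: "'g::complex_algebra_1 hopf \<Rightarrow> 'g set \<Rightarrow> bool" where
  "simple_subcoalgebra G C \<longleftrightarrow> subcoalgebra G C \<and> C \<noteq> {0}
     \<and> (\<forall>B. subcoalgebra G B \<and> B \<subseteq> C \<longrightarrow> B = {0} \<or> B = C)"

definition cosemisimple :: "'g::complex_algebra_1 hopf \<Rightarrow> bool" where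
  "cosemisimple G \<longleftrightarrow> direct_sum (\<lambda>C. C) {C. simple_subcoalgebra G C} UNIV"

locale compact_quantum_group_algebra = hopf_star_algebra G
  for G :: "'g::complex_algebra_1 hopf" +
  assumes cosemisimple: "cosemisimple G"
    and haar_linear: "clinear (haar G)"
    and haar_one: "haar G 1 = 1"
    and haar_left: "tlift (\<lambda>x y. haar G y *\<^sub>C x) (comult G a) = haar G a *\<^sub>C 1"
    and haar_right: "tlift (\<lambda>x y. haar G x *\<^sub>C y) (comult G a) = haar G a *\<^sub>C 1"
    and haar_pos: "a \<noteq> 0 \<Longrightarrow> haar G (star G a * a) \<in> \<real> \<and> 0 < Re (haar G (star G a * a))"


section \<open>Quantum homogeneous spaces\<close>

definition coinvariants ::
    "'g::complex_algebra_1 hopf \<Rightarrow> ('g \<Rightarrow> 'h::complex_algebra_1) \<Rightarrow> 'g set" where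
  "coinvariants G \<pi> = {g. tensor_map id \<pi> (comult G g) = g \<otimes> 1}"

text \<open>The subalgebra \<open>M\<close> of \<open>\<pi>\<close>-coinvariants of \<open>G\<close> is represented by a type \<open>'m\<close> together with
  an injective algebra map \<open>\<iota>\<close> into \<open>G\<close> whose range is the set of coinvariants.\<close>

locale quantum_homogeneous_space =
  G: compact_quantum_group_algebra G + H: compact_quantum_group_algebra H
  for G :: "'g::complex_algebra_1 hopf" and H :: "'h::complex_algebra_1 hopf" +
  fixes \<pi> :: "'g \<Rightarrow> 'h" and \<iota> :: "'m::complex_algebra_1 \<Rightarrow> 'g"
  assumes pi_linear: "clinear \<pi>"
    and pi_mult: "\<pi> (a * b) = \<pi> a * \<pi> b"
    and pi_one: "\<pi> 1 = 1"
    and pi_comult: "comult H (\<pi> a) = tensor_map \<pi> \<pi> (comult G a)"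
    and pi_counit: "counit H (\<pi> a) = counit G a"
    and pi_antipode: "\<pi> (antipode G a) = antipode H (\<pi> a)"
    and pi_star: "\<pi> (star G a) = star H (\<pi> a)"
    and pi_surj: "surj \<pi>"
    and incl_linear: "clinear \<iota>"
    and incl_mult: "\<iota> (x * y) = \<iota> x * \<iota> y"
    and incl_one: "\<iota> 1 = 1"
    and incl_inj: "inj \<iota>"
    and incl_range: "range \<iota> = coinvariants G \<pi>"

text \<open>Involution and coaction of \<open>M\<close>, i.e. the restrictions of those of \<open>G\<close>, and \<open>M \<inter> ker \<epsilon>\<close>.\<close>

definition base_star :: "'g::complex_algebra_1 hopf \<Rightarrow> ('m \<Rightarrow> 'g) \<Rightarrow> 'm \<Rightarrow> 'm" where
  "base_star G \<iota> m = inv \<iota> (star G (\<iota> m))"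

definition base_coaction ::
    "'g::complex_algebra_1 hopf \<Rightarrow> ('m::complex_algebra_1 \<Rightarrow> 'g) \<Rightarrow> 'm \<Rightarrow> 'g \<otimes>\<^sub>C 'm" where
  "base_coaction G \<iota> m = inv (tensor_map id \<iota>) (comult G (\<iota> m))"

definition base_plus :: "'g::complex_algebra_1 hopf \<Rightarrow> ('m \<Rightarrow> 'g) \<Rightarrow> 'm set" where
  "base_plus G \<iota> = {m. counit G (\<iota> m) = 0}"

definition base_pos :: "'g::complex_algebra_1 hopf \<Rightarrow> ('m::complex_algebra_1 \<Rightarrow> 'g) \<Rightarrow> 'm set" where
  "base_pos G \<iota> = {x. x \<noteq> 0 \<and> (\<exists>ps :: (real \<times> 'm) list. (\<forall>(l, m)\<in>set ps. 0 \<le> l) \<and>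
      x = (\<Sum>(l, m)\<leftarrow>ps. complex_of_real l *\<^sub>C (m * base_star G \<iota> m)))}"

record (overloaded) ('g, 'm, 'f) bimodule =
  lact :: "'m \<Rightarrow> 'f \<Rightarrow> 'f"
  ract :: "'f \<Rightarrow> 'm \<Rightarrow> 'f"
  coact :: "'f::complex_vector \<Rightarrow> 'g::complex_vector \<otimes>\<^sub>C 'f"

locale covariant_bimodule =
  fixes G :: "'g::complex_algebra_1 hopf" and \<iota> :: "'m::complex_algebra_1 \<Rightarrow> 'g"
    and F :: "('g, 'm, 'f::complex_vector) bimodule"
  assumes lact_bilinear: "cbilinear (lact F)"
    and lact_mult: "lact F (x * y) f = lact F x (lact F y f)"
    and lact_one: "lact F 1 f = f"
    and ract_bilinear: "cbilinear (ract F)"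
    and ract_mult: "ract F f (x * y) = ract F (ract F f x) y"
    and ract_one: "ract F f 1 = f"
    and lact_ract: "lact F x (ract F f y) = ract F (lact F x f) y"
    and coact_comodule: "comodule G (coact F)"
    and coact_lact: "coact F (lact F x f) = tensor_map2 (*) (lact F) (base_coaction G \<iota> x) (coact F f)"
    and coact_ract: "coact F (ract F f x) = tensor_map2 (*) (ract F) (coact F f) (base_coaction G \<iota> x)"
    and finitely_generated: "\<exists>A. finite A \<and> (\<forall>f. \<exists>m. f = (\<Sum>a\<in>A. lact F (m a) a))"
    and plus_condition: "cvec.span {ract F f x | f x. x \<in> base_plus G \<iota>}
      \<subseteq> cvec.span {lact F x f | x f. x \<in> base_plus G \<iota>}"


section \<open>Differential calculi and Kaehler structures\<close>

text \<open>The total algebra of forms is the whole type \<open>'w\<close>, its degree \<open>k\<close> part is \<open>deg \<Omega> k\<close>, and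
  \<open>emb \<Omega>\<close> identifies \<open>M\<close> with the forms of degree \<open>0\<close>.\<close>

record (overloaded) ('g, 'm, 'w) calculus =
  deg :: "nat \<Rightarrow> 'w set"
  emb :: "'m \<Rightarrow> 'w"
  diff :: "'w \<Rightarrow> 'w"
  form_star :: "'w \<Rightarrow> 'w"
  form_coact :: "'w::complex_vector \<Rightarrow> 'g::complex_vector \<otimes>\<^sub>C 'w"

definition form_bimodule ::
    "('g::complex_vector, 'm, 'w::complex_algebra_1) calculus \<Rightarrow> ('g, 'm, 'w) bimodule" where
  "form_bimodule \<Omega> = \<lparr>lact = (\<lambda>m \<omega>. emb \<Omega> m * \<omega>), ract = (\<lambda>\<omega> m. \<omega> * emb \<Omega> m), coact = form_coact \<Omega>\<rparr>"

locale covariant_star_calculus =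
  fixes G :: "'g::complex_algebra_1 hopf" and \<iota> :: "'m::complex_algebra_1 \<Rightarrow> 'g"
    and \<Omega> :: "('g, 'm, 'w::complex_algebra_1) calculus"
  assumes deg_direct_sum: "direct_sum (deg \<Omega>) UNIV UNIV"
    and deg_mult: "\<omega> \<in> deg \<Omega> k \<Longrightarrow> \<nu> \<in> deg \<Omega> l \<Longrightarrow> \<omega> * \<nu> \<in> deg \<Omega> (k + l)"
    and emb_linear: "clinear (emb \<Omega>)"
    and emb_mult: "emb \<Omega> (x * y) = emb \<Omega> x * emb \<Omega> y"
    and emb_one: "emb \<Omega> 1 = 1"
    and emb_inj: "inj (emb \<Omega>)"
    and emb_range: "range (emb \<Omega>) = deg \<Omega> 0"
    and diff_linear: "clinear (diff \<Omega>)"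
    and diff_deg: "\<omega> \<in> deg \<Omega> k \<Longrightarrow> diff \<Omega> \<omega> \<in> deg \<Omega> (Suc k)"
    and diff_diff: "diff \<Omega> (diff \<Omega> \<omega>) = 0"
    and diff_mult: "\<omega> \<in> deg \<Omega> k \<Longrightarrow> diff \<Omega> (\<omega> * \<nu>) = diff \<Omega> \<omega> * \<nu> + (-1) ^ k * \<omega> * diff \<Omega> \<nu>"
    and generated: "\<lbrakk>cvec.subspace A; range (emb \<Omega>) \<subseteq> A; \<And>\<omega> \<nu>. \<omega> \<in> A \<Longrightarrow> \<nu> \<in> A \<Longrightarrow> \<omega> * \<nu> \<in> A;
      \<And>\<omega>. \<omega> \<in> A \<Longrightarrow> diff \<Omega> \<omega> \<in> A\<rbrakk> \<Longrightarrow> A = UNIV"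
    and form_star_antilinear: "antilinear (form_star \<Omega>)"
    and form_star_star: "form_star \<Omega> (form_star \<Omega> \<omega>) = \<omega>"
    and form_star_emb: "form_star \<Omega> (emb \<Omega> x) = emb \<Omega> (base_star G \<iota> x)"
    and form_star_diff: "form_star \<Omega> (diff \<Omega> \<omega>) = diff \<Omega> (form_star \<Omega> \<omega>)"
    and form_star_mult: "\<omega> \<in> deg \<Omega> k \<Longrightarrow> \<nu> \<in> deg \<Omega> l \<Longrightarrow>
      form_star \<Omega> (\<omega> * \<nu>) = (-1) ^ (k * l) * form_star \<Omega> \<nu> * form_star \<Omega> \<omega>"
    and form_bimodule: "covariant_bimodule G \<iota> (form_bimodule \<Omega>)"
    and form_coact_deg: "form_coact \<Omega> ` deg \<Omega> k \<subseteq> subtensor UNIV (deg \<Omega> k)"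
    and form_coact_mult: "form_coact \<Omega> (\<omega> * \<nu>) = tensor_map2 (*) (*) (form_coact \<Omega> \<omega>) (form_coact \<Omega> \<nu>)"
    and form_coact_emb: "form_coact \<Omega> (emb \<Omega> x) = tensor_map id (emb \<Omega>) (base_coaction G \<iota> x)"
    and form_coact_diff: "form_coact \<Omega> (diff \<Omega> \<omega>) = tensor_map id (diff \<Omega>) (form_coact \<Omega> \<omega>)"
    and form_coact_star: "form_coact \<Omega> (form_star \<Omega> \<omega>) =
      tensor_antimap (star G) (form_star \<Omega>) (form_coact \<Omega> \<omega>)"

record 'w complex_str =
  bideg :: "nat \<Rightarrow> nat \<Rightarrow> 'w set"
  del :: "'w \<Rightarrow> 'w"
  delbar :: "'w \<Rightarrow> 'w"

locale complex_structure = covariant_star_calculus G \<iota> \<Omega>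
  for G :: "'g::complex_algebra_1 hopf" and \<iota> :: "'m::complex_algebra_1 \<Rightarrow> 'g"
    and \<Omega> :: "('g, 'm, 'w::complex_algebra_1) calculus" +
  fixes C :: "'w complex_str"
  assumes bideg_direct_sum:
      "direct_sum (\<lambda>(a, b). bideg C a b) {(a, b). a + b = k} (deg \<Omega> k)"
    and bideg_mult: "\<omega> \<in> bideg C a b \<Longrightarrow> \<nu> \<in> bideg C a' b' \<Longrightarrow> \<omega> * \<nu> \<in> bideg C (a + a') (b + b')"
    and bideg_lact: "\<omega> \<in> bideg C a b \<Longrightarrow> emb \<Omega> x * \<omega> \<in> bideg C a b"
    and bideg_ract: "\<omega> \<in> bideg C a b \<Longrightarrow> \<omega> * emb \<Omega> x \<in> bideg C a b"
    and bideg_coact: "form_coact \<Omega> ` bideg C a b \<subseteq> subtensor UNIV (bideg C a b)"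
    and bideg_star: "form_star \<Omega> ` bideg C a b = bideg C b a"
    and del_linear: "clinear (del C)"
    and delbar_linear: "clinear (delbar C)"
    and del_bideg: "\<omega> \<in> bideg C a b \<Longrightarrow> del C \<omega> \<in> bideg C (Suc a) b"
    and delbar_bideg: "\<omega> \<in> bideg C a b \<Longrightarrow> delbar C \<omega> \<in> bideg C a (Suc b)"
    and diff_del_delbar: "diff \<Omega> \<omega> = del C \<omega> + delbar C \<omega>"

locale kaehler_structure = complex_structure G \<iota> \<Omega> C
  for G :: "'g::complex_algebra_1 hopf" and \<iota> :: "'m::complex_algebra_1 \<Rightarrow> 'g"
    and \<Omega> :: "('g, 'm, 'w::complex_algebra_1) calculus" and C :: "'w complex_str" +
  fixes n :: nat and \<kappa> :: 'w
  assumes top_nonzero: "deg \<Omega> (2 * n) \<noteq> {0}"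
    and above_top_zero: "k > 2 * n \<Longrightarrow> deg \<Omega> k = {0}"
    and kappa_bideg: "\<kappa> \<in> bideg C 1 1"
    and kappa_closed: "diff \<Omega> \<kappa> = 0"
    and kappa_central: "\<kappa> * \<omega> = \<omega> * \<kappa>"
    and kappa_real: "form_star \<Omega> \<kappa> = \<kappa>"
    and kappa_coinvariant: "form_coact \<Omega> \<kappa> = 1 \<otimes> \<kappa>"
    and lefschetz_iso: "k < n \<Longrightarrow> bij_betw ((*) \<kappa> ^^ (n - k)) (deg \<Omega> k) (deg \<Omega> (2 * n - k))"

definition primitive :: "('g::complex_vector, 'm, 'w::complex_algebra_1) calculus \<Rightarrow> nat \<Rightarrow> 'w \<Rightarrow> nat \<Rightarrow> 'w set" where
  "primitive \<Omega> n \<kappa> k = (if k \<le> n then {\<alpha> \<in> deg \<Omega> k. ((*) \<kappa> ^^ (n - k + 1)) \<alpha> = 0} else {0})"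

definition hodge ::
    "('g::complex_vector, 'm, 'w::complex_algebra_1) calculus \<Rightarrow> 'w complex_str \<Rightarrow> nat \<Rightarrow> 'w \<Rightarrow> 'w \<Rightarrow> 'w" where
  "hodge \<Omega> C n \<kappa> = (THE T. clinear T \<and>
     (\<forall>a b j. \<forall>\<alpha> \<in> primitive \<Omega> n \<kappa> (a + b) \<inter> bideg C a b. a + b + j \<le> n \<longrightarrow>
        T (((*) \<kappa> ^^ j) \<alpha>) =
          ((-1) ^ ((a + b) * (a + b + 1) div 2) * \<i> powi (int a - int b)
             * (fact j / fact (n - j - (a + b)))) *\<^sub>C ((*) \<kappa> ^^ (n - j - (a + b))) \<alpha>))"

definition vol ::
    "('g::complex_vector, 'm, 'w::complex_algebra_1) calculus \<Rightarrow> 'w complex_str \<Rightarrow> nat \<Rightarrow> 'w \<Rightarrow> 'w \<Rightarrow> 'm" where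
  "vol \<Omega> C n \<kappa> \<omega> = inv (emb \<Omega>) (hodge \<Omega> C n \<kappa> (component (deg \<Omega>) UNIV (2 * n) \<omega>))"

definition kaehler_positive_definite ::
    "'g::complex_algebra_1 hopf \<Rightarrow> ('m::complex_algebra_1 \<Rightarrow> 'g) \<Rightarrow> ('g, 'm, 'w::complex_algebra_1) calculus
      \<Rightarrow> 'w complex_str \<Rightarrow> nat \<Rightarrow> 'w \<Rightarrow> bool" where
  "kaehler_positive_definite G \<iota> \<Omega> C n \<kappa> \<longleftrightarrow>
     (\<forall>\<omega>. \<omega> \<noteq> 0 \<longrightarrow> vol \<Omega> C n \<kappa> (\<omega> * hodge \<Omega> C n \<kappa> (form_star \<Omega> \<omega>)) \<in> base_pos G \<iota>)"

definition integral_closed ::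
    "'g::complex_algebra_1 hopf \<Rightarrow> ('m \<Rightarrow> 'g) \<Rightarrow> ('g, 'm, 'w::complex_algebra_1) calculus
      \<Rightarrow> 'w complex_str \<Rightarrow> nat \<Rightarrow> 'w \<Rightarrow> bool" where
  "integral_closed G \<iota> \<Omega> C n \<kappa> \<longleftrightarrow>
     (\<forall>k. \<forall>\<omega> \<in> deg \<Omega> k. Suc k = 2 * n \<longrightarrow> haar G (\<iota> (vol \<Omega> C n \<kappa> (diff \<Omega> \<omega>))) = 0)"


section \<open>Balanced tensor products\<close>

text \<open>The map \<open>\<tau>\<close> exhibits the type \<open>'e\<close> as the tensor product of the subspaces \<open>A\<close> and \<open>B\<close> over
  the algebra \<open>'m\<close> acting by \<open>r\<close> on \<open>A\<close> from the right and by \<open>l\<close> on \<open>B\<close> from the left: it induces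
  an isomorphism from the quotient of \<open>A \<otimes> B\<close> by the span of the elements
  \<open>(a m) \<otimes> b - a \<otimes> (m b)\<close> onto \<open>'e\<close>.  Values of \<open>\<tau>\<close> off \<open>A \<times> B\<close> are irrelevant.\<close>

locale balanced_tensor_product =
  fixes A :: "'a::complex_vector set" and B :: "'b::complex_vector set"
    and r :: "'a \<Rightarrow> 'm \<Rightarrow> 'a" and l :: "'m \<Rightarrow> 'b \<Rightarrow> 'b"
    and \<tau> :: "'a \<Rightarrow> 'b \<Rightarrow> 'e::complex_vector"
  assumes add_left: "\<lbrakk>a \<in> A; a' \<in> A; b \<in> B\<rbrakk> \<Longrightarrow> \<tau> (a + a') b = \<tau> a b + \<tau> a' b"
    and add_right: "\<lbrakk>a \<in> A; b \<in> B; b' \<in> B\<rbrakk> \<Longrightarrow> \<tau> a (b + b') = \<tau> a b + \<tau> a b'"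
    and scale_left: "\<lbrakk>a \<in> A; b \<in> B\<rbrakk> \<Longrightarrow> \<tau> (c *\<^sub>C a) b = c *\<^sub>C \<tau> a b"
    and scale_right: "\<lbrakk>a \<in> A; b \<in> B\<rbrakk> \<Longrightarrow> \<tau> a (c *\<^sub>C b) = c *\<^sub>C \<tau> a b"
    and onto: "\<exists>ps. set ps \<subseteq> A \<times> B \<and> x = (\<Sum>(a, b)\<leftarrow>ps. \<tau> a b)"
    and kernel: "set ps \<subseteq> A \<times> B \<Longrightarrow> (\<Sum>(a, b)\<leftarrow>ps. \<tau> a b) = 0 \<longleftrightarrow>
      (\<Sum>(a, b)\<leftarrow>ps. a \<otimes> b) \<in> cvec.span {r a m \<otimes> b - a \<otimes> l m b | a b m. a \<in> A \<and> b \<in> B}"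

definition form_tensor_product ::
    "('g::complex_algebra_1, 'm, 'w::complex_algebra_1) calculus \<Rightarrow> ('g, 'm, 'f::complex_vector) bimodule
      \<Rightarrow> ('w \<Rightarrow> 'f \<Rightarrow> 'e::complex_vector) \<Rightarrow> bool" where
  "form_tensor_product \<Omega> F \<tau> \<longleftrightarrow> balanced_tensor_product UNIV UNIV (\<lambda>\<omega> m. \<omega> * emb \<Omega> m) (lact F) \<tau>"

definition form_tensor_coact ::
    "('g::complex_algebra_1, 'm, 'w::complex_algebra_1) calculus \<Rightarrow> ('g, 'm, 'f::complex_vector) bimodule
      \<Rightarrow> ('w \<Rightarrow> 'f \<Rightarrow> 'e::complex_vector) \<Rightarrow> 'e \<Rightarrow> 'g \<otimes>\<^sub>C 'e" where
  "form_tensor_coact \<Omega> F \<tau> = (THE T. clinear T \<and>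
     (\<forall>\<omega> f. T (\<tau> \<omega> f) = tensor_map2 (*) \<tau> (form_coact \<Omega> \<omega>) (coact F f)))"

definition form_wedge :: "('w::complex_algebra_1 \<Rightarrow> 'f \<Rightarrow> 'e::complex_vector) \<Rightarrow> 'w \<Rightarrow> 'e \<Rightarrow> 'e" where
  "form_wedge \<tau> \<omega> = (THE T. clinear T \<and> (\<forall>\<nu> f. T (\<tau> \<nu> f) = \<tau> (\<omega> * \<nu>) f))"


section \<open>Holomorphic and Hermitian vector bundles\<close>

definition delbar_extension ::
    "('g::complex_vector, 'm, 'w::complex_algebra_1) calculus \<Rightarrow> 'w complex_str
      \<Rightarrow> ('w \<Rightarrow> 'f \<Rightarrow> 'e::complex_vector) \<Rightarrow> ('f \<Rightarrow> 'e) \<Rightarrow> 'e \<Rightarrow> 'e" where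
  "delbar_extension \<Omega> C \<tau> D = (THE T. clinear T \<and>
     (\<forall>k. \<forall>\<omega> \<in> deg \<Omega> k. \<forall>f. T (\<tau> \<omega> f) = \<tau> (delbar C \<omega>) f + (-1) ^ k *\<^sub>C form_wedge \<tau> \<omega> (D f)))"

locale holomorphic_structure =
  fixes \<Omega> :: "('g::complex_algebra_1, 'm::complex_algebra_1, 'w::complex_algebra_1) calculus"
    and C :: "'w complex_str"
    and F :: "('g, 'm, 'f::complex_vector) bimodule"
    and \<tau> :: "'w \<Rightarrow> 'f \<Rightarrow> 'e::complex_vector" and D :: "'f \<Rightarrow> 'e"
  assumes values_in: "D f \<in> cvec.span {\<tau> \<omega> f' | \<omega> f'. \<omega> \<in> bideg C 0 1}"
    and equivariant: "comodule_map (coact F) (form_tensor_coact \<Omega> F \<tau>) D"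
    and leibniz: "D (lact F m f) = \<tau> (delbar C (emb \<Omega> m)) f + form_wedge \<tau> (emb \<Omega> m) (D f)"
    and flat: "delbar_extension \<Omega> C \<tau> D (delbar_extension \<Omega> C \<tau> D e) = 0"

definition dual_module ::
    "('g::complex_vector, 'm::complex_algebra_1, 'f::complex_vector) bimodule \<Rightarrow> ('f \<Rightarrow> 'm) set" where
  "dual_module F = {\<phi>. clinear \<phi> \<and> (\<forall>m f. \<phi> (lact F m f) = m * \<phi> f)}"

definition dual_ract :: "('f \<Rightarrow> 'm::complex_algebra_1) \<Rightarrow> 'm \<Rightarrow> 'f \<Rightarrow> 'm" where
  "dual_ract \<phi> m = (\<lambda>f. \<phi> f * m)"

text \<open>The unique element \<open>\<phi>\<^sub>(\<^sub>-\<^sub>1\<^sub>) \<otimes> \<phi>\<^sub>(\<^sub>0\<^sub>)\<close> such that, for all \<open>f\<close>,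
  \<open>\<phi>\<^sub>(\<^sub>-\<^sub>1\<^sub>) \<otimes> \<phi>\<^sub>(\<^sub>0\<^sub>) f = S f\<^sub>(\<^sub>-\<^sub>1\<^sub>) (\<phi> f\<^sub>(\<^sub>0\<^sub>))\<^sub>(\<^sub>-\<^sub>1\<^sub>) \<otimes> (\<phi> f\<^sub>(\<^sub>0\<^sub>))\<^sub>(\<^sub>0\<^sub>)\<close>.\<close>

definition dual_coact ::
    "'g::complex_algebra_1 hopf \<Rightarrow> ('m::complex_algebra_1 \<Rightarrow> 'g) \<Rightarrow> ('g, 'm, 'f::complex_vector) bimodule
      \<Rightarrow> ('f \<Rightarrow> 'm) \<Rightarrow> 'g \<otimes>\<^sub>C ('f \<Rightarrow> 'm)" where
  "dual_coact G \<iota> F \<phi> = (THE t. t \<in> subtensor UNIV (dual_module F) \<and>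
     (\<forall>f. tensor_map id (\<lambda>\<psi>. \<psi> f) t =
        tlift (\<lambda>g f'. tensor_map (\<lambda>x. antipode G g * x) id (base_coaction G \<iota> (\<phi> f'))) (coact F f)))"

definition conj_ract ::
    "'g::complex_algebra_1 hopf \<Rightarrow> ('m \<Rightarrow> 'g) \<Rightarrow> ('g, 'm, 'f::complex_vector) bimodule
      \<Rightarrow> 'f conj_space \<Rightarrow> 'm \<Rightarrow> 'f conj_space" where
  "conj_ract G \<iota> F x m = Conj (lact F (base_star G \<iota> m) (unConj x))"

definition conj_coact ::
    "'g::complex_algebra_1 hopf \<Rightarrow> ('g, 'm, 'f::complex_vector) bimodule
      \<Rightarrow> 'f conj_space \<Rightarrow> 'g \<otimes>\<^sub>C 'f conj_space" where
  "conj_coact G F x = tensor_antimap (star G) Conj (coact F (unConj x))"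

locale hermitian_structure =
  fixes G :: "'g::complex_algebra_1 hopf" and \<iota> :: "'m::complex_algebra_1 \<Rightarrow> 'g"
    and F :: "('g, 'm, 'f::complex_vector) bimodule"
    and h :: "'f conj_space \<Rightarrow> ('f \<Rightarrow> 'm)"
  assumes bijective: "bij_betw h UNIV (dual_module F)"
    and right_linear: "h (conj_ract G \<iota> F x m) = dual_ract (h x) m"
    and equivariant: "comodule_map (conj_coact G F) (dual_coact G \<iota> F) h"
    and symmetric: "h (Conj f) g = base_star G \<iota> (h (Conj g) f)"

definition hermitian_positive_definite ::
    "'g::complex_algebra_1 hopf \<Rightarrow> ('m::complex_algebra_1 \<Rightarrow> 'g) \<Rightarrow> ('f::complex_vector conj_space \<Rightarrow> ('f \<Rightarrow> 'm))
      \<Rightarrow> bool" where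
  "hermitian_positive_definite G \<iota> h \<longleftrightarrow> (\<forall>f. f \<noteq> 0 \<longrightarrow> h (Conj f) f \<in> base_pos G \<iota>)"

definition dual_tensor_product ::
    "('g::complex_algebra_1, 'm::complex_algebra_1, 'w::complex_algebra_1) calculus
      \<Rightarrow> ('g, 'm, 'f::complex_vector) bimodule
      \<Rightarrow> (('f \<Rightarrow> 'm) \<Rightarrow> 'w \<Rightarrow> 'd::complex_vector) \<Rightarrow> bool" where
  "dual_tensor_product \<Omega> F \<tau>' \<longleftrightarrow>
     balanced_tensor_product (dual_module F) UNIV dual_ract (\<lambda>m \<omega>. emb \<Omega> m * \<omega>) \<tau>'"

definition ev_wedge ::
    "('g::complex_algebra_1, 'm::complex_algebra_1, 'w::complex_algebra_1) calculus
      \<Rightarrow> ('g, 'm, 'f::complex_vector) bimodule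
      \<Rightarrow> ('w \<Rightarrow> 'f \<Rightarrow> 'e::complex_vector) \<Rightarrow> (('f \<Rightarrow> 'm) \<Rightarrow> 'w \<Rightarrow> 'd::complex_vector)
      \<Rightarrow> 'e \<Rightarrow> 'd \<Rightarrow> 'w" where
  "ev_wedge \<Omega> F \<tau> \<tau>' = (THE \<beta>. cbilinear \<beta> \<and>
     (\<forall>\<omega> f \<nu>. \<forall>\<phi> \<in> dual_module F. \<beta> (\<tau> \<omega> f) (\<tau>' \<phi> \<nu>) = \<omega> * emb \<Omega> (\<phi> f) * \<nu>))"

definition hodge_bundle ::
    "('g::complex_algebra_1, 'm::complex_algebra_1, 'w::complex_algebra_1) calculus
      \<Rightarrow> 'w complex_str \<Rightarrow> nat \<Rightarrow> 'w
      \<Rightarrow> ('w \<Rightarrow> 'f::complex_vector \<Rightarrow> 'e::complex_vector) \<Rightarrow> (('f \<Rightarrow> 'm) \<Rightarrow> 'w \<Rightarrow> 'd::complex_vector)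
      \<Rightarrow> ('f conj_space \<Rightarrow> ('f \<Rightarrow> 'm)) \<Rightarrow> 'e \<Rightarrow> 'd" where
  "hodge_bundle \<Omega> C n \<kappa> \<tau> \<tau>' h = (THE T. antilinear T \<and>
     (\<forall>\<omega> f. T (\<tau> \<omega> f) = \<tau>' (h (Conj f)) (hodge \<Omega> C n \<kappa> (form_star \<Omega> \<omega>))))"

definition bundle_inner ::
    "'g::complex_algebra_1 hopf \<Rightarrow> ('m::complex_algebra_1 \<Rightarrow> 'g)
      \<Rightarrow> ('g, 'm, 'w::complex_algebra_1) calculus \<Rightarrow> 'w complex_str \<Rightarrow> nat \<Rightarrow> 'w
      \<Rightarrow> ('g, 'm, 'f::complex_vector) bimodule
      \<Rightarrow> ('w \<Rightarrow> 'f \<Rightarrow> 'e::complex_vector) \<Rightarrow> (('f \<Rightarrow> 'm) \<Rightarrow> 'w \<Rightarrow> 'd::complex_vector)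
      \<Rightarrow> ('f conj_space \<Rightarrow> ('f \<Rightarrow> 'm)) \<Rightarrow> 'e \<Rightarrow> 'e \<Rightarrow> complex" where
  "bundle_inner G \<iota> \<Omega> C n \<kappa> F \<tau> \<tau>' h \<alpha> \<beta> =
     haar G (\<iota> (vol \<Omega> C n \<kappa> (ev_wedge \<Omega> F \<tau> \<tau>' \<alpha> (hodge_bundle \<Omega> C n \<kappa> \<tau> \<tau>' h \<beta>))))"

text \<open>For a positive definite inner product the adjoint is unique where it exists; its existence is
  not built into the definition.\<close>

definition adjoint_op :: "('e \<Rightarrow> 'e \<Rightarrow> complex) \<Rightarrow> ('e \<Rightarrow> 'e) \<Rightarrow> 'e \<Rightarrow> 'e" where
  "adjoint_op ip T \<beta> = (THE \<gamma>. \<forall>\<alpha>. ip (T \<alpha>) \<beta> = ip \<alpha> \<gamma>)"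

definition dirac ::
    "'g::complex_algebra_1 hopf \<Rightarrow> ('m::complex_algebra_1 \<Rightarrow> 'g)
      \<Rightarrow> ('g, 'm, 'w::complex_algebra_1) calculus \<Rightarrow> 'w complex_str \<Rightarrow> nat \<Rightarrow> 'w
      \<Rightarrow> ('g, 'm, 'f::complex_vector) bimodule
      \<Rightarrow> ('w \<Rightarrow> 'f \<Rightarrow> 'e::complex_vector) \<Rightarrow> (('f \<Rightarrow> 'm) \<Rightarrow> 'w \<Rightarrow> 'd::complex_vector)
      \<Rightarrow> ('f conj_space \<Rightarrow> ('f \<Rightarrow> 'm)) \<Rightarrow> ('f \<Rightarrow> 'e) \<Rightarrow> 'e \<Rightarrow> 'e" where
  "dirac G \<iota> \<Omega> C n \<kappa> F \<tau> \<tau>' h D e =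
     delbar_extension \<Omega> C \<tau> D e +
     adjoint_op (bundle_inner G \<iota> \<Omega> C n \<kappa> F \<tau> \<tau>' h) (delbar_extension \<Omega> C \<tau> D) e"

end

theory Submission
  imports Defs "HOL-Computational_Algebra.Fundamental_Theorem_Algebra"
begin

text \<open>
  A linear functional \<open>p\<close> on the quantum group acts on the comodule \<open>\<E> = \<Omega> \<otimes>\<^sub>M \<F>\<close> by
  \<open>e \<mapsto> p(e\<^sub>(\<^sub>-\<^sub>1\<^sub>)) e\<^sub>(\<^sub>0\<^sub>)\<close>, and these operators commute with the Dolbeault operator. For
  \<open>p = h(\<cdot> b)\<close> the operator has finite rank: by invariance of \<open>h\<close>,
  \<open>h(g\<^sub>(\<^sub>1\<^sub>) b) g\<^sub>(\<^sub>2\<^sub>) = h(g b\<^sub>(\<^sub>1\<^sub>)) S(b\<^sub>(\<^sub>2\<^sub>))\<close>, which confines the coefficients over finitely many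
  generators of \<open>\<E>\<close> to a finite-dimensional space. As \<open>h\<close> is faithful, every functional on a
  finite-dimensional subspace of the quantum group has the form \<open>h(\<cdot> b)\<close>, so every element of \<open>\<E>\<close>
  is fixed by such an operator. Invariance of the inner product makes the adjoint of an operator of
  this kind again the action of a functional; hence the adjoint of the Dolbeault operator exists,
  and \<open>\<E>\<close> is a union of finite-dimensional subspaces invariant under the Dirac operator, on which
  it is symmetric.

  Positivity of the inner product is checked in the fibre over the counit: there \<open>\<Omega> M\<^sup>+ \<subseteq> M\<^sup>+ \<Omega>\<close>
  makes it a tensor product of two semidefinite forms, and invariance transports the result to
  \<open>\<E>\<close>. Definiteness uses a finite dual basis of \<open>\<F>\<close>, obtained by averaging rank-one operators
  with \<open>h\<close>.
\<close>

section \<open>Linear maps and tensors\<close>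

text \<open>In infinite dimension a symmetric operator need not have eigenvectors, and
  \<open>adjoint_op\<close> is a definite description that says nothing before an adjoint is found.
  An invariant finite-dimensional subspace alone does not help: its orthogonal complement must be
  invariant too, which is why the adjoint of a functional's action has to be an action again.
  Positivity is not inherited factor by factor. The pairing of \<open>\<tau> \<omega> f\<close> with
  \<open>\<tau> \<nu> g\<close> has the function \<open>pairing f g\<close> between two forms, while
  positivity is assumed for single forms and single sections. At the counit that function becomes a
  number, and what is left is Schur's theorem on entrywise products of semidefinite matrices. The
  price is degeneracy: forms in the fibre vanish on multiples by M^+, so definiteness has to be
  regained from faithfulness of the Haar functional. Most operators, such as \<open>hodge\<close>,
  \<open>ev_wedge\<close> and \<open>dual_coact\<close>, are definite descriptions as well;
  existence and uniqueness come before any use.\<close>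

global_interpretation cvp: vector_space_pair
  "scaleC :: complex \<Rightarrow> 'a \<Rightarrow> 'a::complex_vector" "scaleC :: complex \<Rightarrow> 'b \<Rightarrow> 'b::complex_vector"
  by unfold_locales

lemmas clinear_add = cvp.linear_add
  and clinear_scale = cvp.linear_scale
  and clinear_0 = cvp.linear_0
  and clinear_sum = cvp.linear_sum
  and clinear_diff = cvp.linear_diff
  and clinear_neg = cvp.linear_neg

lemmas clinear_simps = clinear_add clinear_scale clinear_0 clinear_sum clinear_diff clinear_neg

text \<open>Every use of \<open>tlift\<close> carries linearity side conditions; these closure rules
  let \<open>intro clin\<close> discharge them. Most are phrased for composites so that they apply
  below an abstraction.\<close>

named_theorems clin

lemma clinearI:
  "(\<And>x y. f (x + y) = f x + f y) \<Longrightarrow> (\<And>c x. f (c *\<^sub>C x) = c *\<^sub>C f x) \<Longrightarrow> clinear f"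
  by (simp add: clinear_iff)

lemma cbilinearI [clin]:
  "(\<And>a. clinear (\<beta> a)) \<Longrightarrow> (\<And>b. clinear (\<lambda>a. \<beta> a b)) \<Longrightarrow> cbilinear \<beta>"
  by (simp add: cbilinear_def)

lemma cbilinear_right: "cbilinear \<beta> \<Longrightarrow> clinear (\<beta> a)"
  and cbilinear_left: "cbilinear \<beta> \<Longrightarrow> clinear (\<lambda>a. \<beta> a b)"
  by (simp_all add: cbilinear_def)

lemma clinear_comp: "clinear g \<Longrightarrow> clinear f \<Longrightarrow> clinear (\<lambda>x. g (f x))"
  by (simp add: clinear_iff)

lemma cbilinear_comp_left: "cbilinear \<beta> \<Longrightarrow> clinear f \<Longrightarrow> clinear (\<lambda>x. \<beta> (f x) b)"
  by (simp add: clinear_iff cbilinear_def)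

lemma cbilinear_comp_right: "cbilinear \<beta> \<Longrightarrow> clinear f \<Longrightarrow> clinear (\<lambda>x. \<beta> a (f x))"
  by (simp add: clinear_iff cbilinear_def)

lemma scaleC_complex: "c *\<^sub>C (d::complex) = c * d"
  by (simp add: scaleC_complex_def)

lemma scaleC_fun_apply [simp]: "(c *\<^sub>C f) x = c *\<^sub>C f x"
  by (simp add: scaleC_fun_def)

lemma clinear_ident [clin]: "clinear (\<lambda>x. x)"
  and clinear_zero [clin]: "clinear (\<lambda>x. 0)"
  by (simp_all add: clinear_iff)

lemma clinear_id_const [clin]: "clinear id"
  by (simp add: clinear_iff)

lemma clinear_plus [clin]: "clinear f \<Longrightarrow> clinear g \<Longrightarrow> clinear (\<lambda>x. f x + g x)"
  by (simp add: clinear_iff scaleC_add_right algebra_simps)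

lemma clinear_minus [clin]: "clinear f \<Longrightarrow> clinear g \<Longrightarrow> clinear (\<lambda>x. f x - g x)"
  by (simp add: clinear_iff cvec.scale_right_diff_distrib algebra_simps)

lemma clinear_scaleC_right [clin]: "clinear f \<Longrightarrow> clinear (\<lambda>x. c *\<^sub>C f x)"
  by (simp add: clinear_iff scaleC_add_right scaleC_scaleC mult.commute)

lemma clinear_scaleC_left [clin]: "clinear f \<Longrightarrow> clinear (\<lambda>x. f x *\<^sub>C v)"
  by (simp add: clinear_iff scaleC_add_left scaleC_scaleC scaleC_complex)

lemma clinear_mult_left [clin]: "clinear f \<Longrightarrow> clinear (\<lambda>x. f x * b)"
  and clinear_mult_right [clin]: "clinear f \<Longrightarrow> clinear (\<lambda>x. b * f x)" for b :: "'a::complex_algebra_1"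
  by (simp_all add: clinear_iff algebra_simps mult_scaleC_left mult_scaleC_right)

lemma clinear_setsum [clin]: "(\<And>i. clinear (\<lambda>x. f x i)) \<Longrightarrow> clinear (\<lambda>x. \<Sum>i\<in>I. f x i)"
  by (rule clinearI) (simp_all add: clinear_iff sum.distrib cvec.scale_sum_right)

lemma clinear_fun [clin]: "(\<And>b. clinear (\<lambda>x. f x b)) \<Longrightarrow> clinear f"
  by (simp add: clinear_iff fun_eq_iff)

section \<open>The algebraic tensor product\<close>

lemma tens_add_left: "(a + a') \<otimes> b = a \<otimes> b + a' \<otimes> b"
proof transfer
  fix a a' b
  have "Poly_Mapping.single (a + a', b) 1 - Poly_Mapping.single (a, b) 1 - Poly_Mapping.single (a', b) 1
      \<in> tensor_relations"
    unfolding tensor_relations_def by (rule cvec.span_base) blast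
  then show "Poly_Mapping.single (a + a', b) (1::complex)
      - (Poly_Mapping.single (a, b) 1 + Poly_Mapping.single (a', b) 1) \<in> tensor_relations"
    by (simp add: algebra_simps)
qed

lemma tens_add_right: "a \<otimes> (b + b') = a \<otimes> b + a \<otimes> b'"
proof transfer
  fix a b b'
  have "Poly_Mapping.single (a, b + b') 1 - Poly_Mapping.single (a, b) 1 - Poly_Mapping.single (a, b') 1
      \<in> tensor_relations"
    unfolding tensor_relations_def by (rule cvec.span_base) blast
  then show "Poly_Mapping.single (a, b + b') (1::complex)
      - (Poly_Mapping.single (a, b) 1 + Poly_Mapping.single (a, b') 1) \<in> tensor_relations"
    by (simp add: algebra_simps)
qed

lemma tens_scale_left: "(c *\<^sub>C a) \<otimes> b = c *\<^sub>C (a \<otimes> b)"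
  by transfer (unfold tensor_relations_def, rule cvec.span_base, blast)

lemma tens_scale_right: "a \<otimes> (c *\<^sub>C b) = c *\<^sub>C (a \<otimes> b)"
  by transfer (unfold tensor_relations_def, rule cvec.span_base, blast)

lemma clinear_tens_left [clin]: "clinear f \<Longrightarrow> clinear (\<lambda>x. f x \<otimes> b)"
  and clinear_tens_right [clin]: "clinear g \<Longrightarrow> clinear (\<lambda>x. a \<otimes> g x)"
  by (simp_all add: clinear_iff tens_add_left tens_add_right tens_scale_left tens_scale_right)

lemma tens_sum_left: "(\<Sum>i\<in>I. a i) \<otimes> b = (\<Sum>i\<in>I. a i \<otimes> b)"
  by (rule clinear_sum) (intro clin)

lemma tens_sum_right: "a \<otimes> (\<Sum>i\<in>I. b i) = (\<Sum>i\<in>I. a \<otimes> b i)"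
  by (rule clinear_sum) (intro clin)

lemma tens_zero [simp]: "0 \<otimes> b = 0" "a \<otimes> 0 = 0"
  using clinear_0[OF clinear_tens_left[OF clinear_ident]] clinear_0[OF clinear_tens_right[OF clinear_ident]]
  by auto

lemma clinear_tlift_arg [clin]: "cbilinear \<mu> \<Longrightarrow> clinear f \<Longrightarrow> clinear (\<lambda>x. tlift \<mu> (f x))"
  by (rule clinear_comp[OF clinear_tlift])

text \<open>For a fixed tensor, \<open>tlift\<close> is one finite sum over a chosen representative,
  so it is linear in its integrand even where the integrand is not bilinear.\<close>

lemma clinear_tlift_fun [clin]:
  "(\<And>a b. clinear (\<lambda>x. \<mu> x a b)) \<Longrightarrow> clinear (\<lambda>x. tlift (\<lambda>a b. \<mu> x a b) t)"
  unfolding tlift_def free_lift_def by (intro clin)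

lemma poly_mapping_finite_sum:
  fixes p :: "'a \<Rightarrow>\<^sub>0 complex"
  shows "p = (\<Sum>x\<in>Poly_Mapping.keys p. Poly_Mapping.lookup p x *\<^sub>C Poly_Mapping.single x 1)"
proof (rule poly_mapping_eqI)
  fix k
  have "Poly_Mapping.lookup (\<Sum>x\<in>Poly_Mapping.keys p. Poly_Mapping.lookup p x *\<^sub>C Poly_Mapping.single x 1) k
      = (\<Sum>x\<in>Poly_Mapping.keys p. if x = k then Poly_Mapping.lookup p x else 0)"
    by (simp add: lookup_sum lookup_scaleC scaleC_complex lookup_single when_def if_distrib cong: if_cong)
  also have "\<dots> = Poly_Mapping.lookup p k"
    by (simp add: in_keys_iff)
  finally show "Poly_Mapping.lookup p k
      = Poly_Mapping.lookup (\<Sum>x\<in>Poly_Mapping.keys p. Poly_Mapping.lookup p x *\<^sub>C Poly_Mapping.single x 1) k"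
    by simp
qed

lemma abs_tensor_sum: "abs_tensor (\<Sum>i\<in>I. f i) = (\<Sum>i\<in>I. abs_tensor (f i))"
  by (induction I rule: infinite_finite_induct)
    (simp_all add: zero_tensor.abs_eq[symmetric] plus_tensor.abs_eq[symmetric])

text \<open>The index type is fixed to \<open>nat\<close> because an existential cannot range over
  types; expansions of different tensors can then be chosen uniformly.\<close>

lemma tensor_finite_sum:
  obtains I :: "nat set" and a x where "finite I" "t = (\<Sum>i\<in>I. a i \<otimes> x i)"
proof -
  obtain p where p: "t = abs_tensor p"
    by (metis Quotient_abs_rep[OF Quotient_tensor])
  have "t = (\<Sum>z\<in>Poly_Mapping.keys p. abs_tensor (Poly_Mapping.lookup p z *\<^sub>C Poly_Mapping.single z 1))"
    unfolding p by (subst poly_mapping_finite_sum) (rule abs_tensor_sum)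
  then have "t = (\<Sum>z\<in>Poly_Mapping.keys p. (Poly_Mapping.lookup p z *\<^sub>C fst z) \<otimes> snd z)"
    by (simp add: scaleC_tensor.abs_eq[symmetric] tens.abs_eq tens_scale_left[unfolded tens.abs_eq])
  moreover obtain h :: "nat \<Rightarrow> _" and I where "bij_betw h I (Poly_Mapping.keys p)" "finite I"
    using ex_bij_betw_nat_finite[OF finite_keys] by (metis finite_atLeastLessThan)
  ultimately have "t = (\<Sum>i\<in>I. (Poly_Mapping.lookup p (h i) *\<^sub>C fst (h i)) \<otimes> snd (h i))"
    using sum.reindex_bij_betw[of h I "Poly_Mapping.keys p" "\<lambda>z. (Poly_Mapping.lookup p z *\<^sub>C fst z) \<otimes> snd z"] by simp
  with \<open>finite I\<close> show thesis by (rule that)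
qed

lemma tensor_induct [case_names tens plus]:
  assumes "\<And>a b. P (a \<otimes> b)" and "\<And>s t. P s \<Longrightarrow> P t \<Longrightarrow> P (s + t)"
  shows "P t"
proof -
  obtain I a x where I: "finite (I::nat set)" and t: "t = (\<Sum>i\<in>I. a i \<otimes> x i)"
    by (rule tensor_finite_sum)
  from I have "P (\<Sum>i\<in>I. a i \<otimes> x i)"
  proof (induction I)
    case empty
    then show ?case using assms(1)[of 0 0] by simp
  next
    case (insert i I)
    then show ?case by (simp add: assms)
  qed
  then show ?thesis by (simp add: t)
qed

lemma clinear_eq_tensor:
  assumes "clinear f" "clinear g" "\<And>a b. f (a \<otimes> b) = g (a \<otimes> b)"
  shows "f t = g t"
  by (induction t rule: tensor_induct) (simp_all add: assms clinear_add)

lemma tlift_add: "cbilinear \<mu> \<Longrightarrow> tlift \<mu> (s + t) = tlift \<mu> s + tlift \<mu> t"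
  and tlift_scale: "cbilinear \<mu> \<Longrightarrow> tlift \<mu> (c *\<^sub>C t) = c *\<^sub>C tlift \<mu> t"
  and tlift_zero: "cbilinear \<mu> \<Longrightarrow> tlift \<mu> 0 = 0"
  and tlift_sum: "cbilinear \<mu> \<Longrightarrow> tlift \<mu> (\<Sum>i\<in>I. f i) = (\<Sum>i\<in>I. tlift \<mu> (f i))"
  by (simp_all add: clinear_simps clinear_tlift)

lemma clinear_tlift_push: "clinear f \<Longrightarrow> f (tlift \<mu> t) = tlift (\<lambda>a b. f (\<mu> a b)) t"
  by (simp add: tlift_def free_lift_def clinear_simps)

text \<open>Fubini for iterated contractions. Bilinearity is asked for in the inner variables; the
  outer tensor stays a fixed finite sum.\<close>

lemma tlift_tlift_swap:
  assumes "\<And>a b. cbilinear (\<mu> a b)" 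
  shows "tlift (\<lambda>a b. tlift (\<mu> a b) t) s = tlift (\<lambda>c e. tlift (\<lambda>a b. \<mu> a b c e) s) t"
proof -
  have "clinear (\<lambda>c. \<mu> a b c e)" "clinear (\<lambda>e. \<mu> a b c e)" for a b c e
    using assms by (simp_all add: cbilinear_def)
  note [clin] = this
  show ?thesis
    by (rule clinear_eq_tensor[of "\<lambda>t. tlift (\<lambda>a b. tlift (\<mu> a b) t) s"])
      ((intro clin assms)+, simp add: tlift_tens assms cbilinearI clin)
qed

lemma tensor_map2_tens:
  assumes "cbilinear p" "cbilinear q"
  shows "tensor_map2 p q (a \<otimes> b) (c \<otimes> e) = p a c \<otimes> q b e"
proof -
  note [clin] = cbilinear_comp_left[OF assms(1)] cbilinear_comp_left[OF assms(2)]
    cbilinear_comp_right[OF assms(1)] cbilinear_comp_right[OF assms(2)]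
  show ?thesis
    unfolding tensor_map2_def by (subst tlift_tens, intro clin)+ (rule refl)
qed

lemma cbilinear_tensor_map2:
  assumes "cbilinear p" "cbilinear q"
  shows "cbilinear (tensor_map2 p q)"
proof -
  note [clin] = cbilinear_comp_left[OF assms(1)] cbilinear_comp_left[OF assms(2)]
    cbilinear_comp_right[OF assms(1)] cbilinear_comp_right[OF assms(2)]
  show ?thesis
    unfolding tensor_map2_def by (intro clin)
qed

lemma clinear_tensor_map2_left: "\<lbrakk>cbilinear p; cbilinear q; clinear f\<rbrakk> \<Longrightarrow> clinear (\<lambda>x. tensor_map2 p q (f x) t)"
  by (rule cbilinear_comp_left[OF cbilinear_tensor_map2])

lemma clinear_tensor_map2_right: "\<lbrakk>cbilinear p; cbilinear q; clinear f\<rbrakk> \<Longrightarrow> clinear (\<lambda>x. tensor_map2 p q t (f x))"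
  by (rule cbilinear_comp_right[OF cbilinear_tensor_map2])

lemma tensor_map2_sums:
  assumes "cbilinear p" "cbilinear q"
  shows "tensor_map2 p q (\<Sum>i\<in>I. a i \<otimes> b i) (\<Sum>j\<in>J. c j \<otimes> e j) = (\<Sum>i\<in>I. \<Sum>j\<in>J. p (a i) (c j) \<otimes> q (b i) (e j))"
  by (subst clinear_sum[OF clinear_tensor_map2_left[OF assms clinear_ident]],
      subst clinear_sum[OF clinear_tensor_map2_right[OF assms clinear_ident]])
    (simp add: tensor_map2_tens[OF assms])

lemma cbilinear_map: "clinear f \<Longrightarrow> clinear g \<Longrightarrow> cbilinear (\<lambda>a b. f a \<otimes> g b)"
  by (intro clin)

lemma tensor_map_tens: "clinear f \<Longrightarrow> clinear g \<Longrightarrow> tensor_map f g (a \<otimes> b) = f a \<otimes> g b"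
  by (simp add: tensor_map_def tlift_tens cbilinear_map)

lemma clinear_tensor_map [clin]:
  "clinear f \<Longrightarrow> clinear g \<Longrightarrow> clinear k \<Longrightarrow> clinear (\<lambda>x. tensor_map f g (k x))"
  unfolding tensor_map_def by (intro clin cbilinear_map)

lemma tensor_map_sum:
  "clinear f \<Longrightarrow> clinear g \<Longrightarrow> tensor_map f g (\<Sum>i\<in>I. a i \<otimes> b i) = (\<Sum>i\<in>I. f (a i) \<otimes> g (b i))"
  by (simp add: clinear_sum[OF clinear_tensor_map[OF _ _ clinear_ident]] tensor_map_tens)

lemma tensor_assoc_tens: "tensor_assoc ((a \<otimes> b) \<otimes> c) = a \<otimes> b \<otimes> c"
  unfolding tensor_assoc_def by (subst tlift_tens, intro clin)+ (rule refl)

lemma clinear_tensor_assoc [clin]: "clinear f \<Longrightarrow> clinear (\<lambda>x. tensor_assoc (f x))"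
  unfolding tensor_assoc_def by (intro clin)

lemma tlift_tensor_map:
  assumes "cbilinear \<mu>" "clinear f" "clinear g"
  shows "tlift \<mu> (tensor_map f g t) = tlift (\<lambda>a b. \<mu> (f a) (g b)) t"
proof -
  note [clin] = cbilinear_comp_left[OF assms(1)] cbilinear_comp_right[OF assms(1)] assms
  have b: "cbilinear (\<lambda>a b. \<mu> (f a) (g b))" by (intro clin)
  show ?thesis
    by (rule clinear_eq_tensor) (intro clin b | simp add: tlift_tens tensor_map_tens assms b)+
qed

section \<open>Contraction of the first leg, and coordinates\<close>

definition slice :: "('a::complex_vector \<Rightarrow> complex) \<Rightarrow> 'a \<otimes>\<^sub>C 'b::complex_vector \<Rightarrow> 'b" where
  "slice p t = tlift (\<lambda>a b. p a *\<^sub>C b) t"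

lemma cbilinear_slice: "clinear p \<Longrightarrow> cbilinear (\<lambda>a b. p a *\<^sub>C b)"
  by (intro clin)

lemma clinear_slice [clin]: "clinear p \<Longrightarrow> clinear f \<Longrightarrow> clinear (\<lambda>x. slice p (f x))"
  unfolding slice_def by (intro clin)

lemma slice_tens: "clinear p \<Longrightarrow> slice p (a \<otimes> b) = p a *\<^sub>C b"
  by (simp add: slice_def tlift_tens cbilinear_slice)

lemma slice_sum: "clinear p \<Longrightarrow> slice p (\<Sum>i\<in>I. a i \<otimes> b i) = (\<Sum>i\<in>I. p (a i) *\<^sub>C b i)"
  by (simp add: clinear_sum[OF clinear_slice[OF _ clinear_ident]] slice_tens)

lemma slice_tensor_map:
  assumes "clinear p" "clinear f" "clinear g"
  shows "slice p (tensor_map f g t) = g (slice (\<lambda>a. p (f a)) t)"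
  unfolding slice_def
  by (simp add: tlift_tensor_map assms cbilinear_slice clinear_tlift_push clinear_scale)

text \<open>An algebraic basis, so that there are enough functionals on a space without
  topology.\<close>

definition hamel_basis :: "'a::complex_vector set" where
  "hamel_basis = cvec.extend_basis {}"

definition coordinate :: "'a::complex_vector \<Rightarrow> 'a \<Rightarrow> complex" where
  "coordinate b g = cvec.representation hamel_basis g b"

lemma hamel_basis: "cvec.independent hamel_basis" "cvec.span hamel_basis = UNIV"
  by (simp_all add: hamel_basis_def cvec.independent_extend_basis cvec.independent_empty)

lemma clinear_coordinate: "clinear (coordinate b)"
  using cvec.linear_representation[OF hamel_basis] by (simp add: scaleC_complex_def coordinate_def[abs_def])

lemma coordinate_basis: "b \<in> hamel_basis \<Longrightarrow> coordinate c b = (if c = b then 1 else 0)"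
  by (simp add: coordinate_def cvec.representation_basis hamel_basis)

text \<open>Expanding the first legs in a basis makes the second legs the slices by coordinate
  functionals. Hence slices detect equality of tensors and membership in a tensor product with a
  subspace.\<close>

lemma tensor_expansion:
  obtains S where "finite S" "S \<subseteq> hamel_basis" "t = (\<Sum>b\<in>S. b \<otimes> slice (coordinate b) t)"
proof -
  obtain I a x where I: "finite (I::nat set)" and t: "t = (\<Sum>i\<in>I. a i \<otimes> x i)"
    by (rule tensor_finite_sum)
  define S where "S = (\<Union>i\<in>I. {b. coordinate b (a i) \<noteq> 0})"
  have S: "finite S" "S \<subseteq> hamel_basis"
    using I cvec.finite_representation cvec.representation_ne_zero by (auto simp: S_def coordinate_def)
  have a: "a i = (\<Sum>b\<in>S. coordinate b (a i) *\<^sub>C b)" if "i \<in> I" for i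
  proof -
    have "(\<Sum>b\<in>S. coordinate b (a i) *\<^sub>C b)
        = (\<Sum>b | coordinate b (a i) \<noteq> 0. coordinate b (a i) *\<^sub>C b)"
      by (rule sum.mono_neutral_right) (use S that in \<open>auto simp: S_def\<close>)
    then show ?thesis
      by (simp add: cvec.sum_nonzero_representation_eq hamel_basis coordinate_def)
  qed
  have "t = (\<Sum>i\<in>I. (\<Sum>b\<in>S. coordinate b (a i) *\<^sub>C b) \<otimes> x i)"
    unfolding t using a by (intro sum.cong) auto
  also have "\<dots> = (\<Sum>i\<in>I. \<Sum>b\<in>S. coordinate b (a i) *\<^sub>C (b \<otimes> x i))"
    by (simp add: tens_sum_left tens_scale_left)
  also have "\<dots> = (\<Sum>b\<in>S. \<Sum>i\<in>I. coordinate b (a i) *\<^sub>C (b \<otimes> x i))"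
    by (rule sum.swap)
  also have "\<dots> = (\<Sum>b\<in>S. b \<otimes> slice (coordinate b) t)"
    unfolding t by (simp add: slice_sum[OF clinear_coordinate] tens_sum_right tens_scale_right)
  finally show thesis using S that by blast
qed

lemma tensor_eqI:
  fixes s t :: "'a::complex_vector \<otimes>\<^sub>C 'b::complex_vector"
  assumes "\<And>p. clinear p \<Longrightarrow> slice p s = slice p t"
  shows "s = t"
proof -
  obtain S where S: "s - t = (\<Sum>b\<in>S. b \<otimes> slice (coordinate b) (s - t))"
    by (rule tensor_expansion)
  have "slice p (s - t) = 0" if "clinear p" for p
    using assms that by (simp add: clinear_diff[OF clinear_slice[OF that clinear_ident]])
  then have "s - t = 0"
    by (subst S) (simp add: clinear_coordinate)
  then show ?thesis by simp
qed

text \<open>Turns invariance of a subspace under a coaction into invariance under the action of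
  every functional.\<close>

lemma mem_subtensor_iff:
  fixes t :: "'a::complex_vector \<otimes>\<^sub>C 'b::complex_vector"
  assumes "cvec.subspace W"
  shows "t \<in> subtensor UNIV W \<longleftrightarrow> (\<forall>p. clinear p \<longrightarrow> slice p t \<in> W)"
proof
  assume "t \<in> subtensor UNIV W"
  then show "\<forall>p. clinear p \<longrightarrow> slice p t \<in> W"
    unfolding subtensor_def
  proof (induction rule: cvec.span_induct_alt)
    case base
    then show ?case
      using assms cvec.subspace_0 clinear_0[OF clinear_slice[OF _ clinear_ident]] by metis
  next
    case (step c x y)
    then show ?case
      using assms by (auto simp: clinear_add[OF clinear_slice[OF _ clinear_ident]] slice_tens
          clinear_scale[OF clinear_slice[OF _ clinear_ident]] intro!: cvec.subspace_add cvec.subspace_scale)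
  qed
next
  assume *: "\<forall>p. clinear p \<longrightarrow> slice p t \<in> W"
  obtain S where S: "t = (\<Sum>b\<in>S. b \<otimes> slice (coordinate b) t)"
    by (rule tensor_expansion)
  show "t \<in> subtensor UNIV W"
    unfolding subtensor_def
    by (subst S) (intro cvec.span_sum cvec.span_base, use * clinear_coordinate in blast)
qed

lemma tensor_map_id_inj:
  assumes "clinear f" "inj f"
  shows "inj (tensor_map (id :: 'a::complex_vector \<Rightarrow> 'a) f)"
proof (rule injI, rule tensor_eqI)
  fix s t :: "'a \<otimes>\<^sub>C 'b" and p :: "'a \<Rightarrow> complex"
  assume *: "tensor_map id f s = tensor_map id f t" and p: "clinear p"
  have "f (slice p s) = f (slice p t)"
    using arg_cong[OF *, of "slice p"] by (simp add: slice_tensor_map p assms clin)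
  then show "slice p s = slice p t"
    using assms(2) by (simp add: inj_eq)
qed

text \<open>Together with \<open>tensor_map_id_inj\<close> this identifies a tensor product with the
  tensors whose slices lie in the image of \<open>f\<close>; this is how the comultiplication
  restricts to a coaction on \<open>M\<close>.\<close>

lemma tensor_map_id_range:
  assumes "clinear f" "\<And>p. clinear p \<Longrightarrow> slice p t \<in> range f"
  shows "\<exists>s. tensor_map id f s = t"
proof -
  have "t \<in> subtensor UNIV (range f)"
    using assms by (subst mem_subtensor_iff) (auto intro: cvp.linear_subspace_image cvec.subspace_UNIV)
  then show ?thesis
    unfolding subtensor_def
  proof (induction rule: cvec.span_induct_alt)
    case base
    then show ?case
      using clinear_0[OF clinear_tensor_map[OF clinear_id_const assms(1) clinear_ident]] by blast
  next
    case (step c x y)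
    then obtain a b s where x: "x = a \<otimes> f b" and s: "tensor_map id f s = y" by blast
    have "tensor_map id f (c *\<^sub>C (a \<otimes> b) + s) = c *\<^sub>C x + y"
      using clinear_tensor_map[OF clinear_id_const assms(1) clinear_ident]
      by (simp add: clinear_add clinear_scale tensor_map_tens assms(1) clin x s)
    then show ?case by blast
  qed
qed

section \<open>Spectral theory of locally finite symmetric operators\<close>

text \<open>An injective map preserves independence, so a basis of \<open>W\<close> cannot have more
  elements than \<open>S\<close>.\<close>

lemma finite_span_vimage:
  assumes f: "clinear f" "inj f" and S: "finite S" "f ` W \<subseteq> cvec.span S"
  shows "\<exists>S'. finite S' \<and> W \<subseteq> cvec.span S'"
proof -
  obtain B where B: "B \<subseteq> W" "cvec.independent B" "W \<subseteq> cvec.span B"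
    using cvec.maximal_independent_subset[of W] by blast
  have "cvec.independent (f ` B)"
    by (rule cvp.linear_independent_injective_image[OF f(1) B(2) inj_on_subset[OF f(2) subset_UNIV]]) 
  moreover have "f ` B \<subseteq> cvec.span S" using B(1) S(2) by blast
  ultimately have "finite (f ` B)"
    using cvec.independent_span_bound[OF S(1)] by blast
  then have "finite B"
    using f(2) by (rule finite_imageD[OF _ inj_on_subset[OF _ subset_UNIV]])
  with B show ?thesis by blast
qed

text \<open>Dimension count: an element of \<open>W\<close> outside the span of the image of a basis
  \<open>B\<close> would give \<open>card B + 1\<close> independent vectors in the span of
  \<open>B\<close>.\<close>

lemma inj_endo_fin_dim_surj:
  assumes f: "clinear f" "inj f" and W: "cvec.subspace W" "f ` W \<subseteq> W"
    and S: "finite S" "W \<subseteq> cvec.span S"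
  shows "W \<subseteq> f ` W"
proof
  fix w assume w: "w \<in> W"
  obtain B where B: "B \<subseteq> W" "cvec.independent B" "W \<subseteq> cvec.span B"
    using cvec.maximal_independent_subset[of W] by blast
  have finB: "finite B"
    using cvec.independent_span_bound[OF S(1) B(2)] B(1) S(2) by blast
  have sB: "cvec.span B = W"
    using B W(1) by (simp add: cvec.span_minimal subset_antisym)
  have ind: "cvec.independent (f ` B)"
    by (rule cvp.linear_independent_injective_image[OF f(1) B(2) inj_on_subset[OF f(2) subset_UNIV]])
  have card: "card (f ` B) = card B"
    using f(2) by (simp add: card_image inj_on_subset)
  have "w \<in> cvec.span (f ` B)"
  proof (rule ccontr)
    assume nw: "w \<notin> cvec.span (f ` B)"
    have "cvec.independent (insert w (f ` B))"
      using ind nw by (rule cvec.independent_insertI[rotated])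
    moreover have "insert w (f ` B) \<subseteq> cvec.span B"
      using w W(2) B(1) sB by auto
    ultimately have "card (insert w (f ` B)) \<le> card B"
      using cvec.independent_span_bound[OF finB] by blast
    moreover have "w \<notin> f ` B" using nw cvec.span_base by blast
    ultimately show False using finB card by simp
  qed
  also have "cvec.span (f ` B) = f ` cvec.span B"
    using f(1) by (rule cvp.linear_span_image)
  finally show "w \<in> f ` W" by (simp add: sB)
qed

text \<open>Either the first \<open>card S + 1\<close> terms are distinct and too many to be
  independent, or two of them coincide and their difference is the relation.\<close>

lemma finite_span_dependent_powers:
  fixes f :: "nat \<Rightarrow> 'a::complex_vector"
  assumes S: "finite S" "range f \<subseteq> cvec.span S"
  shows "\<exists>c N. (\<exists>i\<le>N. c i \<noteq> 0) \<and> (\<Sum>i\<le>N. c i *\<^sub>C f i) = 0"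
proof (cases "inj_on f {..card S}")
  case True
  have "cvec.dependent (f ` {..card S})"
  proof (rule ccontr)
    assume "\<not> ?thesis"
    moreover have "f ` {..card S} \<subseteq> cvec.span S" using S(2) by blast
    ultimately have "card (f ` {..card S}) \<le> card S"
      using cvec.independent_span_bound[OF S(1)] by blast
    then show False using True by (simp add: card_image)
  qed
  then obtain u where u: "\<exists>v\<in>f ` {..card S}. u v \<noteq> 0" "(\<Sum>v\<in>f ` {..card S}. u v *\<^sub>C v) = 0"
    by (auto simp: cvec.dependent_finite)
  then show ?thesis
    using True by (intro exI[of _ "u \<circ> f"] exI[of _ "card S"]) (auto simp: sum.reindex)
next
  case False
  then obtain i j where ij: "i \<le> card S" "j \<le> card S" "f i = f j" "i \<noteq> j"
    by (auto simp: inj_on_def)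
  let ?c = "\<lambda>k. if k = i then 1 else if k = j then - 1 else 0"
  have "(\<Sum>k\<le>card S. ?c k *\<^sub>C f k) = (\<Sum>k\<in>{i, j}. ?c k *\<^sub>C f k)"
    by (rule sum.mono_neutral_right) (use ij in auto)
  also have "\<dots> = 0" using ij by simp
  finally show ?thesis
    using ij(1) by (intro exI[of _ ?c] exI[of _ "card S"]) auto
qed

text \<open>The vector p(D) v, evaluated by Horner's scheme.\<close>

definition poly_action :: "('a::complex_vector \<Rightarrow> 'a) \<Rightarrow> 'a \<Rightarrow> complex poly \<Rightarrow> 'a" where
  "poly_action D v p = fold_coeffs (\<lambda>a w. a *\<^sub>C v + D w) p 0"

lemma poly_action_0 [simp]: "poly_action D v 0 = 0"
  by (simp add: poly_action_def)

lemma poly_action_pCons: "clinear D \<Longrightarrow> poly_action D v (pCons a p) = a *\<^sub>C v + D (poly_action D v p)"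
  by (cases "a = 0 \<and> p = 0") (auto simp: poly_action_def clinear_0)

lemma poly_action_add:
  assumes "clinear D"
  shows "poly_action D v (p + q) = poly_action D v p + poly_action D v q"
proof (induction p q rule: poly_induct2)
  case (pCons a p b q)
  then show ?case
    using assms by (simp add: poly_action_pCons scaleC_add_left clinear_add algebra_simps)
qed simp

lemma poly_action_smult: "clinear D \<Longrightarrow> poly_action D v (smult c p) = c *\<^sub>C poly_action D v p"
  by (induction p) (simp_all add: poly_action_pCons scaleC_add_right scaleC_scaleC clinear_scale)

lemma poly_action_monom: "clinear D \<Longrightarrow> poly_action D v (monom c i) = c *\<^sub>C (D ^^ i) v"
  by (induction i) (simp_all add: monom_0 monom_Suc poly_action_pCons clinear_0 clinear_scale)

lemma poly_action_sum:
  "clinear D \<Longrightarrow> poly_action D v (\<Sum>i\<in>I. f i) = (\<Sum>i\<in>I. poly_action D v (f i))"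
  by (induction I rule: infinite_finite_induct) (simp_all add: poly_action_add)

text \<open>Take a polynomial p of least degree with p(D) v = 0, a root z of it, and q with p = (X -
  z) q. By minimality q(D) v is nonzero, and D - z kills it.\<close>

lemma eigenvector_exists:
  assumes D: "clinear D" and W: "cvec.subspace W" "D ` W \<subseteq> W"
    and S: "finite S" "W \<subseteq> cvec.span S" and v: "v \<in> W" "v \<noteq> 0"
  shows "\<exists>w c. w \<in> W \<and> w \<noteq> 0 \<and> D w = c *\<^sub>C w"
proof -
  have powers: "(D ^^ i) v \<in> W" for i
    by (induction i) (use v W in auto)
  then have "range (\<lambda>i. (D ^^ i) v) \<subseteq> cvec.span S" using S(2) by blast
  from finite_span_dependent_powers[OF S(1) this] obtain c :: "nat \<Rightarrow> complex" and N
    where c: "\<exists>i\<le>N. c i \<noteq> 0" "(\<Sum>i\<le>N. c i *\<^sub>C (D ^^ i) v) = 0" by blast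
  let ?p = "\<Sum>i\<le>N. monom (c i) i"
  have "?p \<noteq> 0"
  proof
    assume p0: "?p = 0"
    obtain i where i: "i \<le> N" "c i \<noteq> 0" using c(1) by blast
    have "coeff ?p i = c i" using i(1) by (simp add: coeff_sum sum.delta)
    with p0 i(2) show False by simp
  qed
  moreover have "poly_action D v ?p = 0"
    using c(2) D by (simp add: poly_action_sum poly_action_monom)
  ultimately have "?p \<noteq> 0 \<and> poly_action D v ?p = 0" ..
  from ex_has_least_nat[of "\<lambda>p. p \<noteq> 0 \<and> poly_action D v p = 0", OF this, of degree]
  obtain p where p: "p \<noteq> 0" "poly_action D v p = 0"
    and min: "\<And>q. q \<noteq> 0 \<Longrightarrow> poly_action D v q = 0 \<Longrightarrow> degree p \<le> degree q" by auto
  have "degree p \<noteq> 0"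
  proof
    assume "degree p = 0"
    then obtain a where a: "p = [:a:]" by (rule degree_eq_zeroE)
    with p have "a \<noteq> 0" "a *\<^sub>C v = 0"
      using D by (simp_all add: poly_action_pCons clinear_0)
    with v(2) show False by simp
  qed
  then have "\<not> constant (poly p)" by (simp add: constant_degree)
  then obtain z where "poly p z = 0" using fundamental_theorem_of_algebra by blast
  then obtain q where q: "p = [:- z, 1:] * q" by (auto simp: poly_eq_0_iff_dvd)
  have q0: "q \<noteq> 0" using p(1) q by auto
  have "degree p = degree q + 1"
    unfolding q using q0 by (subst degree_mult_eq) auto
  then have w0: "poly_action D v q \<noteq> 0" using min[OF q0] by auto
  have "p = smult (- z) q + pCons 0 q" unfolding q by simp
  then have "D (poly_action D v q) = z *\<^sub>C poly_action D v q"
    using p(2) D by (simp only: poly_action_add poly_action_smult poly_action_pCons) simp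
  moreover have "poly_action D v q \<in> W" for q
    by (induction q)
      (use v W D in \<open>auto simp: poly_action_pCons cvec.subspace_0 intro!: cvec.subspace_add cvec.subspace_scale\<close>)
  ultimately show ?thesis using w0 by blast
qed

text \<open>Polarisation with c = 1 and c = i. The values may lie in any space with an antilinear
  map, so that both complex-valued forms and pairings with values in M are covered.\<close>

lemma sesquilinear_polarisation:
  fixes Q :: "'v::complex_vector \<Rightarrow> 'v \<Rightarrow> 'z::complex_vector"
  assumes left: "\<And>y. clinear (\<lambda>x. Q x y)" and right: "\<And>x. antilinear (Q x)"
    and s: "antilinear s" and diag: "\<And>x. s (Q x x) = Q x x"
  shows "s (Q x y) = Q y x"
proof -
  have eq: "c *\<^sub>C Q x y + cnj c *\<^sub>C Q y x = cnj c *\<^sub>C s (Q x y) + c *\<^sub>C s (Q y x)" for c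
  proof -
    have Q: "Q (c *\<^sub>C x + y) (c *\<^sub>C x + y)
        = (c * cnj c) *\<^sub>C Q x x + c *\<^sub>C Q x y + cnj c *\<^sub>C Q y x + Q y y"
      using right[unfolded antilinear_def]
      by (simp add: clinear_add[OF left] clinear_scale[OF left] scaleC_add_right scaleC_scaleC algebra_simps)
    show ?thesis
      using diag[of "c *\<^sub>C x + y"] s diag
      unfolding Q by (simp add: antilinear_def mult.commute add.commute)
  qed
  have 1: "Q x y + Q y x = s (Q x y) + s (Q y x)"
    using eq[of 1] by (simp add: scaleC_one)
  have "\<i> *\<^sub>C (Q x y - Q y x) = \<i> *\<^sub>C (s (Q y x) - s (Q x y))"
    using eq[of \<i>] by (simp add: cvec.scale_right_diff_distrib)
  then have 2: "Q x y - Q y x = s (Q y x) - s (Q x y)"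
    by (rule cvec.scale_left_imp_eq[rotated]) simp
  have "(Q x y + Q y x) - (Q x y - Q y x) = (s (Q x y) + s (Q y x)) - (s (Q y x) - s (Q x y))"
    by (simp only: 1 2)
  then have "Q y x + Q y x = s (Q x y) + s (Q x y)"
    by simp
  then have "(1 + 1 :: complex) *\<^sub>C Q y x = (1 + 1 :: complex) *\<^sub>C s (Q x y)"
    by (simp only: scaleC_add_left scaleC_one)
  then have "Q y x = s (Q x y)"
    by (rule cvec.scale_left_imp_eq[rotated]) simp
  then show ?thesis ..
qed

text \<open>Degenerate forms are included: the forms taken in the fibre over the counit vanish on
  all multiples by M^+.\<close>

locale psd_form =
  fixes B :: "'v::complex_vector \<Rightarrow> 'v \<Rightarrow> complex"
  assumes linear_left: "clinear (\<lambda>x. B x y)"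
    and hermitian: "B y x = cnj (B x y)"
    and nonneg: "0 \<le> Re (B x x)"
begin

lemmas left_simps = clinear_simps[OF linear_left]

lemma add_right: "B x (y + z) = B x y + B x z"
  by (subst (1 2 3) hermitian) (simp add: left_simps)

lemma scale_right: "B x (c *\<^sub>C y) = cnj c * B x y"
  by (subst (1 2) hermitian) (simp add: left_simps scaleC_complex)

lemma diff_right: "B x (y - z) = B x y - B x z"
  by (subst (1 2 3) hermitian) (simp add: left_simps)

lemma zero_right [simp]: "B x 0 = 0"
  by (subst hermitian) (simp add: left_simps)

lemma sum_right: "B x (\<Sum>i\<in>I. f i) = (\<Sum>i\<in>I. B x (f i))"
  by (induction I rule: infinite_finite_induct) (simp_all add: add_right)

lemma diag_real: "B x x = of_real (Re (B x x))"
  using arg_cong[OF hermitian[of x x], of Im] by (simp add: complex_eq_iff)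

lemma cnj_swap: "cnj (B x y) = B y x"
  by (rule hermitian[symmetric])

text \<open>The degenerate case of the Cauchy-Schwarz inequality: a null vector is orthogonal to
  everything, since t x + y would otherwise have negative norm for a suitable t.\<close>

lemma null:
  assumes "Re (B x x) = 0"
  shows "B x y = 0"
proof (rule ccontr)
  assume nz: "B x y \<noteq> 0"
  define b where "b = (cmod (B x y))\<^sup>2"
  have b: "b > 0" using nz by (simp add: b_def)
  \<comment> \<open>Chosen so that the cross terms contribute -2 (Re (B y y) + 1), which outweighs
    Re (B y y).\<close>
  define s where "s = (Re (B y y) + 1) / b"
  define t where "t = - complex_of_real s * cnj (B x y)"
  have xx: "B x x = 0" using diag_real[of x] assms by simp
  have "B (t *\<^sub>C x + y) (t *\<^sub>C x + y) = t * B x y + cnj (t * B x y) + B y y"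
    by (subst hermitian[of x y]) (simp add: left_simps add_right scale_right xx scaleC_complex)
  moreover have "t * B x y = - of_real (s * b)"
    by (simp add: t_def b_def mult.assoc complex_norm_square[symmetric] mult.commute[of "cnj _"])
  ultimately have "Re (B (t *\<^sub>C x + y) (t *\<^sub>C x + y)) = - 2 * (s * b) + Re (B y y)"
    by simp
  also have "\<dots> = - Re (B y y) - 2"
    using b by (simp add: s_def field_simps)
  also have "\<dots> < 0" using nonneg[of y] by simp
  finally show False using nonneg[of "t *\<^sub>C x + y"] by simp
qed

text \<open>Gram--Schmidt for a form that may be degenerate: vectors of norm zero are discarded.\<close>

lemma frame:
  assumes "finite S"
  shows "\<exists>Fr. finite Fr \<and> Fr \<subseteq> cvec.span S \<and> (\<forall>u\<in>Fr. \<forall>v\<in>Fr. B u v = of_bool (u = v))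
    \<and> (\<forall>s\<in>cvec.span S. \<forall>y. B s y = (\<Sum>v\<in>Fr. B s v * B v y))"
  using assms
proof (induction S)
  case empty
  show ?case by (intro exI[of _ "{}"]) (simp add: left_simps)
next
  case (insert x S)
  then obtain Fr where IH: "finite Fr \<and> Fr \<subseteq> cvec.span S \<and> (\<forall>u\<in>Fr. \<forall>v\<in>Fr. B u v = of_bool (u = v))
    \<and> (\<forall>s\<in>cvec.span S. \<forall>y. B s y = (\<Sum>v\<in>Fr. B s v * B v y))"
    by (elim exE)
  have Fr: "finite Fr" "Fr \<subseteq> cvec.span S"
    and orth: "\<And>u v. u \<in> Fr \<Longrightarrow> v \<in> Fr \<Longrightarrow> B u v = of_bool (u = v)"
    using IH by simp_all
  have exp: "B s y = (\<Sum>v\<in>Fr. B s v * B v y)" if "s \<in> cvec.span S" for s y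
    using IH that by blast
  define x' where "x' = x - (\<Sum>v\<in>Fr. B x v *\<^sub>C v)"
  have x'y: "B x' y = B x y - (\<Sum>v\<in>Fr. B x v * B v y)" for y
    by (simp add: x'_def left_simps scaleC_complex)
  have x'Fr: "B x' u = 0" if "u \<in> Fr" for u
  proof -
    have "(\<Sum>v\<in>Fr. B x v * B v u) = (\<Sum>v\<in>Fr. if v = u then B x u else 0)"
      by (rule sum.cong) (use that orth in auto)
    then show ?thesis using that Fr(1) by (simp add: x'y)
  qed
  have Ox': "B u x' = 0" if "u \<in> Fr" for u
    using x'Fr[OF that] by (subst hermitian) simp
  have spS: "cvec.span S \<subseteq> cvec.span (insert x S)"
    by (rule cvec.span_mono) auto
  have x'span: "x' \<in> cvec.span (insert x S)"
    unfolding x'_def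
  proof (intro cvec.span_diff cvec.span_sum cvec.span_scale)
    show "x \<in> cvec.span (insert x S)" by (rule cvec.span_base) simp
  qed (use Fr spS in auto)
  have lift: "\<forall>s\<in>cvec.span (insert x S). \<forall>y. B s y = (\<Sum>v\<in>Fr'. B s v * B v y)"
    if x: "\<And>y. B x y = (\<Sum>v\<in>Fr'. B x v * B v y)"
      and S: "\<And>s y. s \<in> cvec.span S \<Longrightarrow> B s y = (\<Sum>v\<in>Fr'. B s v * B v y)" for Fr'
  proof (intro ballI allI)
    fix s y assume "s \<in> cvec.span (insert x S)"
    then obtain k where k: "s - k *\<^sub>C x \<in> cvec.span S"
      by (auto simp: cvec.span_insert)
    have "B s y = k * B x y + B (s - k *\<^sub>C x) y"
      by (simp add: left_simps scaleC_complex)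
    also have "\<dots> = k * (\<Sum>v\<in>Fr'. B x v * B v y) + (\<Sum>v\<in>Fr'. B (s - k *\<^sub>C x) v * B v y)"
      using x[of y] S[OF k, of y] by simp
    also have "\<dots> = (\<Sum>v\<in>Fr'. k * (B x v * B v y) + B (s - k *\<^sub>C x) v * B v y)"
      by (simp only: sum_distrib_left sum.distrib)
    also have "\<dots> = (\<Sum>v\<in>Fr'. B s v * B v y)"
      by (rule sum.cong) (simp_all add: left_simps scaleC_complex left_diff_distrib)
    finally show "B s y = (\<Sum>v\<in>Fr'. B s v * B v y)" .
  qed
  show ?case
  proof (cases "Re (B x' x') = 0")
    case True
    \<comment> \<open>A residual of norm zero is orthogonal to everything, so the old frame already
      accounts for x.\<close>
    then have "B x y = (\<Sum>v\<in>Fr. B x v * B v y)" for y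
      using null[OF True, of y] by (simp add: x'y)
    then have "\<forall>s\<in>cvec.span (insert x S). \<forall>y. B s y = (\<Sum>v\<in>Fr. B s v * B v y)"
      by (rule lift[OF _ exp])
    moreover have "Fr \<subseteq> cvec.span (insert x S)" using Fr(2) spS by (rule subset_trans)
    moreover have "\<forall>u\<in>Fr. \<forall>v\<in>Fr. B u v = of_bool (u = v)" using orth by simp
    ultimately show ?thesis
      using Fr(1) by (intro exI[of _ Fr] conjI)
  next
    case False
    define r where "r = sqrt (Re (B x' x'))"
    have r: "r > 0" "r * r = Re (B x' x')"
      using False nonneg[of x'] by (simp_all add: r_def)
    define w where "w = complex_of_real (1 / r) *\<^sub>C x'"
    have wy: "B w y = of_real (1 / r) * B x' y" and yw: "B y w = of_real (1 / r) * B y x'" for y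
      by (simp_all add: w_def left_simps scale_right scaleC_complex)
    have xx: "B x' x' = of_real r * of_real r" and r0: "complex_of_real r \<noteq> 0"
      using diag_real[of x'] r by (simp_all add: of_real_mult[symmetric] del: of_real_mult)
    have ww: "B w w = 1"
      using r0 by (simp add: wy yw xx)
    have wO: "w \<notin> Fr" using x'Fr[of w] ww wy[of w] by auto
    have orth': "B u v = of_bool (u = v)" if "u \<in> insert w Fr" "v \<in> insert w Fr" for u v
      using that ww orth wO by (auto simp: wy yw x'Fr Ox')
    have "B x y = (\<Sum>v\<in>insert w Fr. B x v * B v y)" for y
    proof -
      have "B x x' = B x' x'"
        using Ox' by (simp add: x'y)
      then have "B x w * B w y = B x' y"
        using r0 by (simp add: wy yw xx)
      then show ?thesis using Fr(1) wO by (simp add: x'y)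
    qed
    moreover have "B s y = (\<Sum>v\<in>insert w Fr. B s v * B v y)" if s: "s \<in> cvec.span S" for s y
    proof -
      have "B s x' = 0" using exp[OF s, of x'] Ox' by simp
      then show ?thesis using Fr(1) wO exp[OF s, of y] by (simp add: yw)
    qed
    ultimately have exp': "\<forall>s\<in>cvec.span (insert x S). \<forall>y. B s y = (\<Sum>v\<in>insert w Fr. B s v * B v y)"
      by (rule lift)
    have span': "insert w Fr \<subseteq> cvec.span (insert x S)"
      using x'span Fr(2) spS by (auto simp: w_def intro: cvec.span_scale)
    have on': "\<forall>u\<in>insert w Fr. \<forall>v\<in>insert w Fr. B u v = of_bool (u = v)"
      by (intro ballI orth')
    have "finite (insert w Fr)" using Fr(1) by simp
    then show ?thesis using span' on' exp' by (intro exI[of _ "insert w Fr"] conjI)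
  qed
qed

end

locale inner_form = psd_form +
  assumes definite: "x \<noteq> 0 \<Longrightarrow> B x x \<noteq> 0"
begin

lemma eqI: "(\<And>a. B a x = B a y) \<Longrightarrow> x = y"
  using definite[of "x - y"] by (auto simp: diff_right left_simps)

lemma orthonormal_expansion:
  assumes "finite S"
  obtains Fr where "finite Fr" "Fr \<subseteq> cvec.span S" "\<And>s. s \<in> cvec.span S \<Longrightarrow> s = (\<Sum>v\<in>Fr. B s v *\<^sub>C v)"
    "\<And>u v. u \<in> Fr \<Longrightarrow> v \<in> Fr \<Longrightarrow> B u v = of_bool (u = v)"
proof -
  obtain Fr where Fr: "finite Fr" "Fr \<subseteq> cvec.span S" "\<forall>u\<in>Fr. \<forall>v\<in>Fr. B u v = of_bool (u = v)"
    and exp: "\<forall>s\<in>cvec.span S. \<forall>y. B s y = (\<Sum>v\<in>Fr. B s v * B v y)"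
    using frame[OF assms] by blast
  have "s = (\<Sum>v\<in>Fr. B s v *\<^sub>C v)" if "s \<in> cvec.span S" for s
  proof (rule eqI)
    fix a
    have "B s a = B (\<Sum>v\<in>Fr. B s v *\<^sub>C v) a"
      using exp that by (simp add: left_simps scaleC_complex)
    then show "B a s = B a (\<Sum>v\<in>Fr. B s v *\<^sub>C v)"
      by (metis hermitian)
  qed
  with Fr show thesis using that by blast
qed

lemma riesz:
  assumes "finite S" "clinear f"
  shows "\<exists>u\<in>cvec.span S. \<forall>x\<in>cvec.span S. f x = B x u"
proof -
  obtain Fr where Fr: "finite Fr" "Fr \<subseteq> cvec.span S" "\<And>s. s \<in> cvec.span S \<Longrightarrow> s = (\<Sum>v\<in>Fr. B s v *\<^sub>C v)"
    by (rule orthonormal_expansion[OF assms(1)]) blast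
  let ?u = "\<Sum>v\<in>Fr. cnj (f v) *\<^sub>C v"
  have "f x = B x ?u" if x: "x \<in> cvec.span S" for x
  proof -
    have "f x = f (\<Sum>v\<in>Fr. B x v *\<^sub>C v)" using Fr(3)[OF x] by simp
    also have "\<dots> = B x ?u"
      by (simp add: clinear_simps[OF assms(2)] sum_right scale_right scaleC_complex mult.commute)
    finally show ?thesis .
  qed
  moreover have "?u \<in> cvec.span S"
    using Fr(2) by (intro cvec.span_sum cvec.span_scale) auto
  ultimately show ?thesis by blast
qed

lemma orthogonal_projection:
  assumes "finite S"
  shows "\<exists>w\<in>cvec.span S. \<forall>s\<in>cvec.span S. B (x - w) s = 0"
proof -
  obtain u where u: "u \<in> cvec.span S" "\<forall>s\<in>cvec.span S. B s x = B s u"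
  proof -
    obtain Fr where Fr: "finite Fr" "Fr \<subseteq> cvec.span S" "\<And>s. s \<in> cvec.span S \<Longrightarrow> s = (\<Sum>v\<in>Fr. B s v *\<^sub>C v)"
      by (rule orthonormal_expansion[OF assms]) blast
    let ?u = "\<Sum>v\<in>Fr. B x v *\<^sub>C v"
    have "B s x = B s ?u" if s: "s \<in> cvec.span S" for s
    proof -
      have "B s x = B (\<Sum>v\<in>Fr. B s v *\<^sub>C v) x" using Fr(3)[OF s] by simp
      also have "\<dots> = B s ?u"
        by (simp add: left_simps sum_right scale_right scaleC_complex mult.commute cnj_swap)
      finally show ?thesis .
    qed
    moreover have "?u \<in> cvec.span S"
      using Fr(2) by (intro cvec.span_sum cvec.span_scale) auto
    ultimately show thesis using that by blast
  qed
  have "B (x - u) s = 0" if "s \<in> cvec.span S" for s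
    using u(2) that by (subst hermitian) (simp add: diff_right)
  with u(1) show ?thesis by blast
qed

text \<open>By symmetry the orthogonal complement, inside \<open>W\<close>, of the span of all
  eigenvectors in \<open>W\<close> is again invariant. If it were nonzero it would contain an
  eigenvector, which would be orthogonal to itself.\<close>

lemma eigenvectors_span:
  assumes D: "clinear D" and W: "cvec.subspace W" "D ` W \<subseteq> W"
    and S: "finite S" "W \<subseteq> cvec.span S"
    and sym: "\<And>x y. x \<in> W \<Longrightarrow> y \<in> W \<Longrightarrow> B (D x) y = B x (D y)"
  shows "W \<subseteq> cvec.span {w. \<exists>c. D w = c *\<^sub>C w}"
proof
  fix x assume x: "x \<in> W"
  define E where "E = {w \<in> W. \<exists>c. D w = c *\<^sub>C w}"
  obtain A where A: "A \<subseteq> E" "cvec.independent A" "E \<subseteq> cvec.span A"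
    using cvec.maximal_independent_subset[of E] by blast
  have finA: "finite A"
    using cvec.independent_span_bound[OF S(1) A(2)] A(1) S(2) by (auto simp: E_def)
  have AW: "cvec.span A \<subseteq> W"
    using A(1) W(1) by (intro cvec.span_minimal) (auto simp: E_def)
  have DA: "D v \<in> cvec.span A" if "v \<in> cvec.span A" for v
    using that
  proof (induction rule: cvec.span_induct_alt)
    case base
    then show ?case by (simp add: clinear_0[OF D] cvec.span_zero)
  next
    case (step c x y)
    then obtain c where "D x = c *\<^sub>C x" using A(1) by (auto simp: E_def)
    then have "D x \<in> cvec.span A" using step(1) by (auto intro: cvec.span_scale cvec.span_base)
    with step show ?case by (simp add: clinear_add[OF D] clinear_scale[OF D] cvec.span_add cvec.span_scale)
  qed
  obtain w where w: "w \<in> cvec.span A" "\<forall>s\<in>cvec.span A. B (x - w) s = 0"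
    using orthogonal_projection[OF finA] by blast
  define U where "U = {u \<in> W. \<forall>v\<in>cvec.span A. B u v = 0}"
  have U: "cvec.subspace U"
    using W(1) by (auto simp: U_def cvec.subspace_def left_simps)
  have DU: "D ` U \<subseteq> U"
  proof (rule image_subsetI)
    fix u assume u: "u \<in> U"
    then have "D u \<in> W" using W(2) by (auto simp: U_def)
    moreover have "B (D u) v = 0" if v: "v \<in> cvec.span A" for v
      using sym[of u v] u DA[OF v] AW v by (auto simp: U_def)
    ultimately show "D u \<in> U" by (simp add: U_def)
  qed
  have "x - w = 0"
  proof (rule ccontr)
    assume "x - w \<noteq> 0"
    moreover have "x - w \<in> U"
      using w x AW W(1) by (auto simp: U_def intro: cvec.subspace_diff)
    moreover have "U \<subseteq> cvec.span S" using S(2) by (auto simp: U_def)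
    ultimately obtain u c where u: "u \<in> U" "u \<noteq> 0" "D u = c *\<^sub>C u"
      using eigenvector_exists[OF D U DU S(1)] by blast
    then have "u \<in> E" by (auto simp: E_def U_def)
    with A(3) u(1) have "B u u = 0" by (auto simp: U_def)
    with u(2) definite show False by blast
  qed
  with w(1) have "x \<in> cvec.span A" by simp
  also have "\<dots> \<subseteq> cvec.span {w. \<exists>c. D w = c *\<^sub>C w}"
    using A(1) by (intro cvec.span_mono) (auto simp: E_def)
  finally show "x \<in> \<dots>" .
qed

text \<open>The range of \<open>P\<close> is a finite-dimensional subspace invariant under \<open>T\<close>, and its orthogonal
  complement is the kernel of \<open>Q\<close>, hence is invariant under \<open>T\<close> as well.  So the adjoint exists and
  is computed on finite-dimensional subspaces.\<close>

theorem diagonalisable_plus_adjoint: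
  assumes T: "clinear T"
    and loc: "\<And>e. \<exists>P Q S. clinear P \<and> finite S \<and> range P \<subseteq> cvec.span S \<and> P e = e
      \<and> (\<forall>x. T (P x) = P (T x)) \<and> (\<forall>x. T (Q x) = Q (T x)) \<and> (\<forall>x y. B (Q x) y = B x (P y))"
  shows "diagonalisable (\<lambda>e. T e + adjoint_op B T e)"
proof -
  define R where "R = adjoint_op B T"
  have inv: "\<exists>W S. cvec.subspace W \<and> finite S \<and> W \<subseteq> cvec.span S \<and> e \<in> W \<and> T ` W \<subseteq> W
    \<and> (\<forall>b\<in>W. \<exists>g\<in>W. \<forall>a. B (T a) b = B a g)" for e
  proof -
    obtain P Q S where P: "clinear P" "finite S" "range P \<subseteq> cvec.span S" "P e = e"
      and TP: "\<And>x. T (P x) = P (T x)" and TQ: "\<And>x. T (Q x) = Q (T x)"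
      and QP: "\<And>x y. B (Q x) y = B x (P y)" using loc[of e] by auto
    define W where "W = range P"
    have W: "cvec.subspace W"
      unfolding W_def by (rule cvp.linear_subspace_image[OF P(1) cvec.subspace_UNIV])
    obtain A where A: "A \<subseteq> W" "cvec.independent A" "W \<subseteq> cvec.span A"
      using cvec.maximal_independent_subset[of W] by blast
    have finA: "finite A"
      using cvec.independent_span_bound[OF P(2) A(2)] A(1) P(3) by (auto simp: W_def)
    have sA: "cvec.span A = W"
      using A W by (simp add: cvec.span_minimal subset_antisym)
    have "\<exists>g\<in>W. \<forall>a. B (T a) b = B a g" if b: "b \<in> W" for b
    proof -
      have "clinear (\<lambda>x. B (T x) b)" using linear_left T by (rule clinear_comp)
      then obtain g where g: "g \<in> W" "\<And>x. x \<in> W \<Longrightarrow> B (T x) b = B x g"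
        using riesz[OF finA] unfolding sA by blast
      have "B (T a) b = B a g" for a
      proof -
        obtain w where w: "w \<in> W" "\<And>s. s \<in> W \<Longrightarrow> B (a - w) s = 0"
          using orthogonal_projection[OF finA] unfolding sA by blast
        \<comment> \<open>Its square norm is the product of \<open>a - w\<close> with an element of
          the range of \<open>P\<close>, hence zero.\<close>
        have "Q (a - w) = 0"
        proof (rule ccontr)
          assume "Q (a - w) \<noteq> 0"
          then have "B (Q (a - w)) (Q (a - w)) \<noteq> 0" by (rule definite)
          with w(2) show False by (simp add: QP W_def)
        qed
        moreover obtain b' where "b = P b'" using b by (auto simp: W_def)
        \<comment> \<open>Writing b = P b' moves P to the other side as Q, which passes T and meets
          a - w.\<close>
        ultimately have "B (T (a - w)) b = 0"
          using clinear_0[OF T] by (simp add: QP[symmetric] TQ[symmetric] left_simps)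
        then have "B (T a) b = B (T w) b"
          by (simp add: clinear_diff[OF T] left_simps)
        also have "\<dots> = B w g" using g w by blast
        also have "\<dots> = B a g" using w(2)[OF g(1)] by (simp add: left_simps)
        finally show ?thesis .
      qed
      with g(1) show ?thesis by blast
    qed
    moreover have "T ` W \<subseteq> W" by (auto simp: W_def TP)
    moreover have "e \<in> W" using P(4) rangeI[of P e] by (simp add: W_def)
    ultimately show ?thesis using W P(2,3)[folded W_def]
      by (intro exI[of _ W] exI[of _ S] conjI) auto
  qed
  have R: "B (T a) b = B a (R b)" for a b
  proof -
    obtain g where g: "\<forall>a. B (T a) b = B a g"
      using inv[of b] by (elim exE conjE) (drule (1) bspec, elim bexE, rule that)
    have "R b = g"
      unfolding R_def adjoint_op_def using g by (intro the_equality) (auto intro: eqI)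
    then show ?thesis using g by simp
  qed
  have linR: "clinear R"
    by (rule clinearI; rule eqI) (simp_all add: add_right scale_right R[symmetric])
  have linD: "clinear (\<lambda>e. T e + R e)"
    using T linR by (rule clinear_plus)
  have eig: "e \<in> cvec.span {w. \<exists>c. T w + R w = c *\<^sub>C w}" for e
  proof -
    obtain W S where W: "cvec.subspace W" "finite S" "W \<subseteq> cvec.span S" "e \<in> W" "T ` W \<subseteq> W"
      and ad: "\<forall>b\<in>W. \<exists>g\<in>W. \<forall>a. B (T a) b = B a g" using inv[of e] by (elim exE conjE) (rule that)
    have RW: "R b \<in> W" if b: "b \<in> W" for b
    proof -
      obtain g where g: "g \<in> W" "\<forall>a. B (T a) b = B a g" using bspec[OF ad b] by (elim bexE)
      have "R b = g" using g(2) R by (auto intro: eqI)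
      with g(1) show ?thesis by simp
    qed
    have sub: "(\<lambda>e. T e + R e) ` W \<subseteq> W"
      using W(5) RW by (auto intro!: cvec.subspace_add[OF W(1)])
    have RT: "B (R x) y = B x (T y)" for x y
      by (subst (1 2) hermitian) (simp add: R)
    have "W \<subseteq> cvec.span {w. \<exists>c. T w + R w = c *\<^sub>C w}"
      by (rule eigenvectors_span[OF linD W(1) sub W(2,3)])
        (simp only: add_right clinear_add[OF linear_left] R RT add.commute)
    with W(4) show ?thesis by blast
  qed
  obtain A where A: "A \<subseteq> {w. \<exists>c. T w + R w = c *\<^sub>C w}" "cvec.independent A"
    "{w. \<exists>c. T w + R w = c *\<^sub>C w} \<subseteq> cvec.span A"
    using cvec.maximal_independent_subset by blast
  have "cvec.span {w. \<exists>c. T w + R w = c *\<^sub>C w} \<subseteq> cvec.span A"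
    using A(3) cvec.subspace_span by (rule cvec.span_minimal)
  then have "cvec.span A = UNIV" using eig by blast
  with A(1,2) linD show ?thesis
    unfolding diagonalisable_def R_def by blast
qed

end

section \<open>Balanced tensor products and comodules\<close>

lemma (in balanced_tensor_product) lift_unique:
  assumes "clinear S" "clinear T" "\<And>a b. a \<in> A \<Longrightarrow> b \<in> B \<Longrightarrow> S (\<tau> a b) = T (\<tau> a b)"
  shows "S x = T x"
proof -
  obtain ps where ps: "set ps \<subseteq> A \<times> B" and x: "x = (\<Sum>(a, b)\<leftarrow>ps. \<tau> a b)"
    using onto by blast
  have "S (\<Sum>(a, b)\<leftarrow>ps. \<tau> a b) = T (\<Sum>(a, b)\<leftarrow>ps. \<tau> a b)"
    using ps by (induction ps) (auto simp: clinear_simps[OF assms(1)] clinear_simps[OF assms(2)] assms(3))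
  then show ?thesis by (simp add: x)
qed

text \<open>The universal property, from a kernel axiom about finite lists: the map is evaluated on
  a chosen list of pure tensors, and the axiom makes the value independent of the list.\<close>

lemma (in balanced_tensor_product) lift:
  assumes A: "cvec.subspace A" and \<beta>: "cbilinear \<beta>"
    and bal: "\<And>a b m. a \<in> A \<Longrightarrow> b \<in> B \<Longrightarrow> \<beta> (r a m) b = \<beta> a (l m b)"
  shows "\<exists>T. clinear T \<and> (\<forall>a\<in>A. \<forall>b\<in>B. T (\<tau> a b) = \<beta> a b)"
proof -
  let ?R = "{r a m \<otimes> b - a \<otimes> l m b | a b m. a \<in> A \<and> b \<in> B}"
  let ?\<tau> = "\<lambda>ps. \<Sum>(a, b)\<leftarrow>ps. \<tau> a b" and ?\<beta> = "\<lambda>ps. \<Sum>(a, b)\<leftarrow>ps. \<beta> a b"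
  have \<beta>l: "clinear (\<lambda>a. \<beta> a b)" and \<beta>r: "clinear (\<beta> a)" for a b
    using \<beta> by (simp_all add: cbilinear_def)
  have zero: "tlift \<beta> t = 0" if "t \<in> cvec.span ?R" for t
    using that
  proof (induction rule: cvec.span_induct_alt)
    case base
    then show ?case by (simp add: tlift_zero \<beta>)
  next
    case (step c x y)
    then obtain a b m where x: "x = r a m \<otimes> b - a \<otimes> l m b" and ab: "a \<in> A" "b \<in> B" by blast
    have "tlift \<beta> x = \<beta> (r a m) b - \<beta> a (l m b)"
      unfolding x by (simp add: clinear_diff[OF clinear_tlift[OF \<beta>]] tlift_tens \<beta>)
    with bal[OF ab] step(2) show ?case by (simp add: tlift_add tlift_scale \<beta>)
  qed
  have kernel': "?\<beta> ps = 0" if "set ps \<subseteq> A \<times> B" "?\<tau> ps = 0" for ps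
  proof -
    have "(\<Sum>(a, b)\<leftarrow>ps. a \<otimes> b) \<in> cvec.span ?R"
      using kernel[OF that(1)] that(2) by blast
    then have "tlift \<beta> (\<Sum>(a, b)\<leftarrow>ps. a \<otimes> b) = 0" by (rule zero)
    moreover have "tlift \<beta> (\<Sum>(a, b)\<leftarrow>ps. a \<otimes> b) = ?\<beta> ps"
      by (induction ps) (auto simp: tlift_zero tlift_add tlift_tens \<beta>)
    ultimately show ?thesis by simp
  qed
  have neg: "?\<beta> (map (\<lambda>(a, b). (c *\<^sub>C a, b)) ps) = c *\<^sub>C ?\<beta> ps" for c ps
    by (induction ps) (auto simp: clinear_scale[OF \<beta>l] scaleC_add_right)
  have negt: "?\<tau> (map (\<lambda>(a, b). (c *\<^sub>C a, b)) ps) = c *\<^sub>C ?\<tau> ps" if "set ps \<subseteq> A \<times> B" for c ps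
    using that by (induction ps) (auto simp: scale_left scaleC_add_right)
  have negs: "set (map (\<lambda>(a, b). (c *\<^sub>C a, b)) ps) \<subseteq> A \<times> B" if "set ps \<subseteq> A \<times> B" for c ps
    using that A by (auto intro: cvec.subspace_scale)
  have wd: "?\<beta> ps = ?\<beta> qs" if "set ps \<subseteq> A \<times> B" "set qs \<subseteq> A \<times> B" "?\<tau> ps = ?\<tau> qs" for ps qs
  proof -
    \<comment> \<open>Equality of two sums becomes vanishing of one: the second list is appended
      with its first entries negated, which stay in the subspace \<open>A\<close>.\<close>
    let ?qs = "map (\<lambda>(a, b). ((- 1) *\<^sub>C a, b)) qs"
    have "?\<beta> (ps @ ?qs) = 0"
    proof (rule kernel')
      show "set (ps @ ?qs) \<subseteq> A \<times> B" using that(1) negs[OF that(2), of "- 1"] by simp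
      show "?\<tau> (ps @ ?qs) = 0"
        unfolding map_append sum_list_append negt[OF that(2)] by (simp add: that(3) scaleC_one)
    qed
    then show ?thesis
      unfolding map_append sum_list_append neg by (simp add: scaleC_one)
  qed
  define rep where "rep x = (SOME ps. set ps \<subseteq> A \<times> B \<and> x = ?\<tau> ps)" for x
  have rep: "set (rep x) \<subseteq> A \<times> B" "?\<tau> (rep x) = x" for x
    using someI_ex[OF onto[of x]] by (auto simp: rep_def)
  define T where "T x = ?\<beta> (rep x)" for x
  have T: "T (?\<tau> ps) = ?\<beta> ps" if "set ps \<subseteq> A \<times> B" for ps
    unfolding T_def by (rule wd) (use rep that in auto)
  have "clinear T"
  proof (rule clinearI)
    fix x y
    have "T (x + y) = T (?\<tau> (rep x @ rep y))"
      unfolding map_append sum_list_append rep(2) ..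
    also have "\<dots> = ?\<beta> (rep x @ rep y)"
      by (rule T) (use rep in auto)
    finally show "T (x + y) = T x + T y"
      by (simp add: T_def)
  next
    fix c x
    have "T (c *\<^sub>C x) = T (?\<tau> (map (\<lambda>(a, b). (c *\<^sub>C a, b)) (rep x)))"
      unfolding negt[OF rep(1)] rep(2) ..
    also have "\<dots> = ?\<beta> (map (\<lambda>(a, b). (c *\<^sub>C a, b)) (rep x))"
      by (rule T) (rule negs[OF rep(1)])
    finally show "T (c *\<^sub>C x) = c *\<^sub>C T x"
      unfolding neg T_def .
  qed
  moreover have "T (\<tau> a b) = \<beta> a b" if "a \<in> A" "b \<in> B" for a b
    using T[of "[(a, b)]"] that by simp
  ultimately show ?thesis by blast
qed

section \<open>Antilinear maps, and products of tensor maps\<close>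

lemma unConj_simps [simp]:
  "unConj 0 = 0" "unConj (x + y) = unConj x + unConj y" "unConj (c *\<^sub>C x) = cnj c *\<^sub>C unConj x"
  by (simp_all add: zero_conj_space_def plus_conj_space_def scaleC_conj_space_def)

lemma antilinear_comp_clinear: "antilinear f \<Longrightarrow> clinear g \<Longrightarrow> antilinear (\<lambda>x. f (g x))"
  by (simp add: antilinear_def clinear_iff)

lemma clinear_antilinear_comp: "clinear f \<Longrightarrow> antilinear g \<Longrightarrow> antilinear (\<lambda>x. f (g x))"
  by (simp add: antilinear_def clinear_iff)

lemma antilinear_0: "antilinear f \<Longrightarrow> f 0 = 0"
proof -
  assume "antilinear f"
  then have "f (0 *\<^sub>C 0) = cnj 0 *\<^sub>C f 0" unfolding antilinear_def by blast
  then show ?thesis by simp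
qed

lemma antilinear_sum: "antilinear f \<Longrightarrow> f (\<Sum>i\<in>I. x i) = (\<Sum>i\<in>I. f (x i))"
  by (induction I rule: infinite_finite_induct) (simp_all add: antilinear_0, simp add: antilinear_def)

text \<open>Antilinear maps are linear maps into the conjugate space; in this way uniqueness and
  lifting results for linear maps also serve antilinear ones.\<close>

lemma clinear_Conj_antilinear: "antilinear f \<Longrightarrow> clinear (\<lambda>x. Conj (f x))"
  by (simp add: clinear_iff antilinear_def plus_conj_space_def scaleC_conj_space_def)

lemma antilinear_Conj: "antilinear Conj"
  by (simp add: antilinear_def plus_conj_space_def scaleC_conj_space_def)

lemma cbilinear_antimap:
  "antilinear f \<Longrightarrow> antilinear g \<Longrightarrow> cbilinear (\<lambda>a b. Conj (f a \<otimes> g b))"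
  by (simp add: cbilinear_def clinear_iff antilinear_def plus_conj_space_def scaleC_conj_space_def
      tens_add_left tens_add_right tens_scale_left tens_scale_right)

lemma tensor_antimap_tens:
  "antilinear f \<Longrightarrow> antilinear g \<Longrightarrow> tensor_antimap f g (a \<otimes> b) = f a \<otimes> g b"
  by (simp add: tensor_antimap_def tlift_tens cbilinear_antimap)

lemma antilinear_tensor_antimap:
  "antilinear f \<Longrightarrow> antilinear g \<Longrightarrow> antilinear (tensor_antimap f g)"
  by (simp add: antilinear_def[of "tensor_antimap f g"] tensor_antimap_def tlift_add tlift_scale cbilinear_antimap)

lemma tensor_antimap_add:
  "antilinear f \<Longrightarrow> antilinear g \<Longrightarrow> tensor_antimap f g (s + t) = tensor_antimap f g s + tensor_antimap f g t"
  using antilinear_tensor_antimap[of f g] by (simp add: antilinear_def)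

lemma tensor_antimap_sum:
  "antilinear f \<Longrightarrow> antilinear g \<Longrightarrow> tensor_antimap f g (\<Sum>i\<in>I. a i \<otimes> b i) = (\<Sum>i\<in>I. f (a i) \<otimes> g (b i))"
  by (simp add: antilinear_sum[OF antilinear_tensor_antimap] tensor_antimap_tens)

lemma cbilinear_times [clin]: "cbilinear ((*) :: 'a::complex_algebra_1 \<Rightarrow> 'a \<Rightarrow> 'a)"
  by (intro cbilinearI clin)

lemma tensor_map_id_tens: "clinear g \<Longrightarrow> tensor_map id g (a \<otimes> b) = a \<otimes> g b"
  by (simp only: tensor_map_tens[OF clinear_id_const]) simp

lemma tlift_tensor_map2:
  assumes \<mu>: "cbilinear \<mu>" and p: "cbilinear p" and q: "cbilinear q"
  shows "tlift \<mu> (tensor_map2 p q s t) = tlift (\<lambda>x1 x2. tlift (\<lambda>g1 g2. \<mu> (p g1 x1) (q g2 x2)) s) t"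
proof -
  note [clin] = cbilinear_comp_left[OF \<mu>] cbilinear_comp_right[OF \<mu>] cbilinear_comp_left[OF p]
    cbilinear_comp_right[OF p] cbilinear_comp_left[OF q] cbilinear_comp_right[OF q]
    clinear_tensor_map2_right[OF p q] clinear_tensor_map2_left[OF p q]
  have b: "cbilinear (\<lambda>g1 g2. \<mu> (p g1 x1) (q g2 x2))" for x1 x2
    by (intro clin)
  have b2: "cbilinear (\<lambda>x1 x2. tlift (\<lambda>g1 g2. \<mu> (p g1 x1) (q g2 x2)) s)" for s
    by (intro clin)
  have 1: "tlift \<mu> (tensor_map2 p q s (x1 \<otimes> x2)) = tlift (\<lambda>g1 g2. \<mu> (p g1 x1) (q g2 x2)) s" for x1 x2
  proof (rule clinear_eq_tensor[of "\<lambda>s. tlift \<mu> (tensor_map2 p q s (x1 \<otimes> x2))"])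
    show "clinear (\<lambda>s. tlift \<mu> (tensor_map2 p q s (x1 \<otimes> x2)))"
      "clinear (\<lambda>s. tlift (\<lambda>g1 g2. \<mu> (p g1 x1) (q g2 x2)) s)" by (intro clin \<mu>)+
  qed (simp add: tensor_map2_tens p q tlift_tens \<mu> b)
  show ?thesis
  proof (rule clinear_eq_tensor)
    show "clinear (\<lambda>t. tlift \<mu> (tensor_map2 p q s t))"
      "clinear (\<lambda>t. tlift (\<lambda>x1 x2. tlift (\<lambda>g1 g2. \<mu> (p g1 x1) (q g2 x2)) s) t)" by (intro clin \<mu>)+
  qed (simp add: 1 tlift_tens b2)
qed

lemma slice_tensor_map2:
  fixes p :: "'g::complex_algebra_1 \<Rightarrow> complex"
  assumes p: "clinear p" and q: "cbilinear q"
  shows "slice p (tensor_map2 (*) q s (\<Sum>i\<in>I. a i \<otimes> x i)) = (\<Sum>i\<in>I. q (slice (\<lambda>g. p (g * a i)) s) (x i))"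
proof -
  have ql: "clinear (\<lambda>a. q a x)" for x using q by (simp add: cbilinear_def)
  have pl: "clinear (\<lambda>g. p (g * b))" for b
    by (intro clinear_comp[OF p] clin)
  note tm = cbilinear_times q
  note [clin] = clinear_comp[OF ql] clinear_tensor_map2_left[OF tm] p pl
  show ?thesis
  proof (rule clinear_eq_tensor[of "\<lambda>s. slice p (tensor_map2 (*) q s (\<Sum>i\<in>I. a i \<otimes> x i))"])
    show "clinear (\<lambda>s. slice p (tensor_map2 (*) q s (\<Sum>i\<in>I. a i \<otimes> x i)))"
      "clinear (\<lambda>s. \<Sum>i\<in>I. q (slice (\<lambda>g. p (g * a i)) s) (x i))" by (intro clin)+
  qed (simp add: clinear_sum[OF clinear_tensor_map2_right[OF tm clinear_ident]]
      tensor_map2_tens[OF tm] slice_tens slice_sum p pl clinear_scale[OF ql])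
qed

lemma tensor_assoc_natural:
  assumes "clinear f"
  shows "tensor_map id (tensor_map id f) (tensor_assoc t) = tensor_assoc (tensor_map id f t)"
proof -
  note [clin] = assms
  have l: "clinear (tensor_map id f)" by (intro clin)
  note [clin] = l
  have 1: "tensor_map id (tensor_map id f) (tensor_assoc (s \<otimes> c)) = tensor_assoc (s \<otimes> f c)" for s c
    by (rule clinear_eq_tensor[of "\<lambda>s. tensor_map id (tensor_map id f) (tensor_assoc (s \<otimes> c))"])
      ((intro clin)+, simp only: tensor_assoc_tens tensor_map_id_tens[OF l] tensor_map_id_tens[OF assms])
  show ?thesis
    by (rule clinear_eq_tensor[of "\<lambda>t. tensor_map id (tensor_map id f) (tensor_assoc t)"])
      ((intro clin)+, simp only: 1 tensor_map_id_tens[OF assms])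
qed

section \<open>Comodules, the antipode and the Haar functional\<close>

definition act :: "('v \<Rightarrow> 'g::complex_vector \<otimes>\<^sub>C 'v::complex_vector) \<Rightarrow> ('g \<Rightarrow> complex) \<Rightarrow> 'v \<Rightarrow> 'v" where
  "act \<delta> p v = slice p (\<delta> v)"

lemma clinear_act [clin]: "clinear \<delta> \<Longrightarrow> clinear p \<Longrightarrow> clinear f \<Longrightarrow> clinear (\<lambda>x. act \<delta> p (f x))"
  unfolding act_def by (rule clinear_slice, assumption, rule clinear_comp)

context hopf_star_algebra
begin

lemmas hopf_clin [clin] = clinear_comp[OF comult_linear] clinear_comp[OF counit_linear]
  clinear_comp[OF antipode_linear]

lemma star_one [simp]: "star G 1 = 1"
  using star_mult[of 1 "star G 1"] by (simp add: star_star)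

lemma star_0 [simp]: "star G 0 = 0"
  by (rule antilinear_0[OF star_antilinear])

lemma star_eq_0_iff: "star G a = 0 \<longleftrightarrow> a = 0"
  by (metis star_star star_0)

text \<open>A consequence of the uniqueness of the counit:
  \<open>\<lambda>a. cnj (counit G (star G a))\<close> satisfies the right counit law, and a left
  and a right counit agree.\<close>

lemma counit_star: "counit G (star G a) = cnj (counit G a)"
proof -
  define e where "e x = cnj (counit G (star G x))" for x
  have e: "clinear e"
    using star_antilinear by (simp add: e_def clinear_iff antilinear_def clinear_add[OF counit_linear]
        clinear_scale[OF counit_linear] scaleC_complex)
  have "tlift (\<lambda>x y. e y *\<^sub>C x) (comult G a) = a"
  proof -
    have t: "star G (tlift (\<lambda>x y. counit G y *\<^sub>C x) (tensor_antimap (star G) (star G) t))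
      = tlift (\<lambda>x y. e y *\<^sub>C x) t" for t
    proof (induction t rule: tensor_induct)
      case (tens a b)
      have "star G (counit G (star G b) *\<^sub>C star G a) = e b *\<^sub>C a"
        using star_antilinear by (simp add: e_def antilinear_def star_star)
      then show ?case
        unfolding tensor_antimap_tens[OF star_antilinear star_antilinear]
        by (subst (1 2) tlift_tens) (intro clin clinear_comp[OF e])+
    next
      case (plus s t)
      have "tlift (\<lambda>(x::'g) y. counit G y *\<^sub>C x) (s + t) = tlift (\<lambda>x y. counit G y *\<^sub>C x) s + tlift (\<lambda>x y. counit G y *\<^sub>C x) t"
        "tlift (\<lambda>(x::'g) y. e y *\<^sub>C x) (s + t) = tlift (\<lambda>x y. e y *\<^sub>C x) s + tlift (\<lambda>x y. e y *\<^sub>C x) t" for s t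
        by (rule tlift_add, intro clin clinear_comp[OF e])+
      then show ?case
        using plus star_antilinear
        by (simp add: tensor_antimap_add) (simp add: antilinear_def)
    qed
    have "tlift (\<lambda>x y. e y *\<^sub>C x) (comult G a) = star G (star G a)"
      unfolding t[symmetric] star_comult[symmetric] counit_right ..
    then show ?thesis by (simp add: star_star)
  qed
  then have "counit G a = counit G (tlift (\<lambda>x y. e y *\<^sub>C x) (comult G a))" by simp
  also have "\<dots> = e (tlift (\<lambda>x y. counit G x *\<^sub>C y) (comult G a))"
    by (simp add: clinear_tlift_push counit_linear e clinear_scale[OF counit_linear] clinear_scale[OF e]
        scaleC_complex mult.commute)
  also have "\<dots> = e a" by (simp add: counit_left)
  finally show ?thesis by (simp add: e_def)
qed

lemma comodule_comult: "comodule G (comult G)"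
  by (simp add: comodule_def comult_linear coassoc counit_left)

text \<open>Sweedler renumbering: coassociativity is tested on an arbitrary expression linear in
  each of the three legs, so that computations with the antipode need not mention
  \<open>tensor_assoc\<close>.\<close>

lemma comodule_coassoc:
  assumes \<delta>: "comodule G \<delta>"
    and \<mu>: "\<And>a b. clinear (\<mu> a b)" "\<And>a c. clinear (\<lambda>b. \<mu> a b c)" "\<And>b c. clinear (\<lambda>a. \<mu> a b c)"
  shows "tlift (\<lambda>a x. tlift (\<lambda>b c. \<mu> b c x) (comult G a)) (\<delta> v)
    = tlift (\<lambda>a x. tlift (\<lambda>b y. \<mu> a b y) (\<delta> x)) (\<delta> v)"
proof -
  have [clin]: "clinear \<delta>" using \<delta> by (simp add: comodule_def)
  note [clin] = clinear_comp[OF \<open>clinear \<delta>\<close>] clinear_comp[OF \<mu>(1)] clinear_comp[OF \<mu>(2)] clinear_comp[OF \<mu>(3)]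
  define \<Phi> where "\<Phi> = tlift (\<lambda>a s. tlift (\<lambda>b y. \<mu> a b y) s)"
  have b: "cbilinear (\<lambda>a s. tlift (\<lambda>b y. \<mu> a b y) s)" by (intro clin)
  have b1: "cbilinear (\<lambda>b y. \<mu> a b y)" for a by (intro clin)
  have b2: "cbilinear (\<lambda>b c. \<mu> b c x)" for x by (intro clin)
  have b3: "cbilinear (\<lambda>a x. tlift (\<lambda>b c. \<mu> b c x) (comult G a))" by (intro clin)
  have \<Phi>lin: "clinear \<Phi>" unfolding \<Phi>_def by (rule clinear_tlift[OF b])
  note [clin] = clinear_comp[OF \<Phi>lin]
  have *: "\<Phi> (tensor_assoc (s \<otimes> x)) = tlift (\<lambda>b c. \<mu> b c x) s" for s x
    by (rule clinear_eq_tensor[of "\<lambda>s. \<Phi> (tensor_assoc (s \<otimes> x))"])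
      (intro clin | simp add: tensor_assoc_tens tlift_tens b1 b2 b \<Phi>_def)+
  have "\<Phi> (tensor_assoc (tensor_map (comult G) id t)) = tlift (\<lambda>a x. tlift (\<lambda>b c. \<mu> b c x) (comult G a)) t" for t
    by (rule clinear_eq_tensor[of "\<lambda>t. \<Phi> (tensor_assoc (tensor_map (comult G) id t))"])
      (intro clin comult_linear | simp add: tlift_tens b3 tensor_map_tens comult_linear clin *)+
  moreover have "\<Phi> (tensor_map id \<delta> t) = tlift (\<lambda>a x. tlift (\<lambda>b y. \<mu> a b y) (\<delta> x)) t" for t
    unfolding \<Phi>_def by (subst tlift_tensor_map[OF b]) (simp_all add: clin)
  ultimately show ?thesis
    using \<delta> unfolding comodule_def by metis
qed

text \<open>The antipode inverts the passage from Y to the map v \<mapsto> v(-1) Y(v(0)), since the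
  legs collapse by S(a(1)) a(2) = counit(a). The next lemma is the opposite order, and
  \<open>antipode_cancel_zero\<close> the resulting injectivity.\<close>

lemma antipode_cancel_left:
  assumes \<delta>: "comodule G \<delta>" and lm: "cbilinear lm" "\<And>a b v. lm (a * b) v = lm a (lm b v)" "\<And>v. lm 1 v = v"
    and Y: "clinear Y"
  shows "tlift (\<lambda>a x. lm (antipode G a) (tlift (\<lambda>b y. lm b (Y y)) (\<delta> x))) (\<delta> v) = Y v"
proof -
  note lml = cbilinear_left[OF lm(1)]
  note [clin] = cbilinear_comp_left[OF lm(1)] cbilinear_comp_right[OF lm(1)] clinear_comp[OF Y]
  have "tlift (\<lambda>a x. lm (antipode G a) (tlift (\<lambda>b y. lm b (Y y)) (\<delta> x))) (\<delta> v)
      = tlift (\<lambda>a x. tlift (\<lambda>b y. lm (antipode G a * b) (Y y)) (\<delta> x)) (\<delta> v)"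
    by (simp add: clinear_tlift_push[OF cbilinear_right[OF lm(1)]] lm(2))
  also have "\<dots> = tlift (\<lambda>a x. tlift (\<lambda>b c. lm (antipode G b * c) (Y x)) (comult G a)) (\<delta> v)"
    by (rule comodule_coassoc[OF \<delta>, symmetric]) (intro clin)+
  also have "\<dots> = tlift (\<lambda>a x. lm (tlift (\<lambda>b c. antipode G b * c) (comult G a)) (Y x)) (\<delta> v)"
    by (subst clinear_tlift_push[OF lml]) (rule refl)
  also have "\<dots> = Y (tlift (\<lambda>a x. counit G a *\<^sub>C x) (\<delta> v))"
    by (simp add: antipode_left clinear_scale[OF lml] lm(3) clinear_tlift_push[OF Y] clinear_scale[OF Y])
  finally show ?thesis using \<delta> by (simp add: comodule_def)
qed

lemma antipode_cancel_right:
  assumes \<delta>: "comodule G \<delta>" and lm: "cbilinear lm" "\<And>a b v. lm (a * b) v = lm a (lm b v)" "\<And>v. lm 1 v = v"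
    and Y: "clinear Y"
  shows "tlift (\<lambda>a x. lm a (tlift (\<lambda>b y. lm (antipode G b) (Y y)) (\<delta> x))) (\<delta> v) = Y v"
proof -
  note lml = cbilinear_left[OF lm(1)]
  note [clin] = cbilinear_comp_left[OF lm(1)] cbilinear_comp_right[OF lm(1)] clinear_comp[OF Y]
  have "tlift (\<lambda>a x. lm a (tlift (\<lambda>b y. lm (antipode G b) (Y y)) (\<delta> x))) (\<delta> v)
      = tlift (\<lambda>a x. tlift (\<lambda>b y. lm (a * antipode G b) (Y y)) (\<delta> x)) (\<delta> v)"
    by (simp add: clinear_tlift_push[OF cbilinear_right[OF lm(1)]] lm(2))
  also have "\<dots> = tlift (\<lambda>a x. tlift (\<lambda>b c. lm (b * antipode G c) (Y x)) (comult G a)) (\<delta> v)"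
    by (rule comodule_coassoc[OF \<delta>, symmetric]) (intro clin)+
  also have "\<dots> = tlift (\<lambda>a x. lm (tlift (\<lambda>b c. b * antipode G c) (comult G a)) (Y x)) (\<delta> v)"
    by (subst clinear_tlift_push[OF lml]) (rule refl)
  also have "\<dots> = Y (tlift (\<lambda>a x. counit G a *\<^sub>C x) (\<delta> v))"
    by (simp add: antipode_right clinear_scale[OF lml] lm(3) clinear_tlift_push[OF Y] clinear_scale[OF Y])
  finally show ?thesis using \<delta> by (simp add: comodule_def)
qed

lemma antipode_cancel_zero:
  assumes \<delta>: "comodule G \<delta>" and lm: "cbilinear lm" "\<And>a b v. lm (a * b) v = lm a (lm b v)" "\<And>v. lm 1 v = v"
    and Y: "clinear Y" and 0: "\<And>v. tlift (\<lambda>b y. lm b (Y y)) (\<delta> v) = 0"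
  shows "Y v = 0"
proof -
  have "Y v = tlift (\<lambda>a x. lm (antipode G a) 0) (\<delta> v)"
    using antipode_cancel_left[OF \<delta> lm Y, of v] by (simp add: 0)
  also have "\<dots> = 0"
    by (simp add: clinear_0[OF cbilinear_right[OF lm(1)]] tlift_def free_lift_def)
  finally show ?thesis .
qed

end

context compact_quantum_group_algebra
begin

lemmas haar_clin [clin] = clinear_comp[OF haar_linear]

text \<open>Put x = b(1) in the invariance h(g x) 1 = h(g(1) x(1)) g(2) x(2) and multiply by S(b(2))
  on the right; coassociativity then collapses the last two legs of b.\<close>

lemma haar_slide:
  "tlift (\<lambda>x y. haar G (x * b) *\<^sub>C y) (comult G g) = tlift (\<lambda>x y. haar G (g * x) *\<^sub>C antipode G y) (comult G b)"
proof -
  have inv: "haar G (g * x) *\<^sub>C 1 = tlift (\<lambda>x1 x2. tlift (\<lambda>g1 g2. haar G (g1 * x1) *\<^sub>C (g2 * x2)) (comult G g)) (comult G x)" for x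
  proof -
    show ?thesis
      unfolding haar_right[symmetric] comult_mult by (subst tlift_tensor_map2) ((intro clin)+, rule refl)
  qed
  have "haar G (g * x) *\<^sub>C antipode G y = (haar G (g * x) *\<^sub>C 1) * antipode G y" for x y
    by (simp add: mult_scaleC_left)
  then have "tlift (\<lambda>x y. haar G (g * x) *\<^sub>C antipode G y) (comult G b)
    = tlift (\<lambda>x y. tlift (\<lambda>x1 x2. tlift (\<lambda>g1 g2. haar G (g1 * x1) *\<^sub>C (g2 * x2 * antipode G y)) (comult G g)) (comult G x)) (comult G b)"
    unfolding inv by (simp add: clinear_tlift_push[OF clinear_mult_left[OF clinear_ident]] mult_scaleC_left)
  also have "\<dots> = tlift (\<lambda>x y. tlift (\<lambda>y1 y2. tlift (\<lambda>g1 g2. haar G (g1 * x) *\<^sub>C (g2 * y1 * antipode G y2)) (comult G g)) (comult G y)) (comult G b)"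
    by (rule comodule_coassoc[OF comodule_comult]) (intro clin)+
  also have "\<dots> = tlift (\<lambda>x y. tlift (\<lambda>g1 g2. tlift (\<lambda>y1 y2. haar G (g1 * x) *\<^sub>C (g2 * y1 * antipode G y2)) (comult G y)) (comult G g)) (comult G b)"
    by (subst tlift_tlift_swap) (intro clin, rule refl)
  also have "\<dots> = tlift (\<lambda>x y. tlift (\<lambda>g1 g2. haar G (g1 * x) *\<^sub>C (g2 * tlift (\<lambda>y1 y2. y1 * antipode G y2) (comult G y))) (comult G g)) (comult G b)"
    by (simp add: clinear_tlift_push[OF clinear_mult_right[OF clinear_ident]]
        clinear_tlift_push[OF clinear_scaleC_right[OF clinear_ident]] mult.assoc)
  also have "\<dots> = tlift (\<lambda>x y. tlift (\<lambda>g1 g2. haar G (g1 * (counit G y *\<^sub>C x)) *\<^sub>C g2) (comult G g)) (comult G b)"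
    by (simp add: antipode_right mult_scaleC_right clinear_scale[OF haar_linear] scaleC_scaleC scaleC_complex mult.commute)
  also have "\<dots> = tlift (\<lambda>g1 g2. tlift (\<lambda>x y. haar G (g1 * (counit G y *\<^sub>C x)) *\<^sub>C g2) (comult G b)) (comult G g)"
    by (rule tlift_tlift_swap) (intro clin)
  also have "\<dots> = tlift (\<lambda>g1 g2. haar G (g1 * tlift (\<lambda>x y. counit G y *\<^sub>C x) (comult G b)) *\<^sub>C g2) (comult G g)"
    by (simp add: clinear_tlift_push[OF clinear_mult_right[OF clinear_ident]]
        clinear_tlift_push[OF haar_linear] clinear_tlift_push[OF clinear_scaleC_left[OF clinear_ident]])
  finally show ?thesis by (simp add: counit_right)
qed

text \<open>Positivity is assumed only on the diagonal, and with the adjoint on the left; applying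
  it to \<open>star G x\<close> puts the adjoint on the right, and polarisation supplies the
  Hermitian symmetry.\<close>

sublocale haar_form: inner_form "\<lambda>x y. haar G (x * star G y)"
proof (intro inner_form.intro psd_form.intro inner_form_axioms.intro)
  have l: "clinear (\<lambda>x. haar G (x * y))" for y by (intro clin)
  show "clinear (\<lambda>x. haar G (x * star G y))" for y by (rule l)
  have pos: "haar G (x * star G x) \<in> \<real> \<and> 0 \<le> Re (haar G (x * star G x))
    \<and> (x \<noteq> 0 \<longrightarrow> haar G (x * star G x) \<noteq> 0)" for x
    using haar_pos[of "star G x"] by (cases "x = 0") (auto simp: star_star star_eq_0_iff clinear_0[OF haar_linear])
  then show "0 \<le> Re (haar G (x * star G x))" "x \<noteq> 0 \<Longrightarrow> haar G (x * star G x) \<noteq> 0" for x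
    by auto
  have "antilinear (\<lambda>y. haar G (x * star G y))" for x
    using star_antilinear by (simp add: antilinear_def distrib_left mult_scaleC_right clinear_add[OF haar_linear]
        clinear_scale[OF haar_linear])
  moreover have "antilinear cnj" by (simp add: antilinear_def scaleC_complex)
  ultimately show "haar G (y * star G x) = cnj (haar G (x * star G y))" for x y
    using sesquilinear_polarisation[of "\<lambda>x y. haar G (x * star G y)" cnj x y] l pos
    by (simp add: Reals_cnj_iff)
qed

lemma haar_star: "haar G (star G x) = cnj (haar G x)"
  using haar_form.hermitian[of 1 x] by simp

lemma haar_represents_counit:
  assumes "finite S"
  shows "\<exists>b. \<forall>c\<in>cvec.span S. haar G (c * b) = counit G c"
  using haar_form.riesz[OF assms counit_linear] by metis

end

section \<open>The base of a quantum homogeneous space\<close>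

context quantum_homogeneous_space
begin

lemmas qhs_clin [clin] = clinear_comp[OF pi_linear] clinear_comp[OF incl_linear]
  incl_linear pi_linear

lemma star_coinvariant: "star G g \<in> coinvariants G \<pi>" if "g \<in> coinvariants G \<pi>"
proof -
  have t: "tensor_map id \<pi> (tensor_antimap (star G) (star G) t)
    = tensor_antimap (star G) (star H) (tensor_map id \<pi> t)" for t
  proof (induction t rule: tensor_induct)
    case (tens a b)
    then show ?case
      by (simp only: tensor_antimap_tens G.star_antilinear H.star_antilinear tensor_map_id_tens[OF pi_linear] pi_star)
  next
    case (plus s t)
    then show ?case
      by (simp only: tensor_antimap_add G.star_antilinear H.star_antilinear
          clinear_add[OF clinear_tensor_map[OF clinear_id_const pi_linear clinear_ident]])
  qed
  show ?thesis
    using that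
    by (simp add: coinvariants_def G.star_comult t tensor_antimap_tens G.star_antilinear H.star_antilinear)
qed

lemma incl_base_star [simp]: "\<iota> (base_star G \<iota> m) = star G (\<iota> m)"
proof -
  have "star G (\<iota> m) \<in> range \<iota>"
    using star_coinvariant[of "\<iota> m"] incl_range by blast
  then show ?thesis
    by (simp add: base_star_def f_inv_into_f)
qed

lemma incl_eq_iff: "\<iota> x = \<iota> y \<longleftrightarrow> x = y"
  using incl_inj by (simp add: inj_eq)

lemma base_star_antilinear: "antilinear (base_star G \<iota>)"
  using G.star_antilinear
  by (simp add: antilinear_def incl_eq_iff[symmetric] clinear_add[OF incl_linear] clinear_scale[OF incl_linear])

lemma base_star_star [simp]: "base_star G \<iota> (base_star G \<iota> m) = m"
  by (simp add: incl_eq_iff[symmetric] G.star_star)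

lemma base_star_mult: "base_star G \<iota> (m * m') = base_star G \<iota> m' * base_star G \<iota> m"
  by (simp add: incl_eq_iff[symmetric] G.star_mult incl_mult)

text \<open>A slice contracts the left leg while coinvariance concerns the right one, so
  coassociativity makes \<open>M\<close> a left subcomodule.\<close>

lemma slice_coinvariant:
  assumes g: "g \<in> coinvariants G \<pi>" and p: "clinear p"
  shows "slice p (comult G g) \<in> coinvariants G \<pi>"
proof -
  note [clin] = clinear_comp[OF p]
  have "tensor_map id \<pi> (comult G (slice p (comult G g)))
    = tlift (\<lambda>a x. tlift (\<lambda>b y. p a *\<^sub>C (b \<otimes> \<pi> y)) (comult G x)) (comult G g)"
  proof -
    have l: "clinear (\<lambda>x. tensor_map id \<pi> (comult G x))" by (intro clin)
    have t: "c *\<^sub>C tensor_map id \<pi> t = tlift (\<lambda>b y. c *\<^sub>C (b \<otimes> \<pi> y)) t" for c and t :: "'g \<otimes>\<^sub>C 'g"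
      by (simp add: tensor_map_def clinear_tlift_push[OF clinear_scaleC_right[OF clinear_ident]])
    show ?thesis
      unfolding slice_def clinear_tlift_push[OF l] clinear_scale[OF l] t ..
  qed
  also have "\<dots> = tlift (\<lambda>a x. tlift (\<lambda>b y. p b *\<^sub>C (y \<otimes> \<pi> x)) (comult G a)) (comult G g)"
    by (rule G.comodule_coassoc[OF G.comodule_comult, symmetric]) (intro clin)+
  also have "\<dots> = tlift (\<lambda>a z. tlift (\<lambda>b y. p b *\<^sub>C (y \<otimes> z)) (comult G a)) (tensor_map id \<pi> (comult G g))"
    by (subst tlift_tensor_map) ((intro clin)+, simp)
  also have "\<dots> = tlift (\<lambda>a z. tlift (\<lambda>b y. p b *\<^sub>C (y \<otimes> z)) (comult G a)) (g \<otimes> 1)"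
    using g by (simp add: coinvariants_def)
  also have "\<dots> = tlift (\<lambda>b y. p b *\<^sub>C (y \<otimes> 1)) (comult G g)"
    by (subst tlift_tens) (intro clin, rule refl)
  also have "\<dots> = slice p (comult G g) \<otimes> 1"
    unfolding slice_def
    by (simp add: clinear_tlift_push[OF clinear_tens_left[OF clinear_ident]] tens_scale_left)
  finally show ?thesis by (simp add: coinvariants_def)
qed

text \<open>\<open>base_coaction\<close> is defined as an inverse image; the preceding lemma shows
  that there is one.\<close>

lemma base_coaction: "tensor_map id \<iota> (base_coaction G \<iota> m) = comult G (\<iota> m)"
proof -
  have "slice p (comult G (\<iota> m)) \<in> range \<iota>" if "clinear p" for p
    using slice_coinvariant[OF _ that, of "\<iota> m"] incl_range by blast
  then have "comult G (\<iota> m) \<in> range (tensor_map id \<iota>)"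
    using tensor_map_id_range[OF incl_linear] by (metis rangeI)
  then show ?thesis
    unfolding base_coaction_def by (rule f_inv_into_f)
qed

lemma tensor_map_incl_eqI: "tensor_map (id :: 'g \<Rightarrow> 'g) \<iota> s = tensor_map id \<iota> t \<Longrightarrow> s = t"
  by (rule injD[OF tensor_map_id_inj[OF incl_linear incl_inj]])

lemma tensor_map_incl_linear: "clinear (tensor_map (id :: 'g \<Rightarrow> 'g) \<iota>)"
  by (intro clin)

lemma base_coaction_linear: "clinear (base_coaction G \<iota>)"
  by (rule clinearI; rule tensor_map_incl_eqI)
    (simp_all only: base_coaction clinear_add[OF tensor_map_incl_linear] clinear_scale[OF tensor_map_incl_linear]
      clinear_add[OF incl_linear] clinear_scale[OF incl_linear] clinear_add[OF G.comult_linear] clinear_scale[OF G.comult_linear])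

lemmas base_coaction_clin [clin] = clinear_comp[OF base_coaction_linear]

lemma tensor_map_incl_mult:
  "tensor_map (id :: 'g \<Rightarrow> 'g) \<iota> (tensor_map2 (*) (*) s t) = tensor_map2 (*) (*) (tensor_map id \<iota> s) (tensor_map id \<iota> t)"
proof -
  obtain I a x J b y where s: "s = (\<Sum>i\<in>(I::nat set). a i \<otimes> x i)" and t: "t = (\<Sum>j\<in>(J::nat set). b j \<otimes> y j)"
    by (metis tensor_finite_sum)
  show ?thesis
    unfolding s t
    by (simp only: tensor_map2_sums[OF cbilinear_times cbilinear_times] tensor_map_sum[OF clinear_id_const incl_linear]
        clinear_sum[OF tensor_map_incl_linear] tensor_map_id_tens[OF incl_linear] incl_mult id_apply)
qed

lemma base_coaction_mult:
  "base_coaction G \<iota> (x * y) = tensor_map2 (*) (*) (base_coaction G \<iota> x) (base_coaction G \<iota> y)"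
  by (rule tensor_map_incl_eqI) (simp only: base_coaction tensor_map_incl_mult incl_mult G.comult_mult)

text \<open>Both comodule laws are checked after embedding into G, where they are those of the
  comultiplication.\<close>

lemma base_comodule: "comodule G (base_coaction G \<iota>)"
  unfolding comodule_def
proof (intro conjI allI)
  show "clinear (base_coaction G \<iota>)" by (rule base_coaction_linear)
next
  fix m
  have inj: "inj (tensor_map (id :: 'g \<Rightarrow> 'g) (tensor_map (id :: 'g \<Rightarrow> 'g) \<iota>))"
    by (rule tensor_map_id_inj[OF tensor_map_incl_linear]) (rule tensor_map_id_inj[OF incl_linear incl_inj])
  have 1: "tensor_map id \<iota> (tensor_map (comult G) id t) = tensor_map (comult G) id (tensor_map id \<iota> t)" for t
    by (rule clinear_eq_tensor[of "\<lambda>t. tensor_map id \<iota> (tensor_map (comult G) id t)"])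
      ((intro clin G.comult_linear)+, simp add: tensor_map_tens clin G.comult_linear)
  have 2: "tensor_map id (tensor_map id \<iota>) (tensor_map id (base_coaction G \<iota>) t)
      = tensor_map id (comult G) (tensor_map id \<iota> t)" for t :: "'g \<otimes>\<^sub>C 'm"
  proof (rule clinear_eq_tensor[of "\<lambda>t. tensor_map id (tensor_map id \<iota>) (tensor_map id (base_coaction G \<iota>) t)"])
    show "clinear (\<lambda>t::'g \<otimes>\<^sub>C 'm. tensor_map id (tensor_map id \<iota>) (tensor_map id (base_coaction G \<iota>) t))"
      by (intro clin tensor_map_incl_linear base_coaction_linear)
    show "clinear (\<lambda>t::'g \<otimes>\<^sub>C 'm. tensor_map id (comult G) (tensor_map id \<iota> t))"
      by (intro clin G.comult_linear)
  qed (simp only: tensor_map_id_tens[OF base_coaction_linear] tensor_map_id_tens[OF tensor_map_incl_linear]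
      tensor_map_id_tens[OF incl_linear] tensor_map_id_tens[OF G.comult_linear] base_coaction)
  show "tensor_assoc (tensor_map (comult G) id (base_coaction G \<iota> m)) = tensor_map id (base_coaction G \<iota>) (base_coaction G \<iota> m)"
    by (rule injD[OF inj]) (simp only: tensor_assoc_natural[OF incl_linear] 1 2 base_coaction G.coassoc)
  have "\<iota> (tlift (\<lambda>g w. counit G g *\<^sub>C w) (base_coaction G \<iota> m))
      = tlift (\<lambda>g w. counit G g *\<^sub>C w) (tensor_map id \<iota> (base_coaction G \<iota> m))"
    by (subst tlift_tensor_map) ((intro clin)+, simp add: clinear_tlift_push[OF incl_linear] clinear_scale[OF incl_linear])
  then show "tlift (\<lambda>g w. counit G g *\<^sub>C w) (base_coaction G \<iota> m) = m"
    by (simp add: base_coaction G.counit_left incl_eq_iff)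
qed

lemma incl_act: "clinear p \<Longrightarrow> \<iota> (act (base_coaction G \<iota>) p m) = slice p (comult G (\<iota> m))"
  unfolding act_def base_coaction[symmetric] by (simp add: slice_tensor_map clin incl_linear)

lemma act_haar_finite_rank:
  "\<exists>S. finite S \<and> (\<forall>m. act (base_coaction G \<iota>) (\<lambda>g. haar G (g * b)) m \<in> cvec.span S)"
proof -
  obtain I x y where I: "finite (I::nat set)" and b: "comult G b = (\<Sum>i\<in>I. x i \<otimes> y i)"
    by (rule tensor_finite_sum)
  have p: "clinear (\<lambda>g. haar G (g * b))" by (intro clin)
  have "\<iota> (act (base_coaction G \<iota>) (\<lambda>g. haar G (g * b)) m) \<in> cvec.span ((\<lambda>i. antipode G (y i)) ` I)" for m
  proof -
    have "cbilinear (\<lambda>x y. haar G (\<iota> m * x) *\<^sub>C antipode G y)" by (intro clin)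
    then have "\<iota> (act (base_coaction G \<iota>) (\<lambda>g. haar G (g * b)) m)
      = (\<Sum>i\<in>I. haar G (\<iota> m * x i) *\<^sub>C antipode G (y i))"
      by (simp add: incl_act p slice_def G.haar_slide b tlift_sum tlift_tens)
    then show ?thesis
      by (auto intro: cvec.span_sum cvec.span_scale cvec.span_base)
  qed
  then have "\<iota> ` range (act (base_coaction G \<iota>) (\<lambda>g. haar G (g * b))) \<subseteq> cvec.span ((\<lambda>i. antipode G (y i)) ` I)"
    by blast
  from finite_span_vimage[OF incl_linear incl_inj _ this] I show ?thesis by blast
qed

lemma base_counit_mult: "counit G (\<iota> (x * y)) = counit G (\<iota> x) * counit G (\<iota> y)"
  by (simp add: incl_mult G.counit_mult)

lemma base_counit_star: "counit G (\<iota> (base_star G \<iota> x)) = cnj (counit G (\<iota> x))"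
  by (simp add: G.counit_star)

lemma base_pos_props:
  assumes "x \<in> base_pos G \<iota>"
  shows "x \<noteq> 0" "base_star G \<iota> x = x" "0 \<le> Re (counit G (\<iota> x))"
proof -
  obtain ps :: "(real \<times> 'm) list" where ps: "\<forall>(l, m)\<in>set ps. 0 \<le> l"
    and x: "x = (\<Sum>(l, m)\<leftarrow>ps. complex_of_real l *\<^sub>C (m * base_star G \<iota> m))"
    using assms by (auto simp: base_pos_def)
  show "x \<noteq> 0" using assms by (simp add: base_pos_def)
  have "base_star G \<iota> (\<Sum>(l, m)\<leftarrow>ps. complex_of_real l *\<^sub>C (m * base_star G \<iota> m))
      = (\<Sum>(l, m)\<leftarrow>ps. complex_of_real l *\<^sub>C (m * base_star G \<iota> m))"
    using base_star_antilinear
    by (induction ps) (auto simp: antilinear_0 antilinear_def base_star_mult)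
  then show "base_star G \<iota> x = x" by (simp add: x)
  have "0 \<le> Re (counit G (\<iota> (\<Sum>(l, m)\<leftarrow>ps. complex_of_real l *\<^sub>C (m * base_star G \<iota> m))))"
    using ps
  proof (induction ps)
    case Nil
    then show ?case by (simp add: clinear_0[OF incl_linear] clinear_0[OF G.counit_linear])
  next
    case (Cons lm ps)
    obtain l m where lm: "lm = (l, m)" by fastforce
    have "counit G (\<iota> (complex_of_real l *\<^sub>C (m * base_star G \<iota> m))) = of_real (l * (cmod (counit G (\<iota> m)))\<^sup>2)"
      by (simp add: clinear_scale[OF incl_linear] clinear_scale[OF G.counit_linear] scaleC_complex
          incl_mult G.counit_mult G.counit_star complex_norm_square[symmetric] del: of_real_power)
    then show ?case
      using Cons lm by (simp add: clinear_add[OF incl_linear] clinear_add[OF G.counit_linear])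
  qed
  then show "0 \<le> Re (counit G (\<iota> x))" by (simp add: x)
qed

end

text \<open>On m e with a generator e, the legs a(i) of e are absorbed into b: only the functionals
  h(. a(i) b) act on m, and each of them has finite rank on M.\<close>

lemma (in quantum_homogeneous_space) bimodule_act_finite_rank:
  assumes F: "covariant_bimodule G \<iota> F"
  shows "\<exists>S. finite S \<and> (\<forall>f. act (coact F) (\<lambda>g. haar G (g * b)) f \<in> cvec.span S)"
proof -
  interpret F: covariant_bimodule G \<iota> F by (rule F)
  let ?p = "\<lambda>g. haar G (g * b)"
  have p: "clinear ?p" by (intro clin)
  have coact: "clinear (coact F)" using F.coact_comodule by (simp add: comodule_def)
  have actl: "clinear (act (coact F) ?p)"
    by (rule clinear_act[OF coact p clinear_ident])
  obtain A where A: "finite A" "\<And>f. \<exists>m. f = (\<Sum>a\<in>A. lact F (m a) a)"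
    using F.finitely_generated by blast
  have "\<exists>S. finite S \<and> (\<forall>m. act (coact F) ?p (lact F m e) \<in> cvec.span S)" for e
  proof -
    obtain I a x where I: "finite (I::nat set)" and e: "coact F e = (\<Sum>i\<in>I. a i \<otimes> x i)"
      by (rule tensor_finite_sum)
    have act: "act (coact F) ?p (lact F m e)
      = (\<Sum>i\<in>I. lact F (act (base_coaction G \<iota>) (\<lambda>g. haar G (g * (a i * b))) m) (x i))" for m
      unfolding act_def F.coact_lact e slice_tensor_map2[OF p F.lact_bilinear] by (simp add: mult.assoc)
    have "\<forall>i. \<exists>S. finite S \<and> (\<forall>m. act (base_coaction G \<iota>) (\<lambda>g. haar G (g * (a i * b))) m \<in> cvec.span S)"
      using act_haar_finite_rank by blast
    then obtain S where S: "\<And>i. finite (S i)"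
      "\<And>i m. act (base_coaction G \<iota>) (\<lambda>g. haar G (g * (a i * b))) m \<in> cvec.span (S i)" by metis
    define S' where "S' = (\<Union>i\<in>I. (\<lambda>s. lact F s (x i)) ` S i)"
    have "act (coact F) ?p (lact F m e) \<in> cvec.span S'" for m
      unfolding act
    proof (rule cvec.span_sum)
      fix i assume i: "i \<in> I"
      have "lact F (act (base_coaction G \<iota>) (\<lambda>g. haar G (g * (a i * b))) m) (x i)
        \<in> (\<lambda>s. lact F s (x i)) ` cvec.span (S i)" using S(2) by blast
      also have "\<dots> = cvec.span ((\<lambda>s. lact F s (x i)) ` S i)"
        by (rule cvp.linear_span_image[symmetric]) (rule cbilinear_left[OF F.lact_bilinear])
      also have "\<dots> \<subseteq> cvec.span S'"
        by (rule cvec.span_mono) (use i in \<open>auto simp: S'_def\<close>)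
      finally show "lact F (act (base_coaction G \<iota>) (\<lambda>g. haar G (g * (a i * b))) m) (x i) \<in> cvec.span S'" .
    qed
    moreover have "finite S'" using I S(1) by (simp add: S'_def)
    ultimately show ?thesis by blast
  qed
  then obtain S where S: "\<And>e. finite (S e)" "\<And>e m. act (coact F) ?p (lact F m e) \<in> cvec.span (S e)"
    by metis
  have "act (coact F) ?p f \<in> cvec.span (\<Union>e\<in>A. S e)" for f
  proof -
    obtain m where f: "f = (\<Sum>a\<in>A. lact F (m a) a)" using A(2) by blast
    show ?thesis
      unfolding f clinear_sum[OF actl]
      by (rule cvec.span_sum) (use S(2) cvec.span_mono[of "S _" "\<Union>e\<in>A. S e"] in blast)
  qed
  moreover have "finite (\<Union>e\<in>A. S e)" using A(1) S(1) by simp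
  ultimately show ?thesis by blast
qed

section \<open>Direct sums and the bigrading\<close>

lemma decomposition_component:
  assumes "direct_sum A I V" "v \<in> V"
  shows "decomposition A I v (\<lambda>i. component A I i v)"
  using theI'[of "decomposition A I v"] assms by (simp add: direct_sum_def component_def)

lemma component_eqI:
  assumes "direct_sum A I V" "v \<in> V" "decomposition A I v c"
  shows "component A I i v = c i"
proof -
  have "(THE c. decomposition A I v c) = c"
    by (rule the1_equality) (use assms in \<open>auto simp: direct_sum_def\<close>)
  then show ?thesis by (simp add: component_def)
qed

lemma decomposition_finite:
  assumes "finite K" "\<And>i. i \<notin> K \<Longrightarrow> c i = 0" "\<And>i. i \<in> I \<Longrightarrow> c i \<in> A i" "\<And>i. i \<notin> I \<Longrightarrow> c i = 0"
  shows "decomposition A I (\<Sum>i\<in>K. c i) c"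
proof -
  have "{i. c i \<noteq> 0} \<subseteq> K" using assms(2) by blast
  then show ?thesis
    using assms finite_subset[OF _ assms(1)]
    by (auto simp: decomposition_def intro!: sum.mono_neutral_right)
qed

lemma decomposition_sum:
  assumes "decomposition A I v c" "finite K" "{i. c i \<noteq> 0} \<subseteq> K"
  shows "v = (\<Sum>i\<in>K. c i)"
proof -
  have "sum c {i. c i \<noteq> 0} = sum c K"
    by (rule sum.mono_neutral_left[OF assms(2,3)]) blast
  moreover have "v = sum c {i. c i \<noteq> 0}"
    using assms(1) unfolding decomposition_def by blast
  ultimately show ?thesis by (rule trans[rotated])
qed

lemma component_in:
  assumes "direct_sum A I V" "v \<in> V" "i \<in> I"
  shows "component A I i v \<in> A i"
  using decomposition_component[OF assms(1,2)] assms(3) by (simp add: decomposition_def)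

lemma component_sum:
  assumes "direct_sum A I V" "v \<in> V"
  obtains K where "finite K" "K \<subseteq> I" "v = (\<Sum>i\<in>K. component A I i v)"
proof (rule that)
  show "finite {i. component A I i v \<noteq> 0}" "{i. component A I i v \<noteq> 0} \<subseteq> I"
    "v = (\<Sum>i\<in>{i. component A I i v \<noteq> 0}. component A I i v)"
    using decomposition_component[OF assms] by (auto simp: decomposition_def)
qed

lemma component_sum_finite:
  assumes "direct_sum A I V" "v \<in> V" "finite I"
  shows "v = (\<Sum>i\<in>I. component A I i v)"
  by (rule decomposition_sum[OF decomposition_component[OF assms(1,2)] assms(3)])
    (use decomposition_component[OF assms(1,2)] in \<open>auto simp: decomposition_def\<close>)

lemma component_add:
  assumes V: "direct_sum A I V" "v \<in> V" "w \<in> V"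
  shows "component A I i (v + w) = component A I i v + component A I i w"
proof -
  note d = decomposition_component[OF V(1,2)] decomposition_component[OF V(1,3)]
  let ?K = "{i. component A I i v \<noteq> 0} \<union> {i. component A I i w \<noteq> 0}"
  have K: "finite ?K" using d by (simp add: decomposition_def)
  have sub: "cvec.subspace V" "\<And>i. i \<in> I \<Longrightarrow> cvec.subspace (A i)" using V(1) by (auto simp: direct_sum_def)
  have "decomposition A I (\<Sum>i\<in>?K. component A I i v + component A I i w)
    (\<lambda>i. component A I i v + component A I i w)"
    using K d sub by (intro decomposition_finite) (auto simp: decomposition_def intro: cvec.subspace_add)
  moreover have "(\<Sum>i\<in>?K. component A I i v + component A I i w) = v + w"
    using decomposition_sum[OF d(1) K] decomposition_sum[OF d(2) K] by (simp add: sum.distrib)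
  ultimately show ?thesis
    using component_eqI[OF V(1), of "v + w"] V(2,3) sub(1) by (simp add: cvec.subspace_add)
qed

lemma component_scale:
  assumes V: "direct_sum A I V" "v \<in> V"
  shows "component A I i (c *\<^sub>C v) = c *\<^sub>C component A I i v"
proof -
  note d = decomposition_component[OF V]
  let ?K = "{i. component A I i v \<noteq> 0}"
  have K: "finite ?K" using d by (simp add: decomposition_def)
  have sub: "cvec.subspace V" "\<And>i. i \<in> I \<Longrightarrow> cvec.subspace (A i)" using V(1) by (auto simp: direct_sum_def)
  have "decomposition A I (\<Sum>i\<in>?K. c *\<^sub>C component A I i v) (\<lambda>i. c *\<^sub>C component A I i v)"
    using K d sub by (intro decomposition_finite) (auto simp: decomposition_def intro: cvec.subspace_scale)
  moreover have "(\<Sum>i\<in>?K. c *\<^sub>C component A I i v) = c *\<^sub>C v"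
    using decomposition_sum[OF d K] by (simp add: cvec.scale_sum_right[symmetric])
  ultimately show ?thesis
    using component_eqI[OF V(1), of "c *\<^sub>C v"] V(2) sub(1) by (simp add: cvec.subspace_scale)
qed

lemma component_homogeneous:
  assumes V: "direct_sum A I V" "j \<in> I" "v \<in> A j"
  shows "component A I i v = (if i = j then v else 0)"
proof -
  have "decomposition A I (\<Sum>i\<in>{j}. if i = j then v else 0) (\<lambda>i. if i = j then v else 0)"
    using V by (intro decomposition_finite) (auto simp: direct_sum_def intro: cvec.subspace_0)
  moreover have "v \<in> V" using V by (auto simp: direct_sum_def)
  ultimately show ?thesis using component_eqI[OF V(1), of v] by simp
qed

section \<open>Projections onto degrees and bidegrees\<close>

context covariant_star_calculus
begin

abbreviation degree_component :: "nat \<Rightarrow> 'w \<Rightarrow> 'w" where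
  "degree_component k \<equiv> component (deg \<Omega>) UNIV k"

lemma clinear_degree_component: "clinear (degree_component k)"
  by (rule clinearI) (simp_all add: component_add[OF deg_direct_sum] component_scale[OF deg_direct_sum])

lemma degree_component_in: "degree_component k \<omega> \<in> deg \<Omega> k"
  by (rule component_in[OF deg_direct_sum]) auto

lemma degree_component_deg: "\<omega> \<in> deg \<Omega> k \<Longrightarrow> degree_component j \<omega> = (if j = k then \<omega> else 0)"
  by (rule component_homogeneous[OF deg_direct_sum]) auto

lemma deg_subspace: "cvec.subspace (deg \<Omega> k)"
  using deg_direct_sum by (simp add: direct_sum_def)

lemma emb_eq_iff: "emb \<Omega> x = emb \<Omega> y \<longleftrightarrow> x = y"
  using emb_inj by (simp add: inj_eq)

lemmas emb_clin [clin] = clinear_comp[OF emb_linear]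

lemma form_comodule: "comodule G (form_coact \<Omega>)"
  using covariant_bimodule.coact_comodule[OF form_bimodule] by (simp add: form_bimodule_def)

lemma form_coact_linear: "clinear (form_coact \<Omega>)"
  using form_comodule by (simp add: comodule_def)

lemmas form_coact_clin [clin] = clinear_comp[OF form_coact_linear]

end

lemma minus_one_power_scaleC: "(- 1) ^ k * x = ((- 1) ^ k :: complex) *\<^sub>C (x :: 'a::complex_algebra_1)"
  by (induction k) (simp_all add: scaleC_one mult.assoc)

context complex_structure
begin

text \<open>The bigrading is given degree by degree, so the projection first selects the total
  degree.\<close>

definition bideg_component :: "nat \<Rightarrow> nat \<Rightarrow> 'w \<Rightarrow> 'w" where
  "bideg_component a b \<omega> =
    component (\<lambda>(a, b). bideg C a b) {(c, e). c + e = a + b} (a, b) (degree_component (a + b) \<omega>)"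

lemma bideg_deg: "bideg C a b \<subseteq> deg \<Omega> (a + b)"
  and bideg_subspace: "cvec.subspace (bideg C a b)"
  using bideg_direct_sum[of "a + b"] by (auto simp: direct_sum_def)

lemma clinear_bideg_component: "clinear (bideg_component a b)"
  unfolding bideg_component_def
  by (rule clinearI)
    (simp_all add: component_add[OF bideg_direct_sum] component_scale[OF bideg_direct_sum]
      degree_component_in clinear_add[OF clinear_degree_component] clinear_scale[OF clinear_degree_component])

lemmas bideg_component_simps = clinear_simps[OF clinear_bideg_component]

lemma bideg_component_in: "bideg_component a b \<omega> \<in> bideg C a b"
  unfolding bideg_component_def
  using component_in[OF bideg_direct_sum degree_component_in, of "(a, b)" "a + b"] by auto

lemma bideg_component_bideg:
  assumes "\<omega> \<in> bideg C c e"
  shows "bideg_component a b \<omega> = (if a = c \<and> b = e then \<omega> else 0)"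
proof -
  have d: "\<omega> \<in> deg \<Omega> (c + e)" using assms bideg_deg by blast
  show ?thesis
  proof (cases "a + b = c + e")
    case True
    then show ?thesis
      using component_homogeneous[OF bideg_direct_sum, of "(c, e)" "a + b" \<omega> "(a, b)"] assms
      by (simp add: bideg_component_def degree_component_deg[OF d])
  next
    case False
    have "component (\<lambda>(a, b). bideg C a b) {(c, e). c + e = a + b} (a, b) 0 = 0"
      using component_scale[OF bideg_direct_sum, of 0 "a + b" "(a, b)" 0] deg_subspace cvec.subspace_0 by auto
    then show ?thesis using False by (auto simp: bideg_component_def degree_component_deg[OF d])
  qed
qed

lemma finite_bidegrees: "finite {(a, b). a + b = (k::nat)}"
  by (rule finite_subset[of _ "{..k} \<times> {..k}"]) auto

lemma deg_sum_bideg_components: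
  assumes "\<omega> \<in> deg \<Omega> k"
  shows "\<omega> = (\<Sum>(a, b)\<in>{(a, b). a + b = k}. bideg_component a b \<omega>)"
proof -
  have "\<omega> = (\<Sum>i\<in>{(a, b). a + b = k}. component (\<lambda>(a, b). bideg C a b) {(a, b). a + b = k} i \<omega>)"
    by (rule component_sum_finite[OF bideg_direct_sum assms finite_bidegrees])
  also have "\<dots> = (\<Sum>(a, b)\<in>{(a, b). a + b = k}. bideg_component a b \<omega>)"
    by (rule sum.cong) (auto simp: bideg_component_def degree_component_deg[OF assms])
  finally show ?thesis .
qed

lemma deg_subset_span: "deg \<Omega> k \<subseteq> cvec.span (\<Union>(a, b)\<in>{(a, b). a + b = k}. bideg C a b)"
proof
  fix \<omega> assume "\<omega> \<in> deg \<Omega> k"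
  then have "\<omega> = (\<Sum>(a, b)\<in>{(a, b). a + b = k}. bideg_component a b \<omega>)"
    by (rule deg_sum_bideg_components)
  also have "\<dots> \<in> cvec.span (\<Union>(a, b)\<in>{(a, b). a + b = k}. bideg C a b)"
    by (rule cvec.span_sum) (use bideg_component_in in \<open>fastforce intro: cvec.span_base\<close>)
  finally show "\<omega> \<in> \<dots>" .
qed

lemma span_deg: "cvec.span (\<Union>k. deg \<Omega> k) = UNIV"
proof -
  have "\<omega> \<in> cvec.span (\<Union>k. deg \<Omega> k)" for \<omega>
  proof -
    obtain K where K: "\<omega> = (\<Sum>i\<in>K. degree_component i \<omega>)"
      using component_sum[OF deg_direct_sum, of \<omega>] by blast
    show ?thesis
      by (subst K, rule cvec.span_sum) (use degree_component_in in \<open>blast intro: cvec.span_base\<close>)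
  qed
  then show ?thesis by blast
qed

lemma span_bideg: "cvec.span (\<Union>a b. bideg C a b) = UNIV"
proof -
  have "deg \<Omega> k \<subseteq> cvec.span (\<Union>a b. bideg C a b)" for k
    using deg_subset_span[of k] cvec.span_mono[of "\<Union>(a, b)\<in>{(a, b). a + b = k}. bideg C a b" "\<Union>a b. bideg C a b"]
    by blast
  then have "cvec.span (\<Union>k. deg \<Omega> k) \<subseteq> cvec.span (\<Union>a b. bideg C a b)"
    by (intro cvec.span_minimal cvec.subspace_span) blast
  then show ?thesis by (auto simp: span_deg)
qed

lemma clinear_eq_bideg:
  assumes "clinear f" "clinear g" "\<And>a b \<omega>. \<omega> \<in> bideg C a b \<Longrightarrow> f \<omega> = g \<omega>"
  shows "f \<omega> = g \<omega>"
  by (rule cvp.linear_eq_on_span[OF assms(1,2), of "\<Union>a b. bideg C a b"]) (use assms(3) span_bideg in auto)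

lemma clinear_eq_deg:
  assumes "clinear f" "clinear g" "\<And>a b \<omega>. a + b = k \<Longrightarrow> \<omega> \<in> bideg C a b \<Longrightarrow> f \<omega> = g \<omega>" "\<omega> \<in> deg \<Omega> k"
  shows "f \<omega> = g \<omega>"
  by (rule cvp.linear_eq_on_span[OF assms(1,2) _ subsetD[OF deg_subset_span assms(4)]])
    (use assms(3) in auto)

lemma bideg_preserving_deg:
  assumes f: "clinear f" and pres: "\<And>a b \<omega>. \<omega> \<in> bideg C a b \<Longrightarrow> f \<omega> \<in> bideg C a b" and \<omega>: "\<omega> \<in> deg \<Omega> k"
  shows "f \<omega> \<in> deg \<Omega> k"
proof -
  have "f \<omega> = (\<Sum>(a, b)\<in>{(a, b). a + b = k}. f (bideg_component a b \<omega>))"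
    by (subst deg_sum_bideg_components[OF \<omega>]) (simp add: clinear_sum[OF f] case_prod_unfold)
  also have "\<dots> \<in> deg \<Omega> k"
  proof (rule cvec.subspace_sum[OF deg_subspace], clarify)
    fix a b assume "k = a + b"
    then show "f (bideg_component a b \<omega>) \<in> deg \<Omega> (a + b)"
      using pres[OF bideg_component_in, of a b \<omega>] bideg_deg by blast
  qed
  finally show ?thesis .
qed

lemma bideg_preserving_component:
  assumes f: "clinear f" and pres: "\<And>a b \<omega>. \<omega> \<in> bideg C a b \<Longrightarrow> f \<omega> \<in> bideg C a b"
  shows "degree_component k (f \<omega>) = f (degree_component k \<omega>)"
proof (rule clinear_eq_bideg[of "\<lambda>\<omega>. degree_component k (f \<omega>)"])
  show "clinear (\<lambda>\<omega>. degree_component k (f \<omega>))" "clinear (\<lambda>\<omega>. f (degree_component k \<omega>))"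
    by (rule clinear_comp[OF clinear_degree_component f], rule clinear_comp[OF f clinear_degree_component])
  fix a b \<omega> assume "\<omega> \<in> bideg C a b"
  then have "\<omega> \<in> deg \<Omega> (a + b)" "f \<omega> \<in> deg \<Omega> (a + b)"
    using pres bideg_deg by blast+
  then show "degree_component k (f \<omega>) = f (degree_component k \<omega>)"
    by (simp add: degree_component_deg clinear_0[OF f])
qed

lemma deg_0_eq: "deg \<Omega> 0 = bideg C 0 0"
proof
  show "deg \<Omega> 0 \<subseteq> bideg C 0 0"
  proof
    fix \<omega> assume "\<omega> \<in> deg \<Omega> 0"
    moreover have "{(a, b). a + b = (0::nat)} = {(0, 0)}" by auto
    ultimately have "\<omega> = bideg_component 0 0 \<omega>"
      using deg_sum_bideg_components[of \<omega> 0] by simp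
    then show "\<omega> \<in> bideg C 0 0" using bideg_component_in by metis
  qed
qed (use bideg_deg[of 0 0] in simp)

lemma emb_bideg: "emb \<Omega> x \<in> bideg C 0 0"
  using emb_range deg_0_eq by blast

text \<open>The Leibniz rule is assumed for d only; comparing components of bidegree (a, b + 1)
  extracts the one for \<open>delbar\<close>.\<close>

lemma delbar_mult_emb:
  assumes "\<omega> \<in> deg \<Omega> k"
  shows "delbar C (\<omega> * emb \<Omega> x) = delbar C \<omega> * emb \<Omega> x + (- 1) ^ k *\<^sub>C (\<omega> * delbar C (emb \<Omega> x))"
proof (rule clinear_eq_deg[of "\<lambda>\<omega>. delbar C (\<omega> * emb \<Omega> x)"])
  show "clinear (\<lambda>\<omega>. delbar C (\<omega> * emb \<Omega> x))"
    "clinear (\<lambda>\<omega>. delbar C \<omega> * emb \<Omega> x + (- 1) ^ k *\<^sub>C (\<omega> * delbar C (emb \<Omega> x)))"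
    by (intro clin clinear_comp[OF delbar_linear])+
  fix a b \<omega> assume k: "a + b = k" and \<omega>: "\<omega> \<in> bideg C a b"
  have \<omega>k: "\<omega> \<in> deg \<Omega> k" using \<omega> bideg_deg k by blast
  have dm: "del C (emb \<Omega> x) \<in> bideg C 1 0" "delbar C (emb \<Omega> x) \<in> bideg C 0 1"
    using del_bideg[OF emb_bideg] delbar_bideg[OF emb_bideg] by simp_all
  have "\<omega> * emb \<Omega> x \<in> bideg C a b" by (rule bideg_ract[OF \<omega>])
  then have 1: "del C (\<omega> * emb \<Omega> x) \<in> bideg C (Suc a) b" "delbar C (\<omega> * emb \<Omega> x) \<in> bideg C a (Suc b)"
    by (rule del_bideg delbar_bideg)+
  have 2: "del C \<omega> * emb \<Omega> x \<in> bideg C (Suc a) b" "delbar C \<omega> * emb \<Omega> x \<in> bideg C a (Suc b)"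
    using del_bideg[OF \<omega>] delbar_bideg[OF \<omega>] by (simp_all add: bideg_ract)
  have 3: "\<omega> * del C (emb \<Omega> x) \<in> bideg C (Suc a) b" "\<omega> * delbar C (emb \<Omega> x) \<in> bideg C a (Suc b)"
    using bideg_mult[OF \<omega> dm(1)] bideg_mult[OF \<omega> dm(2)] by simp_all
  have "del C (\<omega> * emb \<Omega> x) + delbar C (\<omega> * emb \<Omega> x)
    = del C \<omega> * emb \<Omega> x + delbar C \<omega> * emb \<Omega> x
      + (- 1) ^ k *\<^sub>C (\<omega> * del C (emb \<Omega> x)) + (- 1) ^ k *\<^sub>C (\<omega> * delbar C (emb \<Omega> x))"
    using diff_mult[OF \<omega>k, of "emb \<Omega> x"]
    by (simp add: diff_del_delbar distrib_left distrib_right minus_one_power_scaleC mult.assoc mult_scaleC_left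
        scaleC_add_right add.assoc)
  from arg_cong[OF this, of "bideg_component a (Suc b)"]
  show "delbar C (\<omega> * emb \<Omega> x) = delbar C \<omega> * emb \<Omega> x + (- 1) ^ k *\<^sub>C (\<omega> * delbar C (emb \<Omega> x))"
    by (simp add: bideg_component_simps bideg_component_bideg[OF 1(1)] bideg_component_bideg[OF 1(2)]
        bideg_component_bideg[OF 2(1)] bideg_component_bideg[OF 2(2)]
        bideg_component_bideg[OF 3(1)] bideg_component_bideg[OF 3(2)])
qed (rule assms)

lemma act_bideg:
  assumes "clinear p" "\<omega> \<in> bideg C a b"
  shows "act (form_coact \<Omega>) p \<omega> \<in> bideg C a b"
  using bideg_coact[of a b] assms mem_subtensor_iff[OF bideg_subspace]
  unfolding act_def by blast

lemma act_diff: "clinear p \<Longrightarrow> act (form_coact \<Omega>) p (diff \<Omega> \<omega>) = diff \<Omega> (act (form_coact \<Omega>) p \<omega>)"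
  by (simp add: act_def form_coact_diff slice_tensor_map diff_linear clin)

text \<open>Equivariance, too, is assumed for d only; it is separated by bidegree, which the action
  of functionals preserves.\<close>

lemma act_delbar:
  assumes p: "clinear p"
  shows "act (form_coact \<Omega>) p (delbar C \<omega>) = delbar C (act (form_coact \<Omega>) p \<omega>)"
proof (rule clinear_eq_bideg[of "\<lambda>\<omega>. act (form_coact \<Omega>) p (delbar C \<omega>)"])
  have act: "clinear (act (form_coact \<Omega>) p)"
    by (rule clinear_act[OF form_coact_linear p clinear_ident])
  show "clinear (\<lambda>\<omega>. act (form_coact \<Omega>) p (delbar C \<omega>))" "clinear (\<lambda>\<omega>. delbar C (act (form_coact \<Omega>) p \<omega>))"
    by (rule clinear_comp[OF act delbar_linear], rule clinear_comp[OF delbar_linear act])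
  fix a b \<omega> assume \<omega>: "\<omega> \<in> bideg C a b"
  have 1: "act (form_coact \<Omega>) p (del C \<omega>) \<in> bideg C (Suc a) b" "act (form_coact \<Omega>) p (delbar C \<omega>) \<in> bideg C a (Suc b)"
    "del C (act (form_coact \<Omega>) p \<omega>) \<in> bideg C (Suc a) b" "delbar C (act (form_coact \<Omega>) p \<omega>) \<in> bideg C a (Suc b)"
    using \<omega> by (simp_all add: act_bideg p del_bideg delbar_bideg)
  have "act (form_coact \<Omega>) p (del C \<omega>) + act (form_coact \<Omega>) p (delbar C \<omega>)
    = del C (act (form_coact \<Omega>) p \<omega>) + delbar C (act (form_coact \<Omega>) p \<omega>)"
    using act_diff[OF p, of \<omega>] by (simp add: diff_del_delbar clinear_add[OF act])
  from arg_cong[OF this, of "bideg_component a (Suc b)"]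
  show "act (form_coact \<Omega>) p (delbar C \<omega>) = delbar C (act (form_coact \<Omega>) p \<omega>)"
    by (simp add: bideg_component_simps bideg_component_bideg[OF 1(1)] bideg_component_bideg[OF 1(2)]
        bideg_component_bideg[OF 1(3)] bideg_component_bideg[OF 1(4)])
qed

end

section \<open>The Lefschetz decomposition and the Hodge map\<close>

context kaehler_structure
begin

lemma lefschetz_power: "((*) \<kappa> ^^ j) \<omega> = \<kappa> ^ j * \<omega>"
  by (induction j) (simp_all add: mult.assoc)

lemma kappa_power_bideg: "\<kappa> ^ j \<in> bideg C j j"
proof (induction j)
  case 0
  show ?case using emb_bideg[of 1] by (simp add: emb_one)
next
  case (Suc j)
  then show ?case using bideg_mult[OF kappa_bideg Suc] by simp
qed

lemma kappa_power_mult_bideg: "\<omega> \<in> bideg C a b \<Longrightarrow> \<kappa> ^ j * \<omega> \<in> bideg C (a + j) (b + j)"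
  using bideg_mult[OF kappa_power_bideg, of \<omega> a b j] by (simp add: add.commute)

lemma kappa_power_mult_deg: "\<omega> \<in> deg \<Omega> k \<Longrightarrow> \<kappa> ^ j * \<omega> \<in> deg \<Omega> (k + 2 * j)"
  using deg_mult[of "\<kappa> ^ j" "2 * j" \<omega> k] kappa_power_bideg[of j] bideg_deg[of j j] by (auto simp: add.commute mult_2)

lemma commute_kappa_power:
  assumes "\<And>\<omega>. f (\<kappa> * \<omega>) = \<kappa> * f \<omega>"
  shows "f (\<kappa> ^ j * \<omega>) = \<kappa> ^ j * f \<omega>"
  by (induction j) (simp_all add: assms mult.assoc)

lemma lefschetz_injective: "k \<le> n \<Longrightarrow> x \<in> deg \<Omega> k \<Longrightarrow> \<kappa> ^ (n - k) * x = 0 \<Longrightarrow> x = 0"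
proof (cases "k = n")
  case False
  assume k: "k \<le> n" and x: "x \<in> deg \<Omega> k" and 0: "\<kappa> ^ (n - k) * x = 0"
  have "bij_betw (\<lambda>x. \<kappa> ^ (n - k) * x) (deg \<Omega> k) (deg \<Omega> (2 * n - k))"
    using lefschetz_iso[of k] k False by (simp add: lefschetz_power[abs_def])
  then have "inj_on (\<lambda>x. \<kappa> ^ (n - k) * x) (deg \<Omega> k)" by (simp add: bij_betw_def)
  then show "x = 0"
    using x 0 cvec.subspace_0[OF deg_subspace, of k] by (auto dest: inj_onD[of _ _ x 0])
qed simp

lemma lefschetz_surjective:
  assumes "k \<le> n" "y \<in> deg \<Omega> (2 * n - k)"
  obtains x where "x \<in> deg \<Omega> k" "y = \<kappa> ^ (n - k) * x"
proof (cases "k = n")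
  case True
  then show thesis using assms that[of y] by (simp add: mult_2)
next
  case False
  have "bij_betw (\<lambda>x. \<kappa> ^ (n - k) * x) (deg \<Omega> k) (deg \<Omega> (2 * n - k))"
    using lefschetz_iso[of k] assms(1) False by (simp add: lefschetz_power[abs_def])
  then show thesis using assms(2) that by (auto simp: bij_betw_def)
qed

definition primitive_part :: "nat \<Rightarrow> nat \<Rightarrow> 'w set" where
  "primitive_part a b = primitive \<Omega> n \<kappa> (a + b) \<inter> bideg C a b"

lemma primitive_part_iff:
  "a + b \<le> n \<Longrightarrow> \<alpha> \<in> primitive_part a b \<longleftrightarrow> \<alpha> \<in> bideg C a b \<and> \<kappa> ^ (n - (a + b) + 1) * \<alpha> = 0"
  using bideg_deg[of a b] by (auto simp: primitive_part_def primitive_def lefschetz_power simp del: funpow.simps)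

lemma primitive_part_subspace: "a + b \<le> n \<Longrightarrow> cvec.subspace (primitive_part a b)"
  using bideg_subspace[of a b]
  by (auto simp: cvec.subspace_def primitive_part_iff distrib_left mult_scaleC_right)

lemma primitive_part_killed:
  assumes "a + b \<le> n" "\<alpha> \<in> primitive_part a b" "n - (a + b) + 1 \<le> m"
  shows "\<kappa> ^ m * \<alpha> = 0"
proof -
  have "\<kappa> ^ m * \<alpha> = \<kappa> ^ (m - (n - (a + b) + 1)) * (\<kappa> ^ (n - (a + b) + 1) * \<alpha>)"
    using assms(3) by (simp only: mult.assoc[symmetric] power_add[symmetric]) simp
  then show ?thesis using assms(1,2) by (simp add: primitive_part_iff)
qed

lemma bideg_component_kappa_power:
  "bideg_component (a + j) (b + j) (\<kappa> ^ j * \<omega>) = \<kappa> ^ j * bideg_component a b \<omega>"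
proof (rule clinear_eq_bideg[of "\<lambda>\<omega>. bideg_component (a + j) (b + j) (\<kappa> ^ j * \<omega>)"])
  show "clinear (\<lambda>\<omega>. bideg_component (a + j) (b + j) (\<kappa> ^ j * \<omega>))"
    "clinear (\<lambda>\<omega>. \<kappa> ^ j * bideg_component a b \<omega>)"
    by (intro clin clinear_comp[OF clinear_bideg_component])+
  fix c e \<omega> assume \<omega>: "\<omega> \<in> bideg C c e"
  show "bideg_component (a + j) (b + j) (\<kappa> ^ j * \<omega>) = \<kappa> ^ j * bideg_component a b \<omega>"
    using bideg_component_bideg[OF \<omega>, of a b] bideg_component_bideg[OF kappa_power_mult_bideg[OF \<omega>], of "a + j" "b + j" j]
    by simp
qed

text \<open>For \<omega> of degree k, the form L^(n-k+1) \<omega> has degree 2n - (k - 2), so it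
  equals L^(n-k+2) \<eta> for some \<eta> of degree k - 2. Then \<omega> - \<kappa> \<eta> is
  primitive, and induction handles \<eta>.\<close>

lemma lefschetz_decomposition:
  "k \<le> n \<Longrightarrow> deg \<Omega> k \<subseteq> cvec.span {\<kappa> ^ j * \<alpha> | a b j \<alpha>. \<alpha> \<in> primitive_part a b \<and> a + b + 2 * j = k}"
    (is "_ \<Longrightarrow> _ \<subseteq> cvec.span (?S k)")
proof (induction k rule: less_induct)
  case (less k)
  show ?case
  proof
    fix \<omega> assume \<omega>: "\<omega> \<in> deg \<Omega> k"
    have "\<exists>\<alpha> \<beta>. \<omega> = \<alpha> + \<beta> \<and> \<alpha> \<in> deg \<Omega> k \<and> \<kappa> ^ (n - k + 1) * \<alpha> = 0 \<and> \<beta> \<in> cvec.span (?S k)"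
    proof (cases "k < 2")
      case True
      \<comment> \<open>In degrees 0 and 1 this power passes the top degree, so every form is
        primitive.\<close>
      have "\<kappa> ^ (n - k + 1) * \<omega> \<in> deg \<Omega> (k + 2 * (n - k + 1))"
        by (rule kappa_power_mult_deg[OF \<omega>])
      then have "\<kappa> ^ (n - k + 1) * \<omega> = 0"
        using above_top_zero[of "k + 2 * (n - k + 1)"] True less.prems by auto
      then show ?thesis
        using \<omega> by (intro exI[of _ \<omega>] exI[of _ 0]) (simp add: cvec.span_zero)
    next
      case False
      define l where "l = k - 2"
      have l: "k = l + 2" "l \<le> n" "n - l = n - k + 1 + 1" using False less.prems by (auto simp: l_def)
      have "k + 2 * (n - k + 1) = 2 * n - l" using l less.prems by simp
      then have "\<kappa> ^ (n - k + 1) * \<omega> \<in> deg \<Omega> (2 * n - l)"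
        using kappa_power_mult_deg[OF \<omega>, of "n - k + 1"] by metis
      then obtain \<eta> where \<eta>: "\<eta> \<in> deg \<Omega> l" "\<kappa> ^ (n - k + 1) * \<omega> = \<kappa> ^ (n - l) * \<eta>"
        using lefschetz_surjective[OF l(2)] by blast
      have "\<kappa> ^ (n - k + 1) * (\<omega> - \<kappa> * \<eta>) = 0"
        using \<eta>(2) unfolding l(3) right_diff_distrib
        by (simp only: power_add power_one_right mult.assoc) simp
      moreover have "\<kappa> * \<eta> \<in> deg \<Omega> k"
        using kappa_power_mult_deg[OF \<eta>(1), of 1] l(1) by simp
      then have "\<omega> - \<kappa> * \<eta> \<in> deg \<Omega> k"
        using \<omega> deg_subspace by (simp add: cvec.subspace_diff)
      moreover have "\<kappa> * \<eta> \<in> cvec.span (?S k)"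
      proof -
        have "\<eta> \<in> cvec.span (?S l)" using less.IH[of l] l \<eta>(1) by auto
        then have "\<kappa> * \<eta> \<in> (*) \<kappa> ` cvec.span (?S l)" by blast
        also have "\<dots> = cvec.span ((*) \<kappa> ` ?S l)"
          by (rule cvp.linear_span_image[symmetric]) (intro clin)
        also have "\<dots> \<subseteq> cvec.span (?S k)"
        proof (rule cvec.span_mono, clarify)
          fix a b j \<alpha> assume prim: "\<alpha> \<in> primitive_part a b" and l': "l = a + b + 2 * j"
          show "\<exists>a' b' j' \<alpha>'. \<kappa> * (\<kappa> ^ j * \<alpha>) = \<kappa> ^ j' * \<alpha>' \<and> \<alpha>' \<in> primitive_part a' b' \<and> a' + b' + 2 * j' = k"
            by (rule exI[of _ a], rule exI[of _ b], rule exI[of _ "Suc j"], rule exI[of _ \<alpha>])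
              (simp add: prim l' l(1) mult.assoc)
        qed
        finally show ?thesis .
      qed
      ultimately show ?thesis
        by (intro exI[of _ "\<omega> - \<kappa> * \<eta>"] exI[of _ "\<kappa> * \<eta>"]) simp
    qed
    then obtain \<alpha> \<beta> where \<alpha>\<beta>: "\<omega> = \<alpha> + \<beta>" "\<alpha> \<in> deg \<Omega> k" "\<kappa> ^ (n - k + 1) * \<alpha> = 0" "\<beta> \<in> cvec.span (?S k)"
      by blast
    \<comment> \<open>Bidegree components of a primitive form are primitive because multiplication
      by \<kappa> shifts all bidegrees alike.\<close>
    have "bideg_component a b \<alpha> \<in> ?S k" if "a + b = k" for a b
    proof -
      have "\<kappa> ^ (n - k + 1) * bideg_component a b \<alpha> = 0"
        using bideg_component_kappa_power[of a "n - k + 1" b \<alpha>] \<alpha>\<beta>(3) by (simp add: bideg_component_simps)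
      then have "bideg_component a b \<alpha> \<in> primitive_part a b"
        using that less.prems bideg_component_in by (simp add: primitive_part_iff)
      moreover have "bideg_component a b \<alpha> = \<kappa> ^ 0 * bideg_component a b \<alpha>" by simp
      moreover have "a + b + 2 * 0 = k" using that by simp
      ultimately show ?thesis by blast
    qed
    then have "\<alpha> \<in> cvec.span (?S k)"
      by (subst deg_sum_bideg_components[OF \<alpha>\<beta>(2)], intro cvec.span_sum) (auto intro: cvec.span_base)
    then show "\<omega> \<in> cvec.span (?S k)"
      unfolding \<alpha>\<beta>(1) using \<alpha>\<beta>(4) by (rule cvec.span_add)
  qed
qed

text \<open>Degrees above the middle are images of degrees below it under the Lefschetz
  isomorphisms. Powers of \<kappa> beyond the bound on j annihilate primitive forms.\<close>

lemma lefschetz_span: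
  "cvec.span {\<kappa> ^ j * \<alpha> | a b j \<alpha>. \<alpha> \<in> primitive_part a b \<and> a + b + j \<le> n} = UNIV" (is "cvec.span ?S = _")
proof -
  have "deg \<Omega> k \<subseteq> cvec.span ?S" for k
  proof (cases "k \<le> n")
    case True
    have "deg \<Omega> k \<subseteq> cvec.span {\<kappa> ^ j * \<alpha> | a b j \<alpha>. \<alpha> \<in> primitive_part a b \<and> a + b + 2 * j = k}"
      by (rule lefschetz_decomposition[OF True])
    also have "\<dots> \<subseteq> cvec.span ?S"
      by (rule cvec.span_mono) (use True in fastforce)
    finally show ?thesis .
  next
    case False
    show ?thesis
    proof (cases "k \<le> 2 * n")
      case True
      define l where "l = 2 * n - k"
      have l: "l \<le> n" "k = 2 * n - l" using True False by (auto simp: l_def)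
      show ?thesis
      proof
        fix \<omega> assume "\<omega> \<in> deg \<Omega> k"
        then obtain x where x: "x \<in> deg \<Omega> l" "\<omega> = \<kappa> ^ (n - l) * x"
          using lefschetz_surjective[OF l(1)] l(2) by blast
        have "\<omega> \<in> (*) (\<kappa> ^ (n - l)) ` cvec.span {\<kappa> ^ j * \<alpha> | a b j \<alpha>. \<alpha> \<in> primitive_part a b \<and> a + b + 2 * j = l}"
          using x lefschetz_decomposition[OF l(1)] by blast
        also have "\<dots> = cvec.span ((*) (\<kappa> ^ (n - l)) ` {\<kappa> ^ j * \<alpha> | a b j \<alpha>. \<alpha> \<in> primitive_part a b \<and> a + b + 2 * j = l})"
          by (rule cvp.linear_span_image[symmetric]) (intro clin)
        also have "\<dots> \<subseteq> cvec.span ?S"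
        proof (rule cvec.span_mono, clarify)
          fix a b j \<alpha> assume prim: "\<alpha> \<in> primitive_part a b" and l': "l = a + b + 2 * j"
          have "\<kappa> ^ (n - (a + b + 2 * j)) * (\<kappa> ^ j * \<alpha>) = \<kappa> ^ (n - l + j) * \<alpha>"
            by (simp only: power_add mult.assoc l')
          with prim l' l(1) show "\<exists>a' b' j' \<alpha>'. \<kappa> ^ (n - (a + b + 2 * j)) * (\<kappa> ^ j * \<alpha>) = \<kappa> ^ j' * \<alpha>' \<and> \<alpha>' \<in> primitive_part a' b' \<and> a' + b' + j' \<le> n"
            by - (rule exI[of _ a], rule exI[of _ b], rule exI[of _ "n - l + j"], rule exI[of _ \<alpha>], simp)
        qed
        finally show "\<omega> \<in> cvec.span ?S" .
      qed
    next
      case False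
      then show ?thesis using above_top_zero[of k] by (simp add: cvec.span_zero)
    qed
  qed
  then have "cvec.span (\<Union>k. deg \<Omega> k) \<subseteq> cvec.span ?S"
    by (intro cvec.span_minimal cvec.subspace_span) blast
  then show ?thesis by (auto simp: span_deg)
qed

lemma clinear_eq_lefschetz:
  assumes "clinear f" "clinear g"
    "\<And>a b j \<alpha>. \<alpha> \<in> primitive_part a b \<Longrightarrow> a + b + j \<le> n \<Longrightarrow> f (\<kappa> ^ j * \<alpha>) = g (\<kappa> ^ j * \<alpha>)"
  shows "f \<omega> = g \<omega>"
proof (rule cvp.linear_eq_on_span[OF assms(1,2)])
  show "\<omega> \<in> cvec.span {\<kappa> ^ j * \<alpha> | a b j \<alpha>. \<alpha> \<in> primitive_part a b \<and> a + b + j \<le> n}"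
    by (simp add: lefschetz_span)
qed (use assms(3) in blast)

section \<open>Uniqueness of the Lefschetz decomposition\<close>

definition lefschetz_index :: "(nat \<times> nat \<times> nat) set" where
  "lefschetz_index = {(a, b, j). a + b + j \<le> n}"

lemma finite_lefschetz_index: "finite lefschetz_index"
  by (rule finite_subset[of _ "{..n} \<times> {..n} \<times> {..n}"]) (auto simp: lefschetz_index_def)

text \<open>Primitive components are extended by zero off the finite index set, so that they form a
  subspace of a function space; uniqueness of the decomposition becomes injectivity of the linear
  map \<open>lefschetz_sum\<close> on it.\<close>

definition lefschetz_family :: "(nat \<times> nat \<times> nat \<Rightarrow> 'w) \<Rightarrow> bool" where
  "lefschetz_family \<alpha> \<longleftrightarrow> (\<forall>a b j. (a, b, j) \<in> lefschetz_index \<longrightarrow> \<alpha> (a, b, j) \<in> primitive_part a b)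
     \<and> (\<forall>i. i \<notin> lefschetz_index \<longrightarrow> \<alpha> i = 0)"

definition lefschetz_sum :: "(nat \<times> nat \<times> nat \<Rightarrow> 'w) \<Rightarrow> 'w" where
  "lefschetz_sum \<alpha> = (\<Sum>(a, b, j)\<in>lefschetz_index. \<kappa> ^ j * \<alpha> (a, b, j))"

lemma lefschetz_sum_linear: "clinear lefschetz_sum"
  by (rule clinearI)
    (simp_all add: lefschetz_sum_def case_prod_unfold sum.distrib distrib_left mult_scaleC_right cvec.scale_sum_right)

lemma lefschetz_family_subspace: "cvec.subspace {\<alpha>. lefschetz_family \<alpha>}"
proof -
  have "a + b \<le> n" if "(a, b, j) \<in> lefschetz_index" for a b j using that by (simp add: lefschetz_index_def)
  note s = primitive_part_subspace[OF this]
  show ?thesis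
    unfolding cvec.subspace_def lefschetz_family_def
    by (auto simp: cvec.subspace_0[OF s] cvec.subspace_add[OF s] cvec.subspace_scale[OF s])
qed

lemma lefschetz_family_single:
  assumes "\<alpha> \<in> primitive_part a b" "a + b + j \<le> n"
  shows "lefschetz_family (\<lambda>i. if i = (a, b, j) then \<alpha> else 0)"
    "lefschetz_sum (\<lambda>i. if i = (a, b, j) then \<alpha> else 0) = \<kappa> ^ j * \<alpha>"
proof -
  have i: "(a, b, j) \<in> lefschetz_index" using assms(2) by (simp add: lefschetz_index_def)
  have "0 \<in> primitive_part a' b'" if "(a', b', j') \<in> lefschetz_index" for a' b' j'
    using cvec.subspace_0[OF primitive_part_subspace, of a' b'] that by (simp add: lefschetz_index_def)
  then show "lefschetz_family (\<lambda>i. if i = (a, b, j) then \<alpha> else 0)"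
    using assms(1) i by (auto simp: lefschetz_family_def)
  have "lefschetz_sum (\<lambda>i. if i = (a, b, j) then \<alpha> else 0)
    = (\<Sum>i\<in>lefschetz_index. if i = (a, b, j) then \<kappa> ^ j * \<alpha> else 0)"
    unfolding lefschetz_sum_def by (rule sum.cong) (auto split: if_splits)
  then show "lefschetz_sum (\<lambda>i. if i = (a, b, j) then \<alpha> else 0) = \<kappa> ^ j * \<alpha>"
    using i finite_lefschetz_index by simp
qed

text \<open>Among the non-zero terms of one bidegree, the one with the largest power of \<open>\<kappa>\<close> survives
  multiplication by a suitable further power of \<open>\<kappa>\<close>, while all others are killed.\<close>

lemma lefschetz_family_zero:
  assumes fam: "lefschetz_family \<alpha>" and 0: "lefschetz_sum \<alpha> = 0"
  shows "\<alpha> = 0"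
proof (rule ccontr)
  assume "\<alpha> \<noteq> 0"
  then obtain i where i: "\<alpha> i \<noteq> 0" by (auto simp: fun_eq_iff)
  have bounded: "a + b + j \<le> n" if nz: "\<alpha> (a, b, j) \<noteq> 0" for a b j
  proof (rule ccontr)
    assume "\<not> a + b + j \<le> n"
    then show False using fam nz by (simp add: lefschetz_family_def lefschetz_index_def)
  qed
  have "\<exists>J. (\<exists>a b. \<alpha> (a, b, J) \<noteq> 0) \<and> (\<forall>j. (\<exists>a b. \<alpha> (a, b, j) \<noteq> 0) \<longrightarrow> j \<le> J)"
  proof (rule ex_has_greatest_nat[of _ "snd (snd i)" "\<lambda>j. j" "Suc n"])
    have "\<alpha> (fst i, fst (snd i), snd (snd i)) \<noteq> 0" using i by simp
    then show "\<exists>a b. \<alpha> (a, b, snd (snd i)) \<noteq> 0" by blast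
    show "\<forall>j. (\<exists>a b. \<alpha> (a, b, j) \<noteq> 0) \<longrightarrow> j < Suc n"
    proof clarify
      fix j a b assume "\<alpha> (a, b, j) \<noteq> 0"
      then show "j < Suc n" using bounded[of a b j] by simp
    qed
  qed
  then obtain a b j where nz: "\<alpha> (a, b, j) \<noteq> 0" and max: "\<And>a b j'. \<alpha> (a, b, j') \<noteq> 0 \<Longrightarrow> j' \<le> j"
    by blast
  have abj: "a + b + j \<le> n" by (rule bounded[OF nz])
  then have ind: "(a, b, j) \<in> lefschetz_index" by (simp add: lefschetz_index_def)
  \<comment> \<open>Chosen so that e + j = n - (a + b), the power that the Lefschetz isomorphism
    makes injective on degree a + b.\<close>
  define e where "e = n - (a + b + j)"
  have summand: "\<kappa> ^ e * bideg_component (a + j) (b + j) (\<kappa> ^ j' * \<alpha> (a', b', j'))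
      = (if (a', b', j') = (a, b, j) then \<kappa> ^ (e + j) * \<alpha> (a, b, j) else 0)"
    if i': "(a', b', j') \<in> lefschetz_index" for a' b' j'
  proof -
    have prim: "\<alpha> (a', b', j') \<in> primitive_part a' b'" and le: "a' + b' + j' \<le> n"
      using fam i' by (auto simp: lefschetz_family_def lefschetz_index_def)
    then have bd: "\<alpha> (a', b', j') \<in> bideg C a' b'" by (simp add: primitive_part_iff)
    note comp = bideg_component_bideg[OF kappa_power_mult_bideg[OF bd], of "a + j" "b + j" j']
    show ?thesis
    proof (cases "a + j = a' + j' \<and> b + j = b' + j'")
      case False
      then show ?thesis using comp by auto
    next
      case eq: True
      have *: "\<kappa> ^ e * bideg_component (a + j) (b + j) (\<kappa> ^ j' * \<alpha> (a', b', j')) = \<kappa> ^ (e + j') * \<alpha> (a', b', j')"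
        using comp eq by (simp add: power_add mult.assoc)
      show ?thesis
      proof (cases "j' < j")
        case True
        \<comment> \<open>Equal bidegrees give a' + b' = a + b + 2 (j - j'), so e + j' exceeds n -
          (a' + b') by j - j'.\<close>
        have "n - (a' + b') + 1 \<le> e + j'" 
          using True conjunct1[OF eq] conjunct2[OF eq] abj le unfolding e_def by arith
        with le prim have "\<kappa> ^ (e + j') * \<alpha> (a', b', j') = 0"
          by (intro primitive_part_killed) auto
        then show ?thesis using * True by simp
      next
        case False
        show ?thesis
        proof (cases "j' = j")
          case True
          then show ?thesis using * eq by simp
        next
          case neq: False
          then have "\<alpha> (a', b', j') = 0" using False max[of a' b' j'] by linarith
          then show ?thesis using neq by (simp add: bideg_component_simps)
        qed
      qed
    qed
  qed
  have "0 = \<kappa> ^ e * bideg_component (a + j) (b + j) (lefschetz_sum \<alpha>)"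
    by (simp add: 0 bideg_component_simps)
  also have "\<dots> = (\<Sum>(a', b', j')\<in>lefschetz_index. \<kappa> ^ e * bideg_component (a + j) (b + j) (\<kappa> ^ j' * \<alpha> (a', b', j')))"
    by (simp add: lefschetz_sum_def bideg_component_simps sum_distrib_left case_prod_unfold)
  also have "\<dots> = (\<Sum>i\<in>lefschetz_index. if i = (a, b, j) then \<kappa> ^ (e + j) * \<alpha> (a, b, j) else 0)"
    by (rule sum.cong[OF refl], clarify, simp only: prod.case summand)
  also have "\<dots> = \<kappa> ^ (n - (a + b)) * \<alpha> (a, b, j)"
    using ind finite_lefschetz_index abj by (simp add: e_def)
  finally have "\<kappa> ^ (n - (a + b)) * \<alpha> (a, b, j) = 0" ..
  moreover have "\<alpha> (a, b, j) \<in> deg \<Omega> (a + b)"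
  proof -
    have "\<alpha> (a, b, j) \<in> primitive_part a b" using fam ind by (simp add: lefschetz_family_def)
    then show ?thesis using bideg_deg[of a b] by (auto simp: primitive_part_def)
  qed
  ultimately show False
    using lefschetz_injective[of "a + b" "\<alpha> (a, b, j)"] abj nz by simp
qed

section \<open>The Hodge map and the volume\<close>

abbreviation hodge_map :: "'w \<Rightarrow> 'w" where
  "hodge_map \<equiv> hodge \<Omega> C n \<kappa>"

abbreviation hodge_coefficient :: "nat \<Rightarrow> nat \<Rightarrow> nat \<Rightarrow> complex" where
  "hodge_coefficient a b j \<equiv> (-1) ^ ((a + b) * (a + b + 1) div 2) * \<i> powi (int a - int b)
     * (fact j / fact (n - j - (a + b)))"

text \<open>A linear left inverse of \<open>lefschetz_sum\<close> on the families extracts the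
  primitive components, so the prescribed values extend to a linear map; they determine it because
  the elements \<open>\<kappa> ^ j * \<alpha>\<close> span.\<close>

lemma hodge_exists_unique:
  "\<exists>!T. clinear T \<and> (\<forall>a b j. \<forall>\<alpha> \<in> primitive_part a b. a + b + j \<le> n \<longrightarrow>
     T (\<kappa> ^ j * \<alpha>) = hodge_coefficient a b j *\<^sub>C (\<kappa> ^ (n - j - (a + b)) * \<alpha>))"
proof -
  have "inj_on lefschetz_sum {\<alpha>. lefschetz_family \<alpha>}"
  proof (rule inj_onI)
    fix \<alpha> \<beta> assume "\<alpha> \<in> {\<alpha>. lefschetz_family \<alpha>}" "\<beta> \<in> {\<alpha>. lefschetz_family \<alpha>}" "lefschetz_sum \<alpha> = lefschetz_sum \<beta>"
    then have "lefschetz_family (\<alpha> - \<beta>)" "lefschetz_sum (\<alpha> - \<beta>) = 0"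
      using cvec.subspace_diff[OF lefschetz_family_subspace, of \<alpha> \<beta>] by (simp_all add: clinear_diff[OF lefschetz_sum_linear])
    then have "\<alpha> - \<beta> = 0" by (rule lefschetz_family_zero)
    then show "\<alpha> = \<beta>" by simp
  qed
  from cvp.linear_exists_left_inverse_on[OF lefschetz_sum_linear lefschetz_family_subspace this]
  obtain g where g: "clinear g" "\<And>\<alpha>. lefschetz_family \<alpha> \<Longrightarrow> g (lefschetz_sum \<alpha>) = \<alpha>" by auto
  define T where "T \<omega> = (\<Sum>i\<in>lefschetz_index. hodge_coefficient (fst i) (fst (snd i)) (snd (snd i)) *\<^sub>C
    (\<kappa> ^ (n - snd (snd i) - (fst i + fst (snd i))) * g \<omega> i))" for \<omega>
  have "clinear (\<lambda>\<omega>. g \<omega> i)" for i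
    using g(1) by (simp add: clinear_iff)
  then have T: "clinear T" unfolding T_def[abs_def] by (intro clin)
  have Tval: "T (\<kappa> ^ j * \<alpha>) = hodge_coefficient a b j *\<^sub>C (\<kappa> ^ (n - j - (a + b)) * \<alpha>)"
    if "\<alpha> \<in> primitive_part a b" "a + b + j \<le> n" for a b j \<alpha>
  proof -
    have "g (\<kappa> ^ j * \<alpha>) = (\<lambda>i. if i = (a, b, j) then \<alpha> else 0)"
      using g(2)[OF lefschetz_family_single(1)[OF that]] lefschetz_family_single(2)[OF that] by simp
    then have "T (\<kappa> ^ j * \<alpha>) = (\<Sum>i\<in>lefschetz_index. if i = (a, b, j) then
        hodge_coefficient a b j *\<^sub>C (\<kappa> ^ (n - j - (a + b)) * \<alpha>) else 0)"
      unfolding T_def by (intro sum.cong) auto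
    moreover have "(a, b, j) \<in> lefschetz_index" using that(2) by (simp add: lefschetz_index_def)
    ultimately show ?thesis using finite_lefschetz_index by simp
  qed
  show ?thesis
  proof (rule ex1I[of _ T])
    show "clinear T \<and> (\<forall>a b j. \<forall>\<alpha> \<in> primitive_part a b. a + b + j \<le> n \<longrightarrow>
      T (\<kappa> ^ j * \<alpha>) = hodge_coefficient a b j *\<^sub>C (\<kappa> ^ (n - j - (a + b)) * \<alpha>))"
      by (intro conjI T allI ballI impI Tval)
  next
    fix S assume S: "clinear S \<and> (\<forall>a b j. \<forall>\<alpha> \<in> primitive_part a b. a + b + j \<le> n \<longrightarrow>
      S (\<kappa> ^ j * \<alpha>) = hodge_coefficient a b j *\<^sub>C (\<kappa> ^ (n - j - (a + b)) * \<alpha>))"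
    show "S = T"
    proof
      fix \<omega>
      show "S \<omega> = T \<omega>"
      proof (rule clinear_eq_lefschetz[OF conjunct1[OF S] T])
        fix a b j \<alpha> assume \<alpha>: "\<alpha> \<in> primitive_part a b" and le: "a + b + j \<le> n"
        have "S (\<kappa> ^ j * \<alpha>) = hodge_coefficient a b j *\<^sub>C (\<kappa> ^ (n - j - (a + b)) * \<alpha>)"
          using conjunct2[OF S, rule_format, OF \<alpha> le] .
        then show "S (\<kappa> ^ j * \<alpha>) = T (\<kappa> ^ j * \<alpha>)" by (simp only: Tval[OF \<alpha> le])
      qed
    qed
  qed
qed

lemma hodge_spec:
  "clinear hodge_map \<and> (\<forall>a b j. \<forall>\<alpha> \<in> primitive_part a b. a + b + j \<le> n \<longrightarrow>
     hodge_map (\<kappa> ^ j * \<alpha>) = hodge_coefficient a b j *\<^sub>C (\<kappa> ^ (n - j - (a + b)) * \<alpha>))"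
  unfolding hodge_def primitive_part_def[symmetric] lefschetz_power
  by (rule theI'[OF hodge_exists_unique])

lemma hodge_linear: "clinear hodge_map"
  using hodge_spec by (rule conjunct1)

lemma hodge_value:
  "\<alpha> \<in> primitive_part a b \<Longrightarrow> a + b + j \<le> n \<Longrightarrow>
    hodge_map (\<kappa> ^ j * \<alpha>) = hodge_coefficient a b j *\<^sub>C (\<kappa> ^ (n - j - (a + b)) * \<alpha>)"
  by (rule conjunct2[OF hodge_spec, rule_format])

text \<open>The coefficients of the Hodge map depend only on the bidegree and the power of \<kappa>,
  and such an f maps primitive forms to primitive forms. M-linearity on both sides and equivariance
  of the Hodge map are all instances.\<close>

lemma hodge_commute:
  assumes f: "clinear f" and \<kappa>: "\<And>\<omega>. f (\<kappa> * \<omega>) = \<kappa> * f \<omega>"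
    and pres: "\<And>a b \<omega>. \<omega> \<in> bideg C a b \<Longrightarrow> f \<omega> \<in> bideg C a b"
  shows "hodge_map (f \<omega>) = f (hodge_map \<omega>)"
proof (rule clinear_eq_lefschetz[of "\<lambda>\<omega>. hodge_map (f \<omega>)"])
  show "clinear (\<lambda>\<omega>. hodge_map (f \<omega>))" "clinear (\<lambda>\<omega>. f (hodge_map \<omega>))"
    by (rule clinear_comp[OF hodge_linear f], rule clinear_comp[OF f hodge_linear])
  note \<kappa>j = commute_kappa_power[of f, OF \<kappa>]
  fix a b j \<alpha> assume \<alpha>: "\<alpha> \<in> primitive_part a b" and le: "a + b + j \<le> n"
  then have "f \<alpha> \<in> primitive_part a b"
    using pres by (simp add: primitive_part_iff \<kappa>j[symmetric] clinear_0[OF f] del: power_Suc power_Suc2)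
  then show "hodge_map (f (\<kappa> ^ j * \<alpha>)) = f (hodge_map (\<kappa> ^ j * \<alpha>))"
    using \<alpha> le by (simp add: \<kappa>j hodge_value clinear_scale[OF f])
qed

lemma hodge_lmult: "hodge_map (emb \<Omega> m * \<omega>) = emb \<Omega> m * hodge_map \<omega>"
proof (rule hodge_commute)
  show "emb \<Omega> m * (\<kappa> * \<omega>) = \<kappa> * (emb \<Omega> m * \<omega>)" for \<omega>
    by (simp only: mult.assoc[symmetric] kappa_central[of "emb \<Omega> m"])
qed (simp_all add: bideg_lact clinear_mult_right clinear_ident)

lemma hodge_rmult: "hodge_map (\<omega> * emb \<Omega> m) = hodge_map \<omega> * emb \<Omega> m"
  by (rule hodge_commute[of "\<lambda>\<omega>. \<omega> * emb \<Omega> m"])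
    (simp_all add: bideg_ract clinear_mult_left clinear_ident mult.assoc)

lemma act_kappa:
  assumes p: "clinear p"
  shows "act (form_coact \<Omega>) p (\<kappa> * \<omega>) = \<kappa> * act (form_coact \<Omega>) p \<omega>"
proof -
  have "slice p (tensor_map2 (*) (*) (1 \<otimes> \<kappa>) t) = \<kappa> * slice p t" for t :: "'g \<otimes>\<^sub>C 'w"
  proof (rule clinear_eq_tensor[of "\<lambda>t. slice p (tensor_map2 (*) (*) (1 \<otimes> \<kappa>) t)"])
    show "clinear (\<lambda>t::'g \<otimes>\<^sub>C 'w. slice p (tensor_map2 (*) (*) (1 \<otimes> \<kappa>) t))" "clinear (\<lambda>t. \<kappa> * slice p t)"
      by (intro clin p clinear_tensor_map2_right)+
  qed (simp add: tensor_map2_tens[OF cbilinear_times cbilinear_times] slice_tens p mult_scaleC_right)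
  then show ?thesis by (simp add: act_def form_coact_mult kappa_coinvariant)
qed

lemma act_hodge:
  assumes p: "clinear p"
  shows "hodge_map (act (form_coact \<Omega>) p \<omega>) = act (form_coact \<Omega>) p (hodge_map \<omega>)"
  by (rule hodge_commute) (simp_all add: act_kappa act_bideg p clinear_act[OF form_coact_linear p clinear_ident])

abbreviation vol_map :: "'w \<Rightarrow> 'm" where
  "vol_map \<equiv> vol \<Omega> C n \<kappa>"

text \<open>A top form is \<kappa>^n x with x of degree 0, and the Hodge map returns a multiple of
  x; so the inverse of \<open>emb \<Omega>\<close> in the definition of \<open>vol\<close> is
  applied inside its range.\<close>

lemma emb_vol: "emb \<Omega> (vol_map \<omega>) = hodge_map (degree_component (2 * n) \<omega>)"
proof -
  have "hodge_map y \<in> range (emb \<Omega>)" if y: "y \<in> deg \<Omega> (2 * n)" for y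
  proof -
    obtain x where x: "x \<in> deg \<Omega> 0" "y = \<kappa> ^ n * x"
      using lefschetz_surjective[of 0 y] y by auto
    have "\<kappa> ^ (n + 1) * x \<in> deg \<Omega> (0 + 2 * (n + 1))" by (rule kappa_power_mult_deg[OF x(1)])
    then have "\<kappa> ^ (n + 1) * x = 0" using above_top_zero[of "2 * (n + 1)"] by auto
    then have "x \<in> primitive_part 0 0"
      using x(1) deg_0_eq by (simp add: primitive_part_iff)
    then have "hodge_map y = fact n *\<^sub>C x"
      using hodge_value[of x 0 0 n] by (simp add: x(2))
    then show ?thesis
      using x(1) emb_range deg_subspace[of 0] by (simp add: cvec.subspace_scale)
  qed
  then have "hodge_map (degree_component (2 * n) \<omega>) \<in> range (emb \<Omega>)"
    using degree_component_in by blast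
  then show ?thesis unfolding vol_def by (rule f_inv_into_f)
qed

lemma vol_linear: "clinear vol_map"
  by (rule clinearI; subst emb_eq_iff[symmetric])
    (simp_all add: emb_vol clinear_add[OF emb_linear] clinear_scale[OF emb_linear] clinear_add[OF hodge_linear]
      clinear_scale[OF hodge_linear] clinear_add[OF clinear_degree_component] clinear_scale[OF clinear_degree_component])

lemmas kaehler_clin [clin] = clinear_comp[OF hodge_linear] clinear_comp[OF vol_linear]

lemma vol_lmult: "vol_map (emb \<Omega> m * \<omega>) = m * vol_map \<omega>"
proof -
  have "degree_component (2 * n) (emb \<Omega> m * \<omega>) = emb \<Omega> m * degree_component (2 * n) \<omega>"
    by (rule bideg_preserving_component) (simp_all add: bideg_lact clinear_mult_right clinear_ident)
  then show ?thesis
    by (subst emb_eq_iff[symmetric]) (simp add: emb_vol emb_mult hodge_lmult)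
qed

lemma vol_rmult: "vol_map (\<omega> * emb \<Omega> m) = vol_map \<omega> * m"
proof -
  have "degree_component (2 * n) (\<omega> * emb \<Omega> m) = degree_component (2 * n) \<omega> * emb \<Omega> m"
    by (rule bideg_preserving_component[of "\<lambda>\<omega>. \<omega> * emb \<Omega> m"])
      (simp_all add: bideg_ract clinear_mult_left clinear_ident)
  then show ?thesis
    by (subst emb_eq_iff[symmetric]) (simp add: emb_vol emb_mult hodge_rmult)
qed

end

section \<open>Equivariance of the Hermitian pairing\<close>

lemma tensor_coordinates:
  obtains S where "finite S" "S \<subseteq> hamel_basis" "\<And>b. b \<in> hamel_basis - S \<Longrightarrow> slice (coordinate b) t = 0"
proof -
  obtain S where S: "finite S" "S \<subseteq> hamel_basis" "t = (\<Sum>b\<in>S. b \<otimes> slice (coordinate b) t)"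
    by (rule tensor_expansion)
  have "slice (coordinate b) t = 0" if b: "b \<in> hamel_basis - S" for b
  proof -
    have "slice (coordinate b) t = (\<Sum>c\<in>S. coordinate b c *\<^sub>C slice (coordinate c) t)"
      by (subst S(3)) (rule slice_sum[OF clinear_coordinate])
    also have "\<dots> = 0"
      by (rule sum.neutral) (use S(2) b in \<open>auto simp: coordinate_basis subset_iff\<close>)
    finally show ?thesis .
  qed
  with S(1,2) show thesis by (rule that)
qed

text \<open>The supporting set may be enlarged, so that tensors attached to different sections can
  be expanded over a common one.\<close>

lemma tensor_expansion_superset:
  assumes S: "finite S" "S \<subseteq> hamel_basis" "\<And>b. b \<in> hamel_basis - S \<Longrightarrow> slice (coordinate b) t = 0"
  shows "t = (\<Sum>b\<in>S. b \<otimes> slice (coordinate b) t)"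
proof -
  obtain Q where Q: "finite Q" "Q \<subseteq> hamel_basis" "t = (\<Sum>b\<in>Q. b \<otimes> slice (coordinate b) t)"
    by (rule tensor_expansion)
  have zero: "slice (coordinate b) t = 0" if "b \<in> S - Q" for b
  proof -
    have "slice (coordinate b) t = (\<Sum>c\<in>Q. coordinate b c *\<^sub>C slice (coordinate c) t)"
      by (subst Q(3)) (rule slice_sum[OF clinear_coordinate])
    also have "\<dots> = 0"
      by (rule sum.neutral) (use Q(2) S(2) that in \<open>auto simp: coordinate_basis subset_iff\<close>)
    finally show ?thesis .
  qed
  have "(\<Sum>b\<in>Q. b \<otimes> slice (coordinate b) t) = (\<Sum>b\<in>Q \<union> S. b \<otimes> slice (coordinate b) t)"
    by (rule sum.mono_neutral_left) (use Q(1) S(1) zero in auto)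
  also have "\<dots> = (\<Sum>b\<in>S. b \<otimes> slice (coordinate b) t)"
    by (rule sum.mono_neutral_right) (use Q(1,2) S in auto)
  finally show ?thesis using Q(3) by simp
qed

text \<open>Under \<open>lmult_fst\<close> the space \<open>G \<otimes> M\<close> is a left module
  over the algebra G, which is what the antipode cancellation lemmas ask for.\<close>

definition lmult_fst :: "'g::complex_algebra_1 \<Rightarrow> 'g \<otimes>\<^sub>C 'm::complex_vector \<Rightarrow> 'g \<otimes>\<^sub>C 'm" where
  "lmult_fst a = tensor_map (\<lambda>x. a * x) id"

definition lmult_snd :: "'m::complex_algebra_1 \<Rightarrow> 'g::complex_vector \<otimes>\<^sub>C 'm \<Rightarrow> 'g \<otimes>\<^sub>C 'm" where
  "lmult_snd m = tensor_map id (\<lambda>x. m * x)"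

lemma lmult_fst_tens: "lmult_fst a (b \<otimes> x) = (a * b) \<otimes> x"
  by (simp add: lmult_fst_def tensor_map_tens clin)

lemma lmult_snd_tens: "lmult_snd m (b \<otimes> x) = b \<otimes> (m * x)"
  by (simp add: lmult_snd_def tensor_map_tens clin)

lemma lmult_fst_linear: "clinear (lmult_fst a)" and lmult_snd_linear: "clinear (lmult_snd m)"
  unfolding lmult_fst_def lmult_snd_def by (intro clin)+

lemma cbilinear_lmult_fst: "cbilinear lmult_fst"
proof (rule cbilinearI[OF lmult_fst_linear])
  show "clinear (\<lambda>a. lmult_fst a t)" for t
    unfolding lmult_fst_def tensor_map_def by (intro clin)
qed

lemma cbilinear_lmult_snd: "cbilinear lmult_snd"
proof (rule cbilinearI[OF lmult_snd_linear])
  show "clinear (\<lambda>a. lmult_snd a t)" for t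
    unfolding lmult_snd_def tensor_map_def by (intro clin)
qed

lemmas lmult_clin [clin] = cbilinear_comp_left[OF cbilinear_lmult_fst] cbilinear_comp_right[OF cbilinear_lmult_fst]
  cbilinear_comp_left[OF cbilinear_lmult_snd] cbilinear_comp_right[OF cbilinear_lmult_snd]

lemma lmult_fst_mult: "lmult_fst (a * b) t = lmult_fst a (lmult_fst b t)"
  by (rule clinear_eq_tensor) ((intro clin)+, simp add: lmult_fst_tens mult.assoc)

lemma lmult_fst_one: "lmult_fst 1 t = t"
  by (rule clinear_eq_tensor) ((intro clin)+, simp add: lmult_fst_tens)

lemma lmult_fst_snd_commute: "lmult_fst a (lmult_snd m t) = lmult_snd m (lmult_fst a t)"
  by (rule clinear_eq_tensor[of "\<lambda>t. lmult_fst a (lmult_snd m t)"]) ((intro clin)+, simp add: lmult_fst_tens lmult_snd_tens)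

lemma tensor_map2_lmult:
  fixes s t :: "'g::complex_algebra_1 \<otimes>\<^sub>C 'm::complex_algebra_1"
  shows "tensor_map2 (*) (*) s t = tlift (\<lambda>a m. lmult_fst a (lmult_snd m t)) s"
proof (rule clinear_eq_tensor[of "\<lambda>s. tensor_map2 (*) (*) s t" "tlift (\<lambda>a m. lmult_fst a (lmult_snd m t))"])
  show "clinear (\<lambda>s. tensor_map2 (*) (*) s t)" by (intro clin clinear_tensor_map2_left)
  have b: "cbilinear (\<lambda>(a::'g) m. lmult_fst a (lmult_snd m t))" by (intro clin)
  then show "clinear (tlift (\<lambda>a m. lmult_fst a (lmult_snd m t)))" by (rule clinear_tlift)
  fix a :: 'g and m :: 'm
  have "tensor_map2 (*) (*) (a \<otimes> m) t = lmult_fst a (lmult_snd m t)"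
  proof (rule clinear_eq_tensor[of "tensor_map2 (*) (*) (a \<otimes> m)" "\<lambda>t. lmult_fst a (lmult_snd m t)"])
    show "clinear (tensor_map2 (*) (*) (a \<otimes> m))"
      by (rule cbilinear_right[OF cbilinear_tensor_map2[OF cbilinear_times cbilinear_times]])
    show "clinear (\<lambda>t. lmult_fst a (lmult_snd m t))" by (intro clin)
  qed (simp add: tensor_map2_tens[OF cbilinear_times cbilinear_times] lmult_fst_tens lmult_snd_tens)
  then show "tensor_map2 (*) (*) (a \<otimes> m) t = tlift (\<lambda>a m. lmult_fst a (lmult_snd m t)) (a \<otimes> m)"
    by (simp add: tlift_tens b)
qed

locale hermitian_bundle =
  quantum_homogeneous_space G H \<pi> \<iota> + F: covariant_bimodule G \<iota> F + herm: hermitian_structure G \<iota> F h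
  for G :: "'g::complex_algebra_1 hopf" and H :: "'h::complex_algebra_1 hopf" and \<pi> :: "'g \<Rightarrow> 'h"
    and \<iota> :: "'m::complex_algebra_1 \<Rightarrow> 'g" and F :: "('g, 'm, 'f::complex_vector) bimodule"
    and h :: "'f conj_space \<Rightarrow> ('f \<Rightarrow> 'm)" +
  assumes hermitian_positive: "hermitian_positive_definite G \<iota> h"
begin

lemma coact_linear: "clinear (coact F)"
  using F.coact_comodule by (simp add: comodule_def)

lemmas bundle_clin [clin] = clinear_comp[OF coact_linear] cbilinear_comp_left[OF F.lact_bilinear]
  cbilinear_comp_right[OF F.lact_bilinear]

lemma dual_module_linear: "\<phi> \<in> dual_module F \<Longrightarrow> clinear \<phi>"
  and dual_module_lact: "\<phi> \<in> dual_module F \<Longrightarrow> \<phi> (lact F m f) = m * \<phi> f"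
  by (simp_all add: dual_module_def)

text \<open>The value at f of the coaction that \<phi> should have. That these values come from a
  single tensor over the dual module is shown in \<open>dual_coact_exists_unique\<close>.\<close>

definition twisted_value :: "('f \<Rightarrow> 'm) \<Rightarrow> 'f \<Rightarrow> 'g \<otimes>\<^sub>C 'm" where
  "twisted_value \<phi> f = tlift (\<lambda>a x. lmult_fst (antipode G a) (base_coaction G \<iota> (\<phi> x))) (coact F f)"

lemma twisted_value_linear:
  assumes "clinear \<phi>"
  shows "clinear (twisted_value \<phi>)"
  unfolding twisted_value_def by (intro clin clinear_comp[OF assms])

lemma twisted_value_cancel:
  "clinear \<phi> \<Longrightarrow> tlift (\<lambda>a x. lmult_fst a (twisted_value \<phi> x)) (coact F f) = base_coaction G \<iota> (\<phi> f)"
  unfolding twisted_value_def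
  by (rule G.antipode_cancel_right[OF F.coact_comodule cbilinear_lmult_fst lmult_fst_mult lmult_fst_one])
    (rule clinear_comp[OF base_coaction_linear])

text \<open>The usual computation rests on S being antimultiplicative. That is bypassed: both sides
  agree once multiplied by the legs of m and f, giving the coaction of m \<phi>(f); the difference
  \<open>Z\<close> is then removed by cancelling the antipode twice, first for m and then for
  f.\<close>

lemma twisted_value_lact:
  assumes \<phi>: "\<phi> \<in> dual_module F"
  shows "twisted_value \<phi> (lact F m f) = lmult_snd m (twisted_value \<phi> f)"
proof -
  note \<phi>l = dual_module_linear[OF \<phi>]
  define \<Psi> where "\<Psi> = twisted_value \<phi>"
  note cancel = twisted_value_cancel[OF \<phi>l, folded \<Psi>_def]
  note [clin] = clinear_comp[OF twisted_value_linear[OF \<phi>l, folded \<Psi>_def]]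
  define Z where "Z m f = \<Psi> (lact F m f) - lmult_snd m (\<Psi> f)" for m f
  have Zl: "clinear (\<lambda>m. Z m f)" and Zr: "clinear (Z m)" for m f
    unfolding Z_def by (intro clin)+
  note [clin] = clinear_comp[OF Zl] clinear_comp[OF Zr]
  have 1: "tlift (\<lambda>a x. tlift (\<lambda>b y. lmult_fst (b * a) (\<Psi> (lact F y x))) (base_coaction G \<iota> m)) (coact F f)
      = tensor_map2 (*) (*) (base_coaction G \<iota> m) (base_coaction G \<iota> (\<phi> f))" for m f
  proof -
    have "cbilinear (\<lambda>a x. lmult_fst a (\<Psi> x))" by (intro clin)
    then have "tlift (\<lambda>a x. tlift (\<lambda>b y. lmult_fst (b * a) (\<Psi> (lact F y x))) (base_coaction G \<iota> m)) (coact F f)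
      = tlift (\<lambda>a x. lmult_fst a (\<Psi> x)) (coact F (lact F m f))"
      by (simp add: F.coact_lact tlift_tensor_map2[OF _ cbilinear_times F.lact_bilinear])
    then show ?thesis
      by (simp add: cancel dual_module_lact[OF \<phi>] base_coaction_mult)
  qed
  have 2: "tlift (\<lambda>a x. tlift (\<lambda>b y. lmult_fst (b * a) (lmult_snd y (\<Psi> x))) (base_coaction G \<iota> m)) (coact F f)
      = tensor_map2 (*) (*) (base_coaction G \<iota> m) (base_coaction G \<iota> (\<phi> f))" for m f
  proof -
    have "tlift (\<lambda>a x. tlift (\<lambda>b y. lmult_fst (b * a) (lmult_snd y (\<Psi> x))) (base_coaction G \<iota> m)) (coact F f)
      = tlift (\<lambda>b y. tlift (\<lambda>a x. lmult_fst (b * a) (lmult_snd y (\<Psi> x))) (coact F f)) (base_coaction G \<iota> m)"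
      by (rule tlift_tlift_swap) (intro clin)
    also have "\<dots> = tlift (\<lambda>b y. lmult_fst b (lmult_snd y (tlift (\<lambda>a x. lmult_fst a (\<Psi> x)) (coact F f)))) (base_coaction G \<iota> m)"
      by (simp add: clinear_tlift_push[OF lmult_fst_linear] clinear_tlift_push[OF lmult_snd_linear]
          lmult_fst_mult lmult_fst_snd_commute)
    finally show ?thesis by (simp add: cancel tensor_map2_lmult)
  qed
  have 3: "tlift (\<lambda>b y. lmult_fst b (tlift (\<lambda>a x. lmult_fst a (Z y x)) (coact F f))) (base_coaction G \<iota> m) = 0" for m f
  proof -
    have "tlift (\<lambda>b y. lmult_fst b (tlift (\<lambda>a x. lmult_fst a (Z y x)) (coact F f))) (base_coaction G \<iota> m)
      = tlift (\<lambda>b y. tlift (\<lambda>a x. lmult_fst (b * a) (Z y x)) (coact F f)) (base_coaction G \<iota> m)"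
      by (simp add: clinear_tlift_push[OF lmult_fst_linear] lmult_fst_mult)
    also have "\<dots> = tlift (\<lambda>a x. tlift (\<lambda>b y. lmult_fst (b * a) (Z y x)) (base_coaction G \<iota> m)) (coact F f)"
      by (rule tlift_tlift_swap) (intro clin)
    also have "\<dots> = 0"
    proof -
      have d: "tlift (\<lambda>b y. \<mu> b y - \<nu> b y) t = tlift \<mu> t - tlift \<nu> t" for \<mu> \<nu> and t :: "'x::complex_vector \<otimes>\<^sub>C 'y::complex_vector"
        by (simp add: tlift_def free_lift_def cvec.scale_right_diff_distrib sum_subtractf)
      show ?thesis
        unfolding Z_def clinear_diff[OF lmult_fst_linear] d 1 2 by simp
    qed
    finally show ?thesis .
  qed
  have 4: "tlift (\<lambda>a x. lmult_fst a (Z m x)) (coact F f) = 0" for m f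
    by (rule G.antipode_cancel_zero[OF base_comodule cbilinear_lmult_fst lmult_fst_mult lmult_fst_one _ 3])
      (intro clin)
  have "Z m f = 0"
    by (rule G.antipode_cancel_zero[OF F.coact_comodule cbilinear_lmult_fst lmult_fst_mult lmult_fst_one Zr 4])
  then show ?thesis by (simp add: Z_def \<Psi>_def)
qed

text \<open>The slices of the twisted values by coordinates are left M-linear functionals. Only
  finitely many are nonzero, since this holds at each of the finitely many generators; they become
  the second legs of the tensor. Slices also give uniqueness.\<close>

lemma dual_coact_exists_unique:
  assumes \<phi>: "\<phi> \<in> dual_module F"
  shows "\<exists>!t. t \<in> subtensor UNIV (dual_module F) \<and> (\<forall>f. tensor_map id (\<lambda>\<psi>. \<psi> f) t = twisted_value \<phi> f)"
proof -
  note \<phi>l = dual_module_linear[OF \<phi>]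
  note \<Psi>l = twisted_value_linear[OF \<phi>l]
  define \<psi> where "\<psi> b f = slice (coordinate b) (twisted_value \<phi> f)" for b f
  have evl: "clinear (\<lambda>\<psi> :: 'f \<Rightarrow> 'm. \<psi> f)" for f by (simp add: clinear_iff)
  have \<psi>l: "clinear (\<psi> b)" for b
    unfolding \<psi>_def by (intro clin clinear_comp[OF \<Psi>l] clinear_coordinate)
  have \<psi>m: "\<psi> b (lact F m f) = m * \<psi> b f" for b m f
    unfolding \<psi>_def twisted_value_lact[OF \<phi>] lmult_snd_def
    by (simp add: slice_tensor_map clinear_coordinate clin)
  have \<psi>dual: "\<psi> b \<in> dual_module F" for b
    by (simp add: dual_module_def \<psi>l \<psi>m)
  obtain A where A: "finite A" "\<And>f. \<exists>m. f = (\<Sum>a\<in>A. lact F (m a) a)"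
    using F.finitely_generated by blast
  have "\<forall>a. \<exists>S. finite S \<and> S \<subseteq> hamel_basis \<and> (\<forall>b \<in> hamel_basis - S. \<psi> b a = 0)"
    unfolding \<psi>_def using tensor_coordinates by metis
  then obtain S where S: "\<And>a. finite (S a)" "\<And>a. S a \<subseteq> hamel_basis"
    "\<And>a b. b \<in> hamel_basis - S a \<Longrightarrow> \<psi> b a = 0" by metis
  define R where "R = (\<Union>a\<in>A. S a)"
  have R: "finite R" "R \<subseteq> hamel_basis" using A(1) S(1,2) by (auto simp: R_def)
  have zero: "\<psi> b f = 0" if b: "b \<in> hamel_basis - R" for b f
  proof -
    obtain m where f: "f = (\<Sum>a\<in>A. lact F (m a) a)" using A(2) by blast
    have "\<psi> b a = 0" if "a \<in> A" for a using S(3)[of b a] b that by (auto simp: R_def)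
    then show ?thesis by (simp add: f clinear_sum[OF \<psi>l] \<psi>m)
  qed
  let ?t = "\<Sum>b\<in>R. b \<otimes> \<psi> b"
  have t1: "?t \<in> subtensor UNIV (dual_module F)"
    unfolding subtensor_def by (intro cvec.span_sum cvec.span_base) (use \<psi>dual in blast)
  have t2: "tensor_map id (\<lambda>\<psi>. \<psi> f) ?t = twisted_value \<phi> f" for f
  proof -
    have "tensor_map id (\<lambda>\<psi>. \<psi> f) ?t = (\<Sum>b\<in>R. b \<otimes> \<psi> b f)"
      by (simp only: tensor_map_sum[OF clinear_id_const evl] id_apply)
    also have "\<dots> = twisted_value \<phi> f"
      unfolding \<psi>_def
      by (rule tensor_expansion_superset[OF R, symmetric]) (rule zero[unfolded \<psi>_def])
    finally show ?thesis .
  qed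
  show ?thesis
  proof (rule ex1I[of _ ?t])
    show "?t \<in> subtensor UNIV (dual_module F) \<and> (\<forall>f. tensor_map id (\<lambda>\<psi>. \<psi> f) ?t = twisted_value \<phi> f)"
      using t1 t2 by (intro conjI allI)
  next
    fix t assume t: "t \<in> subtensor UNIV (dual_module F) \<and> (\<forall>f. tensor_map id (\<lambda>\<psi>. \<psi> f) t = twisted_value \<phi> f)"
    show "t = ?t"
    proof (rule tensor_eqI, rule ext)
      fix p :: "'g \<Rightarrow> complex" and f assume p: "clinear p"
      have sl: "slice p s f = slice p (tensor_map id (\<lambda>\<psi>. \<psi> f) s)" for s :: "'g \<otimes>\<^sub>C ('f \<Rightarrow> 'm)"
        by (simp add: slice_tensor_map[OF p clinear_id_const evl])
      show "slice p t f = slice p ?t f"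
        unfolding sl t2 using t by simp
    qed
  qed
qed

definition pairing :: "'f \<Rightarrow> 'f \<Rightarrow> 'm" where
  "pairing f g = h (Conj g) f"

lemma h_linear: "clinear h"
  using herm.equivariant by (simp add: comodule_map_def)

lemma h_dual: "h x \<in> dual_module F"
  using herm.bijective by (auto simp: bij_betw_def)

lemma pairing_linear: "clinear (\<lambda>f. pairing f g)"
  unfolding pairing_def by (rule dual_module_linear[OF h_dual])

lemma pairing_lact_left: "pairing (lact F m f) g = m * pairing f g"
  unfolding pairing_def by (rule dual_module_lact[OF h_dual])

lemma pairing_star: "base_star G \<iota> (pairing f g) = pairing g f"
  unfolding pairing_def by (rule herm.symmetric[symmetric])

text \<open>Equivariance of \<open>h\<close> computes the dual coaction of \<open>h (Conj g)\<close>
  from the coaction of g, and \<open>twisted_value_cancel\<close> turns the dual coaction back into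
  the coaction of a value.\<close>

lemma pairing_coaction:
  assumes f: "coact F f = (\<Sum>i\<in>I. a i \<otimes> x i)" and g: "coact F g = (\<Sum>j\<in>J. b j \<otimes> y j)"
  shows "base_coaction G \<iota> (pairing f g) = (\<Sum>i\<in>I. \<Sum>j\<in>J. (a i * star G (b j)) \<otimes> pairing (x i) (y j))"
proof -
  let ?\<phi> = "h (Conj g)"
  note \<phi>l = dual_module_linear[OF h_dual]
  have evl: "clinear (\<lambda>\<psi> :: 'f \<Rightarrow> 'm. \<psi> f)" for f by (simp add: clinear_iff)
  have dc: "dual_coact G \<iota> F ?\<phi> = (THE t. t \<in> subtensor UNIV (dual_module F) \<and>
      (\<forall>f. tensor_map id (\<lambda>\<psi>. \<psi> f) t = twisted_value ?\<phi> f))"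
    by (simp add: dual_coact_def twisted_value_def lmult_fst_def)
  have "dual_coact G \<iota> F ?\<phi> = tensor_map id h (conj_coact G F (Conj g))"
    using herm.equivariant by (simp add: comodule_map_def)
  also have "\<dots> = (\<Sum>j\<in>J. star G (b j) \<otimes> h (Conj (y j)))"
    by (simp add: conj_coact_def g tensor_antimap_sum G.star_antilinear antilinear_Conj
        tensor_map_sum h_linear clin)
  finally have t: "dual_coact G \<iota> F ?\<phi> = (\<Sum>j\<in>J. star G (b j) \<otimes> h (Conj (y j)))" .
  have "tensor_map id (\<lambda>\<psi>. \<psi> f) (dual_coact G \<iota> F ?\<phi>) = twisted_value ?\<phi> f" for f
    using theI'[OF dual_coact_exists_unique[OF h_dual[of "Conj g"]]] unfolding dc by blast
  then have tw: "twisted_value ?\<phi> f = (\<Sum>j\<in>J. star G (b j) \<otimes> pairing f (y j))" for f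
    unfolding t tensor_map_sum[OF clinear_id_const evl] pairing_def by simp
  have "base_coaction G \<iota> (pairing f g) = tlift (\<lambda>a x. lmult_fst a (twisted_value ?\<phi> x)) (coact F f)"
    unfolding pairing_def by (rule twisted_value_cancel[OF \<phi>l, symmetric])
  also have "\<dots> = (\<Sum>i\<in>I. lmult_fst (a i) (twisted_value ?\<phi> (x i)))"
  proof -
    have "cbilinear (\<lambda>a x. lmult_fst a (twisted_value ?\<phi> x))"
      by (intro clin clinear_comp[OF twisted_value_linear[OF \<phi>l]])
    then show ?thesis by (simp add: f tlift_sum tlift_tens)
  qed
  also have "\<dots> = (\<Sum>i\<in>I. \<Sum>j\<in>J. (a i * star G (b j)) \<otimes> pairing (x i) (y j))"
    by (simp add: tw clinear_sum[OF lmult_fst_linear] lmult_fst_tens)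
  finally show ?thesis .
qed

lemma pairing_positive: "f \<noteq> 0 \<Longrightarrow> pairing f f \<in> base_pos G \<iota>"
  using hermitian_positive by (simp add: hermitian_positive_definite_def pairing_def)

end

section \<open>A finite dual basis of the bundle\<close>

lemma vector_eq_0_if_functionals:
  assumes "\<And>p :: 'a::complex_vector \<Rightarrow> complex. clinear p \<Longrightarrow> p x = 0"
  shows "x = 0"
proof -
  have "x = (\<Sum>b | coordinate b x \<noteq> 0. coordinate b x *\<^sub>C b)"
    by (simp add: coordinate_def cvec.sum_nonzero_representation_eq hamel_basis)
  then show ?thesis using assms[OF clinear_coordinate] by simp
qed

lemma tlift_tens_id: "tlift (\<lambda>a b. a \<otimes> b) t = t"
proof (rule clinear_eq_tensor)
  have b: "cbilinear (\<lambda>(a::'a) (b::'b). a \<otimes> b)" by (intro clin)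
  then show "clinear (tlift (\<lambda>(a::'a) (b::'b). a \<otimes> b))" by (rule clinear_tlift)
  show "clinear (\<lambda>t::'a \<otimes>\<^sub>C 'b. t)" by (intro clin)
  show "tlift (\<lambda>a b. a \<otimes> b) (a \<otimes> b) = a \<otimes> b" for a :: 'a and b :: 'b
    by (simp add: tlift_tens b)
qed

context quantum_homogeneous_space
begin

lemma base_counit_linear: "clinear (\<lambda>m. counit G (\<iota> m))"
  by (intro clin)

text \<open>An element of M is recovered from the values of its translates at the counit. This
  transports statements from the fibre over the counit to M.\<close>

lemma incl_from_coaction:
  assumes "base_coaction G \<iota> m = (\<Sum>i\<in>I. c i \<otimes> m' i)"
  shows "\<iota> m = (\<Sum>i\<in>I. counit G (\<iota> (m' i)) *\<^sub>C c i)"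
proof -
  have b: "cbilinear (\<lambda>x y. counit G (\<iota> y) *\<^sub>C x)" by (intro clin)
  have "\<iota> m = tlift (\<lambda>x y. counit G y *\<^sub>C x) (tensor_map id \<iota> (base_coaction G \<iota> m))"
    by (simp add: base_coaction G.counit_right)
  also have "\<dots> = tlift (\<lambda>x y. counit G (\<iota> y) *\<^sub>C x) (base_coaction G \<iota> m)"
    by (subst tlift_tensor_map) ((intro clin)+, simp)
  also have "\<dots> = (\<Sum>i\<in>I. counit G (\<iota> (m' i)) *\<^sub>C c i)"
    unfolding assms tlift_sum[OF b] tlift_tens[OF b] ..
  finally show ?thesis .
qed

end

context hermitian_bundle
begin

text \<open>The Hermitian form of the fibre F / M^+ F over the counit, pulled back to F.\<close>

definition fibre_form :: "'f \<Rightarrow> 'f \<Rightarrow> complex" where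
  "fibre_form f g = counit G (\<iota> (pairing f g))"

sublocale fibre: psd_form fibre_form
proof (intro psd_form.intro)
  show "clinear (\<lambda>f. fibre_form f g)" for g
    unfolding fibre_form_def by (rule clinear_comp[OF base_counit_linear pairing_linear])
  show "fibre_form g f = cnj (fibre_form f g)" for f g
    unfolding fibre_form_def pairing_star[of f g, symmetric] by (rule base_counit_star)
  show "0 \<le> Re (fibre_form f f)" for f
  proof (cases "f = 0")
    case True
    then show ?thesis
      by (simp add: fibre_form_def clinear_0[OF clinear_comp[OF base_counit_linear pairing_linear]])
  next
    case False
    then show ?thesis
      unfolding fibre_form_def by (rule base_pos_props(3)[OF pairing_positive])
  qed
qed

lemma fibre_form_lact: "fibre_form (lact F m f) g = counit G (\<iota> m) * fibre_form f g"
  by (simp add: fibre_form_def pairing_lact_left base_counit_mult)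

text \<open>Modulo M^+ F, which the form does not see, F is spanned over the complex numbers by its
  finitely many generators, so Gram-Schmidt applies to their span.\<close>

lemma fibre_frame_exists:
  "\<exists>V. finite V \<and> (\<forall>u\<in>V. \<forall>v\<in>V. fibre_form u v = of_bool (u = v))
     \<and> (\<forall>f g. fibre_form f g = (\<Sum>v\<in>V. fibre_form f v * fibre_form v g))"
proof -
  obtain A where A: "finite A" "\<And>f. \<exists>m. f = (\<Sum>a\<in>A. lact F (m a) a)"
    using F.finitely_generated by blast
  obtain V where V: "finite V" "\<forall>u\<in>V. \<forall>v\<in>V. fibre_form u v = of_bool (u = v)"
    "\<forall>s\<in>cvec.span A. \<forall>y. fibre_form s y = (\<Sum>v\<in>V. fibre_form s v * fibre_form v y)"
    using fibre.frame[OF A(1)] by (elim exE conjE)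
  have "fibre_form f g = (\<Sum>v\<in>V. fibre_form f v * fibre_form v g)" for f g
  proof -
    obtain m where f: "f = (\<Sum>a\<in>A. lact F (m a) a)" using A(2) by blast
    define s where "s = (\<Sum>a\<in>A. counit G (\<iota> (m a)) *\<^sub>C a)"
    have fs: "fibre_form f y = fibre_form s y" for y
      by (simp add: f s_def fibre.left_simps fibre_form_lact scaleC_complex)
    have "s \<in> cvec.span A"
      unfolding s_def by (intro cvec.span_sum cvec.span_scale cvec.span_base)
    then show ?thesis unfolding fs using V(3) by blast
  qed
  with V(1,2) show ?thesis by blast
qed

definition fibre_frame :: "'f set" where
  "fibre_frame = (SOME V. finite V \<and> (\<forall>u\<in>V. \<forall>v\<in>V. fibre_form u v = of_bool (u = v))
     \<and> (\<forall>f g. fibre_form f g = (\<Sum>v\<in>V. fibre_form f v * fibre_form v g)))"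

lemma fibre_frame: "finite fibre_frame"
    "\<And>u v. u \<in> fibre_frame \<Longrightarrow> v \<in> fibre_frame \<Longrightarrow> fibre_form u v = of_bool (u = v)"
  and fibre_expansion: "\<And>f g. fibre_form f g = (\<Sum>v\<in>fibre_frame. fibre_form f v * fibre_form v g)"
proof -
  note * = someI_ex[OF fibre_frame_exists, folded fibre_frame_def]
  show "finite fibre_frame" by (rule conjunct1[OF *])
  show "fibre_form u v = of_bool (u = v)" if "u \<in> fibre_frame" "v \<in> fibre_frame" for u v
    by (rule conjunct1[OF conjunct2[OF *], rule_format, OF that])
  show "fibre_form f g = (\<Sum>v\<in>fibre_frame. fibre_form f v * fibre_form v g)" for f g
    by (rule conjunct2[OF conjunct2[OF *], rule_format])
qed


text \<open>Over G the bundle becomes trivial, f \<mapsto> f(-1) \<otimes> [f(0)] with [f(0)] the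
  class in the fibre; these are the components of f there.\<close>

definition frame_coordinate :: "'f \<Rightarrow> 'f \<Rightarrow> 'g" where
  "frame_coordinate v f = tlift (\<lambda>a x. fibre_form x v *\<^sub>C a) (coact F f)"

lemma frame_coordinate_bilinear: "cbilinear (\<lambda>a x. fibre_form x v *\<^sub>C a)"
  by (intro clin clinear_comp[OF fibre.linear_left])

lemma frame_coordinate_linear: "clinear (frame_coordinate v)"
  unfolding frame_coordinate_def by (intro clin frame_coordinate_bilinear)

lemma frame_coordinate_sum:
  "coact F f = (\<Sum>i\<in>I. a i \<otimes> x i) \<Longrightarrow> frame_coordinate v f = (\<Sum>i\<in>I. fibre_form (x i) v *\<^sub>C a i)"
  by (simp add: frame_coordinate_def tlift_sum tlift_tens frame_coordinate_bilinear)

text \<open>In the trivialisation over G the Hermitian metric is the standard one.\<close>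

lemma pairing_frame_coordinates:
  "\<iota> (pairing f g) = (\<Sum>v\<in>fibre_frame. frame_coordinate v f * star G (frame_coordinate v g))"
proof -
  obtain I a x where f: "coact F f = (\<Sum>i\<in>(I::nat set). a i \<otimes> x i)" by (rule tensor_finite_sum)
  obtain J b y where g: "coact F g = (\<Sum>j\<in>(J::nat set). b j \<otimes> y j)" by (rule tensor_finite_sum)
  have sc: "star G (frame_coordinate v g) = (\<Sum>j\<in>J. fibre_form v (y j) *\<^sub>C star G (b j))" for v
    using G.star_antilinear
    by (simp add: frame_coordinate_sum[OF g] antilinear_sum) (simp add: antilinear_def fibre.cnj_swap)
  have "base_coaction G \<iota> (pairing f g) = (\<Sum>ij\<in>I \<times> J. (a (fst ij) * star G (b (snd ij))) \<otimes> pairing (x (fst ij)) (y (snd ij)))"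
    by (simp add: pairing_coaction[OF f g] sum.cartesian_product case_prod_unfold)
  from incl_from_coaction[OF this]
  have "\<iota> (pairing f g) = (\<Sum>i\<in>I. \<Sum>j\<in>J. fibre_form (x i) (y j) *\<^sub>C (a i * star G (b j)))"
    by (simp add: sum.cartesian_product case_prod_unfold fibre_form_def)
  also have "\<dots> = (\<Sum>i\<in>I. \<Sum>j\<in>J. \<Sum>v\<in>fibre_frame. (fibre_form (x i) v *\<^sub>C a i) * (fibre_form v (y j) *\<^sub>C star G (b j)))"
    by (subst fibre_expansion) (simp add: cvec.scale_sum_left mult_scaleC_left mult_scaleC_right scaleC_scaleC mult.commute)
  also have "\<dots> = (\<Sum>i\<in>I. \<Sum>v\<in>fibre_frame. \<Sum>j\<in>J. (fibre_form (x i) v *\<^sub>C a i) * (fibre_form v (y j) *\<^sub>C star G (b j)))"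
    by (rule sum.cong[OF refl], rule sum.swap)
  also have "\<dots> = (\<Sum>v\<in>fibre_frame. \<Sum>i\<in>I. \<Sum>j\<in>J. (fibre_form (x i) v *\<^sub>C a i) * (fibre_form v (y j) *\<^sub>C star G (b j)))"
    by (rule sum.swap)
  also have "\<dots> = (\<Sum>v\<in>fibre_frame. frame_coordinate v f * star G (frame_coordinate v g))"
    by (simp only: sc frame_coordinate_sum[OF f] sum_product)
  finally show ?thesis .
qed

lemma frame_coordinates_injective:
  assumes "\<And>v. v \<in> fibre_frame \<Longrightarrow> frame_coordinate v f = 0"
  shows "f = 0"
proof (rule ccontr)
  assume "f \<noteq> 0"
  then have "pairing f f \<noteq> 0" by (rule base_pos_props(1)[OF pairing_positive])
  moreover have "\<iota> (pairing f f) = \<iota> 0"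
    using assms by (simp add: pairing_frame_coordinates clinear_0[OF incl_linear])
  ultimately show False by (simp add: incl_eq_iff)
qed

lemma frame_coordinate_lact: "frame_coordinate v (lact F m f) = \<iota> m * frame_coordinate v f"
proof -
  obtain I c m' where m: "base_coaction G \<iota> m = (\<Sum>i\<in>(I::nat set). c i \<otimes> m' i)" by (rule tensor_finite_sum)
  obtain J a x where f: "coact F f = (\<Sum>j\<in>(J::nat set). a j \<otimes> x j)" by (rule tensor_finite_sum)
  have "coact F (lact F m f) = (\<Sum>ij\<in>I \<times> J. (c (fst ij) * a (snd ij)) \<otimes> lact F (m' (fst ij)) (x (snd ij)))"
    by (simp add: F.coact_lact m f tensor_map2_sums[OF cbilinear_times F.lact_bilinear] sum.cartesian_product case_prod_unfold)
  from frame_coordinate_sum[OF this]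
  have "frame_coordinate v (lact F m f)
    = (\<Sum>i\<in>I. \<Sum>j\<in>J. (counit G (\<iota> (m' i)) *\<^sub>C c i) * (fibre_form (x j) v *\<^sub>C a j))"
    by (simp add: sum.cartesian_product case_prod_unfold fibre_form_lact mult_scaleC_left mult_scaleC_right scaleC_scaleC mult.commute)
  then show ?thesis
    by (simp only: incl_from_coaction[OF m] frame_coordinate_sum[OF f] sum_product)
qed

lemma frame_coordinate_comult:
  assumes "coact F f = (\<Sum>i\<in>I. a i \<otimes> x i)"
  shows "comult G (frame_coordinate v f) = (\<Sum>i\<in>I. a i \<otimes> frame_coordinate v (x i))"
proof -
  note [clin] = clinear_comp[OF fibre.linear_left] clinear_comp[OF frame_coordinate_linear]
  have b: "cbilinear (\<lambda>a x. a \<otimes> frame_coordinate v x)" by (intro clin)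
  have "comult G (frame_coordinate v f) = tlift (\<lambda>a x. tlift (\<lambda>b c. fibre_form x v *\<^sub>C (b \<otimes> c)) (comult G a)) (coact F f)"
    unfolding frame_coordinate_def
    by (simp add: clinear_tlift_push[OF G.comult_linear] clinear_scale[OF G.comult_linear]
        clinear_tlift_push[OF clinear_scaleC_right[OF clinear_ident], symmetric] tlift_tens_id)
  also have "\<dots> = tlift (\<lambda>a x. tlift (\<lambda>b y. fibre_form y v *\<^sub>C (a \<otimes> b)) (coact F x)) (coact F f)"
    by (rule G.comodule_coassoc[OF F.coact_comodule]) (intro clin)+
  also have "\<dots> = tlift (\<lambda>a x. a \<otimes> frame_coordinate v x) (coact F f)"
    by (simp add: frame_coordinate_def clinear_tlift_push[OF clinear_tens_right[OF clinear_ident]] tens_scale_right)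
  finally show ?thesis by (simp add: assms tlift_sum tlift_tens b)
qed

lemma counit_frame_coordinate: "counit G (frame_coordinate v f) = fibre_form f v"
proof -
  have "counit G (frame_coordinate v f) = fibre_form (tlift (\<lambda>a x. counit G a *\<^sub>C x) (coact F f)) v"
    unfolding frame_coordinate_def
    by (simp add: clinear_tlift_push[OF G.counit_linear] clinear_tlift_push[OF fibre.linear_left]
        clinear_scale[OF G.counit_linear] fibre.left_simps scaleC_complex mult.commute)
  then show ?thesis using F.coact_comodule by (simp add: comodule_def)
qed

definition frame_gram :: "'f \<Rightarrow> 'f \<Rightarrow> complex" where
  "frame_gram k u = (\<Sum>v\<in>fibre_frame. haar G (star G (frame_coordinate k v) * frame_coordinate u v))"

text \<open>Invariance of h applied to
  \<open>star G (frame_coordinate k f) * frame_coordinate u f\<close>, whose coproduct is known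
  because the coordinates intertwine coaction and comultiplication.\<close>

lemma haar_average_frame_coordinates:
  assumes "coact F f = (\<Sum>i\<in>I. a i \<otimes> x i)"
  shows "(\<Sum>i\<in>I. \<Sum>j\<in>I. haar G (star G (a i) * a j) *\<^sub>C (star G (frame_coordinate k (x i)) * frame_coordinate u (x j)))
    = haar G (star G (frame_coordinate k f) * frame_coordinate u f) *\<^sub>C 1"
proof -
  have b: "cbilinear (\<lambda>x y. haar G x *\<^sub>C y)" by (intro clin)
  have "comult G (star G (frame_coordinate k f) * frame_coordinate u f)
    = (\<Sum>i\<in>I. \<Sum>j\<in>I. (star G (a i) * a j) \<otimes> (star G (frame_coordinate k (x i)) * frame_coordinate u (x j)))"
    by (simp add: G.comult_mult G.star_comult frame_coordinate_comult[OF assms] tensor_antimap_sum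
        G.star_antilinear tensor_map2_sums[OF cbilinear_times cbilinear_times])
  then show ?thesis
    unfolding G.haar_right[symmetric] by (simp only: tlift_sum[OF b] tlift_tens[OF b])
qed

text \<open>The Haar average of the rank-one operators \<open>f \<mapsto> (f, v) v\<close>: in the frame coordinates it becomes
  multiplication by the invertible scalar matrix \<^const>\<open>frame_gram\<close>.\<close>

lemma averaged_operator_exists:
  "\<exists>(K :: ('f \<times> nat \<times> nat) set) w w' A. finite K \<and> (\<forall>f. A f = (\<Sum>k\<in>K. lact F (pairing f (w k)) (w' k)))
     \<and> (\<forall>u\<in>fibre_frame. \<forall>f. frame_coordinate u (A f) = (\<Sum>k\<in>fibre_frame. frame_gram k u *\<^sub>C frame_coordinate k f))"
proof -
  have "\<forall>v. \<exists>I a x. finite (I::nat set) \<and> coact F v = (\<Sum>i\<in>I. a i \<otimes> x i)"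
    using tensor_finite_sum by metis
  then obtain I a x where I: "\<And>v. finite (I v :: nat set)" and co: "\<And>v. coact F v = (\<Sum>i\<in>I v. a v i \<otimes> x v i)"
    by metis
  \<comment> \<open>Weights of the average: translating v in both places of f \<mapsto> (f, v) v and
    integrating leaves h(a(i)* a(j)) in front of (f, x(i)) x(j).\<close>
  define s where "s v i j = haar G (star G (a v i) * a v j)" for v i j
  define K where "K = (SIGMA v:fibre_frame. I v \<times> I v)"
  define w where "w k = x (fst k) (fst (snd k))" for k :: "'f \<times> nat \<times> nat"
  define w' where "w' k = s (fst k) (fst (snd k)) (snd (snd k)) *\<^sub>C x (fst k) (snd (snd k))" for k :: "'f \<times> nat \<times> nat"
  define A where "A f = (\<Sum>k\<in>K. lact F (pairing f (w k)) (w' k))" for f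
  have A: "A f = (\<Sum>v\<in>fibre_frame. \<Sum>i\<in>I v. \<Sum>j\<in>I v. s v i j *\<^sub>C lact F (pairing f (x v i)) (x v j))" for f
  proof -
    have "A f = (\<Sum>(v, i, j)\<in>K. s v i j *\<^sub>C lact F (pairing f (x v i)) (x v j))"
      unfolding A_def w_def w'_def clinear_scale[OF cbilinear_right[OF F.lact_bilinear]]
      by (simp add: case_prod_unfold)
    then show ?thesis
      by (simp add: K_def sum.Sigma fibre_frame(1) I sum.cartesian_product)
  qed
  have "frame_coordinate u (A f) = (\<Sum>k\<in>fibre_frame. frame_gram k u *\<^sub>C frame_coordinate k f)"
    if "u \<in> fibre_frame" for u f
  proof -
    have "frame_coordinate u (A f) = (\<Sum>v\<in>fibre_frame. \<Sum>i\<in>I v. \<Sum>j\<in>I v. \<Sum>k\<in>fibre_frame.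
        frame_coordinate k f * (s v i j *\<^sub>C (star G (frame_coordinate k (x v i)) * frame_coordinate u (x v j))))"
      by (simp add: A clinear_simps[OF frame_coordinate_linear] frame_coordinate_lact pairing_frame_coordinates
          sum_distrib_right cvec.scale_sum_right mult_scaleC_right mult.assoc)
    also have "\<dots> = (\<Sum>v\<in>fibre_frame. \<Sum>i\<in>I v. \<Sum>k\<in>fibre_frame. \<Sum>j\<in>I v.
        frame_coordinate k f * (s v i j *\<^sub>C (star G (frame_coordinate k (x v i)) * frame_coordinate u (x v j))))"
      by (intro sum.cong[OF refl]) (rule sum.swap)
    also have "\<dots> = (\<Sum>v\<in>fibre_frame. \<Sum>k\<in>fibre_frame. \<Sum>i\<in>I v. \<Sum>j\<in>I v.
        frame_coordinate k f * (s v i j *\<^sub>C (star G (frame_coordinate k (x v i)) * frame_coordinate u (x v j))))"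
      by (rule sum.cong[OF refl]) (rule sum.swap)
    also have "\<dots> = (\<Sum>k\<in>fibre_frame. \<Sum>v\<in>fibre_frame. \<Sum>i\<in>I v. \<Sum>j\<in>I v.
        frame_coordinate k f * (s v i j *\<^sub>C (star G (frame_coordinate k (x v i)) * frame_coordinate u (x v j))))"
      by (rule sum.swap)
    also have "\<dots> = (\<Sum>k\<in>fibre_frame. \<Sum>v\<in>fibre_frame.
        frame_coordinate k f * (haar G (star G (frame_coordinate k v) * frame_coordinate u v) *\<^sub>C 1))"
      by (simp only: haar_average_frame_coordinates[OF co, folded s_def, symmetric] sum_distrib_left)
    also have "\<dots> = (\<Sum>k\<in>fibre_frame. frame_gram k u *\<^sub>C frame_coordinate k f)"
      by (simp add: frame_gram_def mult_scaleC_right cvec.scale_sum_left)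
    finally show ?thesis .
  qed
  moreover have "finite K" by (simp add: K_def fibre_frame(1) I)
  ultimately show ?thesis using A_def by blast
qed

text \<open>Pairing the relation with the conjugate of c makes the sum over v of h(z(v)* z(v))
  vanish, so z(w) = 0 by faithfulness. The counit takes z(w) to \<open>cnj (c w)\<close>, as the
  frame is orthonormal there.\<close>

lemma frame_gram_injective:
  assumes c: "\<And>u. u \<in> fibre_frame \<Longrightarrow> (\<Sum>k\<in>fibre_frame. c k * frame_gram k u) = 0" and w: "w \<in> fibre_frame"
  shows "c w = 0"
proof -
  define z where "z v = (\<Sum>u\<in>fibre_frame. cnj (c u) *\<^sub>C frame_coordinate u v)" for v
  have sz: "star G (z v) = (\<Sum>k\<in>fibre_frame. c k *\<^sub>C star G (frame_coordinate k v))" for v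
    using G.star_antilinear by (simp add: z_def antilinear_sum) (simp add: antilinear_def)
  have hz: "haar G (star G (z v) * z v)
    = (\<Sum>k\<in>fibre_frame. \<Sum>u\<in>fibre_frame. c k * (cnj (c u) * haar G (star G (frame_coordinate k v) * frame_coordinate u v)))" for v
    unfolding sz unfolding z_def
    by (simp add: sum_product clinear_simps[OF G.haar_linear] mult_scaleC_left mult_scaleC_right scaleC_complex mult_ac)
  have "(\<Sum>v\<in>fibre_frame. haar G (star G (z v) * z v))
    = (\<Sum>k\<in>fibre_frame. \<Sum>u\<in>fibre_frame. c k * (cnj (c u) * frame_gram k u))"
  proof -
    have "(\<Sum>v\<in>fibre_frame. haar G (star G (z v) * z v))
      = (\<Sum>k\<in>fibre_frame. \<Sum>v\<in>fibre_frame. \<Sum>u\<in>fibre_frame.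
          c k * (cnj (c u) * haar G (star G (frame_coordinate k v) * frame_coordinate u v)))"
      unfolding hz by (rule sum.swap)
    also have "\<dots> = (\<Sum>k\<in>fibre_frame. \<Sum>u\<in>fibre_frame. \<Sum>v\<in>fibre_frame.
          c k * (cnj (c u) * haar G (star G (frame_coordinate k v) * frame_coordinate u v)))"
      by (rule sum.cong[OF refl]) (rule sum.swap)
    finally show ?thesis by (simp only: frame_gram_def sum_distrib_left)
  qed
  also have "\<dots> = (\<Sum>u\<in>fibre_frame. \<Sum>k\<in>fibre_frame. c k * (cnj (c u) * frame_gram k u))"
    by (rule sum.swap)
  also have "\<dots> = (\<Sum>u\<in>fibre_frame. cnj (c u) * (\<Sum>k\<in>fibre_frame. c k * frame_gram k u))"
    by (simp add: sum_distrib_left mult.left_commute)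
  also have "\<dots> = 0" using c by simp
  finally have 0: "(\<Sum>v\<in>fibre_frame. Re (haar G (star G (z v) * z v))) = 0"
    by (metis Re_sum zero_complex.sel(1))
  have nn: "0 \<le> Re (haar G (star G (z v) * z v))" for v
    using G.haar_pos[of "z v"] by (cases "z v = 0") (auto simp: clinear_0[OF G.haar_linear])
  have zw: "z w = 0"
    using 0 nn w fibre_frame(1) G.haar_pos[of "z w"] by (auto simp: sum_nonneg_eq_0_iff)
  have "counit G (z w) = (\<Sum>u\<in>fibre_frame. if u = w then cnj (c u) else 0)"
    unfolding z_def clinear_sum[OF G.counit_linear] clinear_scale[OF G.counit_linear] counit_frame_coordinate
    by (rule sum.cong[OF refl]) (auto simp: fibre_frame(2)[OF w] scaleC_complex)
  also have "\<dots> = cnj (c w)" using w fibre_frame(1) by simp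
  finally show ?thesis by (simp add: zw clinear_0[OF G.counit_linear])
qed

text \<open>The averaged operator \<open>A\<close> is left M-linear and injective. It is onto
  because each f lies in a finite-dimensional invariant space, cut out by requiring all coordinates
  to lie in the span of those of f. Then f = A (B f), with \<open>B\<close> the inverse, is the
  required expansion.\<close>

theorem dual_basis:
  "\<exists>(K :: ('f \<times> nat \<times> nat) set) \<phi> w. finite K \<and> (\<forall>k\<in>K. \<phi> k \<in> dual_module F) \<and> (\<forall>f. f = (\<Sum>k\<in>K. lact F (\<phi> k f) (w k)))"
proof -
  from averaged_operator_exists
  obtain K :: "('f \<times> nat \<times> nat) set" and w w' A where
    A: "finite K \<and> (\<forall>f. A f = (\<Sum>k\<in>K. lact F (pairing f (w k)) (w' k))) \<and>
      (\<forall>u\<in>fibre_frame. \<forall>f. frame_coordinate u (A f) = (\<Sum>k\<in>fibre_frame. frame_gram k u *\<^sub>C frame_coordinate k f))"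
    by (elim exE)
  note K = conjunct1[OF A] and Adef = conjunct1[OF conjunct2[OF A], rule_format]
    and coord = conjunct2[OF conjunct2[OF A], rule_format]
  have Alin: "clinear A"
    unfolding Adef[abs_def] by (intro clin pairing_linear)
  have Alact: "A (lact F m f) = lact F m (A f)" for m f
    by (simp add: Adef pairing_lact_left F.lact_mult clinear_sum[OF cbilinear_right[OF F.lact_bilinear]])
  have A0: "f = 0" if "A f = 0" for f
  proof (rule frame_coordinates_injective, rule vector_eq_0_if_functionals)
    fix v and p :: "'g \<Rightarrow> complex" assume v: "v \<in> fibre_frame" and p: "clinear p"
    show "p (frame_coordinate v f) = 0"
    proof (rule frame_gram_injective[of "\<lambda>k. p (frame_coordinate k f)", OF _ v])
      fix u assume "u \<in> fibre_frame"
      then have "(\<Sum>k\<in>fibre_frame. frame_gram k u *\<^sub>C frame_coordinate k f) = 0"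
        using coord[of u f] that by (simp add: clinear_0[OF frame_coordinate_linear])
      from arg_cong[OF this, of p] show "(\<Sum>k\<in>fibre_frame. p (frame_coordinate k f) * frame_gram k u) = 0"
        by (simp add: clinear_simps[OF p] scaleC_complex mult.commute)
    qed
  qed
  have inj: "inj A"
  proof (rule injI)
    fix x y assume "A x = A y"
    then show "x = y" using A0[of "x - y"] by (simp add: clinear_diff[OF Alin])
  qed
  have surj: "f \<in> range A" for f
  proof -
    define S where "S = (\<lambda>k. frame_coordinate k f) ` fibre_frame"
    define W where "W = {f'. \<forall>u\<in>fibre_frame. frame_coordinate u f' \<in> cvec.span S}"
    have W: "cvec.subspace W"
      by (auto simp: W_def cvec.subspace_def clinear_simps[OF frame_coordinate_linear]
          intro: cvec.span_add cvec.span_scale cvec.span_zero)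
    have AW: "A ` W \<subseteq> W"
      by (auto simp: W_def coord intro!: cvec.span_sum cvec.span_scale)
    \<comment> \<open>All frame coordinates at once, zero off the frame; its injectivity makes
      \<open>W\<close> finite-dimensional.\<close>
    define \<Theta> where "\<Theta> f' = (\<lambda>u. if u \<in> fibre_frame then frame_coordinate u f' else 0)" for f'
    have \<Theta>: "clinear \<Theta>"
      by (rule clinearI) (auto simp: \<Theta>_def fun_eq_iff clinear_simps[OF frame_coordinate_linear])
    have \<Theta>inj: "inj \<Theta>"
    proof (rule injI)
      fix x y assume "\<Theta> x = \<Theta> y"
      then have "\<Theta> (x - y) = 0" by (simp add: clinear_diff[OF \<Theta>])
      then have "x - y = 0"
        by (intro frame_coordinates_injective) (auto simp: \<Theta>_def fun_eq_iff split: if_splits)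
      then show "x = y" by simp
    qed
    define e where "e u g = (\<lambda>v. if v = u then g else 0)" for u :: 'f and g :: 'g
    have el: "clinear (e u)" for u
      by (rule clinearI) (auto simp: e_def fun_eq_iff)
    have "\<Theta> ` W \<subseteq> cvec.span (\<Union>u\<in>fibre_frame. e u ` S)"
    proof (rule image_subsetI)
      fix f' assume f': "f' \<in> W"
      have eval: "(\<Sum>u\<in>U. e u (g u)) v = (\<Sum>u\<in>U. e u (g u) v)" for U g and v :: 'f
        by (induction U rule: infinite_finite_induct) auto
      have "\<Theta> f' = (\<Sum>u\<in>fibre_frame. e u (frame_coordinate u f'))"
        by (rule ext) (simp only: eval, simp add: e_def \<Theta>_def fibre_frame(1))
      also have "\<dots> \<in> cvec.span (\<Union>u\<in>fibre_frame. e u ` S)"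
      proof (rule cvec.span_sum)
        fix u assume u: "u \<in> fibre_frame"
        have "e u (frame_coordinate u f') \<in> e u ` cvec.span S" using f' u by (auto simp: W_def)
        also have "\<dots> = cvec.span (e u ` S)" by (rule cvp.linear_span_image[OF el, symmetric])
        also have "\<dots> \<subseteq> cvec.span (\<Union>u\<in>fibre_frame. e u ` S)" by (rule cvec.span_mono) (use u in auto)
        finally show "e u (frame_coordinate u f') \<in> cvec.span (\<Union>u\<in>fibre_frame. e u ` S)" .
      qed
      finally show "\<Theta> f' \<in> cvec.span (\<Union>u\<in>fibre_frame. e u ` S)" .
    qed
    moreover have "finite (\<Union>u\<in>fibre_frame. e u ` S)" by (simp add: S_def fibre_frame(1))
    ultimately have "\<exists>S'. finite S' \<and> W \<subseteq> cvec.span S'"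
      by (intro finite_span_vimage[OF \<Theta> \<Theta>inj])
    then obtain S' where "finite S'" "W \<subseteq> cvec.span S'" by (elim exE conjE)
    from inj_endo_fin_dim_surj[OF Alin inj W AW this] have "W \<subseteq> A ` W" .
    moreover have "f \<in> W" by (auto simp: W_def S_def intro: cvec.span_base)
    ultimately show ?thesis by blast
  qed
  define B where "B = inv A"
  have AB: "A (B f) = f" for f unfolding B_def by (rule f_inv_into_f[OF surj])
  have eqI: "x = y" if "A x = A y" for x y using inj that by (rule injD)
  have Blin: "clinear B"
    by (rule clinearI; rule eqI) (simp_all add: AB clinear_add[OF Alin] clinear_scale[OF Alin])
  have Blact: "B (lact F m f) = lact F m (B f)" for m f
    by (rule eqI) (simp add: AB Alact)
  have "(\<lambda>f. pairing (B f) (w k)) \<in> dual_module F" for k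
    by (simp add: dual_module_def Blact pairing_lact_left clinear_comp[OF pairing_linear Blin])
  moreover have "f = (\<Sum>k\<in>K. lact F (pairing (B f) (w k)) (w' k))" for f
    using AB[of f] by (simp add: Adef)
  ultimately show ?thesis
    using K by (intro exI[of _ K] exI[of _ "\<lambda>k f. pairing (B f) (w k)"] exI[of _ w'] conjI) auto
qed

end

section \<open>Forms with values in the bundle\<close>

lemma cbilinear_eq_tensors:
  assumes f: "cbilinear f" and g: "cbilinear g"
    and eq: "\<And>a b c e. f (a \<otimes> b) (c \<otimes> e) = g (a \<otimes> b) (c \<otimes> e)"
  shows "f s t = g s t"
proof (rule clinear_eq_tensor[of "\<lambda>s. f s t" "\<lambda>s. g s t"])
  show "clinear (\<lambda>s. f s t)" "clinear (\<lambda>s. g s t)" using f g by (simp_all add: cbilinear_def)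
  show "f (a \<otimes> b) t = g (a \<otimes> b) t" for a b
    by (rule clinear_eq_tensor[of "f (a \<otimes> b)" "g (a \<otimes> b)"]) (use f g eq in \<open>simp_all add: cbilinear_def\<close>)
qed

locale kaehler_bundle =
  hermitian_bundle G H \<pi> \<iota> F h + kaehler_structure G \<iota> \<Omega> C n \<kappa> +
  T: balanced_tensor_product UNIV UNIV "\<lambda>\<omega> m. \<omega> * emb \<Omega> m" "lact F" \<tau> +
  T': balanced_tensor_product "dual_module F" UNIV dual_ract "\<lambda>m \<omega>. emb \<Omega> m * \<omega>" \<tau>' +
  hol: holomorphic_structure \<Omega> C F \<tau> D
  for G :: "'g::complex_algebra_1 hopf" and H :: "'h::complex_algebra_1 hopf" and \<pi> :: "'g \<Rightarrow> 'h"
    and \<iota> :: "'m::complex_algebra_1 \<Rightarrow> 'g" and F :: "('g, 'm, 'f::complex_vector) bimodule"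
    and h :: "'f conj_space \<Rightarrow> ('f \<Rightarrow> 'm)"
    and \<Omega> :: "('g, 'm, 'w::complex_algebra_1) calculus" and C :: "'w complex_str" and n :: nat and \<kappa> :: 'w
    and \<tau> :: "'w \<Rightarrow> 'f \<Rightarrow> 'e::complex_vector"
    and \<tau>' :: "('f \<Rightarrow> 'm) \<Rightarrow> 'w \<Rightarrow> 'd::complex_vector"
    and D :: "'f \<Rightarrow> 'e" +
  assumes kaehler_positive: "kaehler_positive_definite G \<iota> \<Omega> C n \<kappa>"
begin

lemma tau_bilinear: "cbilinear \<tau>"
  using T.add_left T.add_right T.scale_left T.scale_right by (simp add: cbilinear_def clinear_iff)

lemmas tau_clin [clin] = cbilinear_comp_left[OF tau_bilinear] cbilinear_comp_right[OF tau_bilinear]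

lemmas tau_simps = clinear_simps[OF cbilinear_left[OF tau_bilinear]] clinear_simps[OF cbilinear_right[OF tau_bilinear]]

lemma clinear_eq_tau: "clinear S \<Longrightarrow> clinear R \<Longrightarrow> (\<And>\<omega> f. S (\<tau> \<omega> f) = R (\<tau> \<omega> f)) \<Longrightarrow> S e = R e"
  by (rule T.lift_unique)

lemma antilinear_eq_tau:
  assumes "antilinear S" "antilinear R" "\<And>\<omega> f. S (\<tau> \<omega> f) = R (\<tau> \<omega> f)"
  shows "S e = R e"
  using clinear_eq_tau[OF clinear_Conj_antilinear[OF assms(1)] clinear_Conj_antilinear[OF assms(2)], of e]
  by (simp add: assms(3))

lemma tau_lift:
  assumes "cbilinear \<beta>" "\<And>\<omega> m f. \<beta> (\<omega> * emb \<Omega> m) f = \<beta> \<omega> (lact F m f)"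
  shows "\<exists>T. clinear T \<and> (\<forall>\<omega> f. T (\<tau> \<omega> f) = \<beta> \<omega> f)"
  using T.lift[OF cvec.subspace_UNIV assms(1)] assms(2) by auto

lemma tau_lift_unique:
  assumes "cbilinear \<beta>" "\<And>\<omega> m f. \<beta> (\<omega> * emb \<Omega> m) f = \<beta> \<omega> (lact F m f)"
  shows "\<exists>!T. clinear T \<and> (\<forall>\<omega> f. T (\<tau> \<omega> f) = \<beta> \<omega> f)"
proof -
  from tau_lift[OF assms]
  obtain S where S: "clinear S \<and> (\<forall>\<omega> f. S (\<tau> \<omega> f) = \<beta> \<omega> f)" by (elim exE)
  show ?thesis
  proof (rule ex1I[of _ S])
    show "clinear S \<and> (\<forall>\<omega> f. S (\<tau> \<omega> f) = \<beta> \<omega> f)" by (rule S)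
  next
    fix R assume R: "clinear R \<and> (\<forall>\<omega> f. R (\<tau> \<omega> f) = \<beta> \<omega> f)"
    show "R = S"
      by (rule ext, rule clinear_eq_tau[OF conjunct1[OF R] conjunct1[OF S]]) (simp add: R S)
  qed
qed

lemma tau_balanced: "\<tau> (\<omega> * emb \<Omega> m) f = \<tau> \<omega> (lact F m f)"
proof -
  have "(\<Sum>(a, b)\<leftarrow>[(\<omega> * emb \<Omega> m, f), (- \<omega>, lact F m f)]. a \<otimes> b)
    \<in> cvec.span {(r * emb \<Omega> m') \<otimes> b - r \<otimes> lact F m' b | r b m'. r \<in> UNIV \<and> b \<in> UNIV}"
    using clinear_neg[OF clinear_tens_left[OF clinear_ident], of \<omega> "lact F m f"]
    by (auto intro!: cvec.span_base)
  then have "(\<Sum>(a, b)\<leftarrow>[(\<omega> * emb \<Omega> m, f), (- \<omega>, lact F m f)]. \<tau> a b) = 0"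
    by (subst T.kernel) auto
  then show ?thesis by (simp add: tau_simps)
qed

lemma bundle_form_sum:
  obtains N :: nat and \<omega> f where "e = (\<Sum>i<N. \<tau> (\<omega> i) (f i))"
proof -
  obtain ps where "e = (\<Sum>(a, b)\<leftarrow>ps. \<tau> a b)" using T.onto by blast
  then have "e = (\<Sum>i<length ps. \<tau> (fst (ps ! i)) (snd (ps ! i)))"
    by (simp add: sum_list_sum_nth atLeast0LessThan case_prod_unfold)
  then show thesis by (rule that)
qed

abbreviation wedge :: "'w \<Rightarrow> 'e \<Rightarrow> 'e" where
  "wedge \<equiv> form_wedge \<tau>"

lemma wedge_spec: "clinear (wedge \<omega>) \<and> (\<forall>\<nu> f. wedge \<omega> (\<tau> \<nu> f) = \<tau> (\<omega> * \<nu>) f)"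
proof -
  have "cbilinear (\<lambda>\<nu> f. \<tau> (\<omega> * \<nu>) f)" by (intro clin)
  then have "\<exists>!T. clinear T \<and> (\<forall>\<nu> f. T (\<tau> \<nu> f) = \<tau> (\<omega> * \<nu>) f)"
    by (rule tau_lift_unique) (simp add: tau_balanced mult.assoc[symmetric])
  from theI'[OF this] show ?thesis unfolding form_wedge_def .
qed

lemma wedge_linear: "clinear (wedge \<omega>)" and wedge_tau: "wedge \<omega> (\<tau> \<nu> f) = \<tau> (\<omega> * \<nu>) f"
  using wedge_spec[of \<omega>] by simp_all

lemma wedge_bilinear: "cbilinear wedge"
proof (rule cbilinearI[OF wedge_linear], rule clinearI)
  show "wedge (\<omega> + \<omega>') e = wedge \<omega> e + wedge \<omega>' e" for \<omega> \<omega>' e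
    by (rule clinear_eq_tau) (intro clin wedge_linear | simp add: wedge_tau distrib_right tau_simps)+
  show "wedge (c *\<^sub>C \<omega>) e = c *\<^sub>C wedge \<omega> e" for c \<omega> e
    by (rule clinear_eq_tau) (intro clin wedge_linear | simp add: wedge_tau mult_scaleC_left tau_simps)+
qed

lemmas wedge_clin [clin] = cbilinear_comp_left[OF wedge_bilinear] cbilinear_comp_right[OF wedge_bilinear]

lemma wedge_mult: "wedge (\<omega> * \<nu>) e = wedge \<omega> (wedge \<nu> e)"
  by (rule clinear_eq_tau) (intro clin | simp add: wedge_tau mult.assoc)+

abbreviation bundle_coact :: "'e \<Rightarrow> 'g \<otimes>\<^sub>C 'e" where
  "bundle_coact \<equiv> form_tensor_coact \<Omega> F \<tau>"

lemma form_coact_emb_right: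
  "form_coact \<Omega> (\<omega> * emb \<Omega> m) = tensor_map2 (*) (\<lambda>\<omega> m. \<omega> * emb \<Omega> m) (form_coact \<Omega> \<omega>) (base_coaction G \<iota> m)"
  using covariant_bimodule.coact_ract[OF form_bimodule, of \<omega> m] by (simp add: form_bimodule_def)

lemma bundle_coact_spec:
  "clinear bundle_coact \<and> (\<forall>\<omega> f. bundle_coact (\<tau> \<omega> f) = tensor_map2 (*) \<tau> (form_coact \<Omega> \<omega>) (coact F f))"
proof -
  have r: "cbilinear (\<lambda>\<omega> m. \<omega> * emb \<Omega> m)" by (intro clin)
  have bil: "cbilinear (\<lambda>\<omega> f. tensor_map2 (*) \<tau> (form_coact \<Omega> \<omega>) (coact F f))"
    by (intro clin clinear_tensor_map2_left clinear_tensor_map2_right tau_bilinear coact_linear form_coact_linear)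
  have bal: "tensor_map2 (*) \<tau> (form_coact \<Omega> (\<omega> * emb \<Omega> m)) (coact F f)
    = tensor_map2 (*) \<tau> (form_coact \<Omega> \<omega>) (coact F (lact F m f))" for \<omega> m f
  proof -
  obtain I a x where \<omega>: "form_coact \<Omega> \<omega> = (\<Sum>i\<in>(I::nat set). a i \<otimes> x i)" by (rule tensor_finite_sum)
  obtain J b y where m: "base_coaction G \<iota> m = (\<Sum>j\<in>(J::nat set). b j \<otimes> y j)" by (rule tensor_finite_sum)
  obtain K c z where f: "coact F f = (\<Sum>k\<in>(K::nat set). c k \<otimes> z k)" by (rule tensor_finite_sum)
  have 1: "tensor_map2 (*) \<tau> (form_coact \<Omega> (\<omega> * emb \<Omega> m)) (coact F f)
    = (\<Sum>i\<in>I. \<Sum>j\<in>J. \<Sum>k\<in>K. (a i * b j * c k) \<otimes> \<tau> (x i * emb \<Omega> (y j)) (z k))"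
    unfolding form_coact_emb_right \<omega> m f tensor_map2_sums[OF cbilinear_times r]
      clinear_sum[OF clinear_tensor_map2_left[OF cbilinear_times tau_bilinear clinear_ident]]
    by (simp add: clinear_sum[OF clinear_tensor_map2_right[OF cbilinear_times tau_bilinear clinear_ident]]
        tensor_map2_tens[OF cbilinear_times tau_bilinear])
  have "coact F (lact F m f) = (\<Sum>jk\<in>J \<times> K. (b (fst jk) * c (snd jk)) \<otimes> lact F (y (fst jk)) (z (snd jk)))"
    by (simp add: F.coact_lact f m tensor_map2_sums[OF cbilinear_times F.lact_bilinear] sum.cartesian_product case_prod_unfold)
  then have 2: "tensor_map2 (*) \<tau> (form_coact \<Omega> \<omega>) (coact F (lact F m f))
    = (\<Sum>i\<in>I. \<Sum>j\<in>J. \<Sum>k\<in>K. (a i * (b j * c k)) \<otimes> \<tau> (x i) (lact F (y j) (z k)))"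
    by (simp add: \<omega> tensor_map2_sums[OF cbilinear_times tau_bilinear])
      (simp add: sum.cartesian_product case_prod_unfold)
  show ?thesis
    unfolding 1 2 by (simp add: tau_balanced mult.assoc)
  qed
  from theI'[OF tau_lift_unique[OF bil bal]] show ?thesis unfolding form_tensor_coact_def .
qed

lemma bundle_coact_linear: "clinear bundle_coact"
  and bundle_coact_tau: "bundle_coact (\<tau> \<omega> f) = tensor_map2 (*) \<tau> (form_coact \<Omega> \<omega>) (coact F f)"
  using bundle_coact_spec by simp_all

lemmas bundle_coact_clin [clin] = clinear_comp[OF bundle_coact_linear]

text \<open>The coaction is diagonal: \<open>M\<close> combines the three legs pairwise, and
  coassociativity and the counit law reduce to those of \<Omega> and F.\<close>

lemma bundle_comodule: "comodule G bundle_coact"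
  unfolding comodule_def
proof (intro conjI allI)
  show "clinear bundle_coact" by (rule bundle_coact_linear)
  note ct = cbilinear_times and tb = tau_bilinear
  have inner: "cbilinear (tensor_map2 ((*) :: 'g \<Rightarrow> 'g \<Rightarrow> 'g) \<tau>)" by (rule cbilinear_tensor_map2[OF ct tb])
  define M where "M = tensor_map2 ((*) :: 'g \<Rightarrow> 'g \<Rightarrow> 'g) (tensor_map2 ((*) :: 'g \<Rightarrow> 'g \<Rightarrow> 'g) \<tau>)"
  have M: "cbilinear M" unfolding M_def by (rule cbilinear_tensor_map2[OF ct inner])
  note [clin] = cbilinear_comp_left[OF M] cbilinear_comp_right[OF M]
    clinear_tensor_map2_left[OF ct tb] clinear_tensor_map2_right[OF ct tb]
    clinear_tensor_map2_left[OF ct ct] clinear_tensor_map2_right[OF ct ct]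
    G.comult_linear bundle_coact_linear form_coact_linear coact_linear
  have Mtens: "M (a \<otimes> s) (b \<otimes> t) = (a * b) \<otimes> tensor_map2 (*) \<tau> s t" for a b s t
    unfolding M_def by (rule tensor_map2_tens[OF ct inner])
  have 1: "tensor_assoc (tensor_map2 (*) (*) u v \<otimes> \<tau> \<omega> f) = M (tensor_assoc (u \<otimes> \<omega>)) (tensor_assoc (v \<otimes> f))" for u v :: "'g \<otimes>\<^sub>C 'g" and \<omega> f
  proof (rule cbilinear_eq_tensors[of "\<lambda>u v. tensor_assoc (tensor_map2 (*) (*) u v \<otimes> \<tau> \<omega> f)"])
    show "cbilinear (\<lambda>(u :: 'g \<otimes>\<^sub>C 'g) v. tensor_assoc (tensor_map2 (*) (*) u v \<otimes> \<tau> \<omega> f))"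
      "cbilinear (\<lambda>u v. M (tensor_assoc (u \<otimes> \<omega>)) (tensor_assoc (v \<otimes> f)))" by (intro clin)+
  qed (simp add: tensor_map2_tens[OF ct ct] tensor_map2_tens[OF ct tb] tensor_assoc_tens Mtens)
  have L: "tensor_assoc (tensor_map (comult G) id (tensor_map2 (*) \<tau> s t))
    = M (tensor_assoc (tensor_map (comult G) id s)) (tensor_assoc (tensor_map (comult G) id t))" for s t
  proof (rule cbilinear_eq_tensors[of "\<lambda>s t. tensor_assoc (tensor_map (comult G) id (tensor_map2 (*) \<tau> s t))"])
    show "cbilinear (\<lambda>s t. tensor_assoc (tensor_map (comult G) id (tensor_map2 (*) \<tau> s t)))"
      "cbilinear (\<lambda>s t. M (tensor_assoc (tensor_map (comult G) id s)) (tensor_assoc (tensor_map (comult G) id t)))"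
      by (intro clin)+
  qed (simp add: tensor_map2_tens[OF ct tb] tensor_map_tens G.comult_linear clin G.comult_mult 1)
  have R: "tensor_map id bundle_coact (tensor_map2 (*) \<tau> s t)
    = M (tensor_map id (form_coact \<Omega>) s) (tensor_map id (coact F) t)" for s :: "'g \<otimes>\<^sub>C 'w" and t :: "'g \<otimes>\<^sub>C 'f"
  proof (rule cbilinear_eq_tensors[of "\<lambda>s t. tensor_map id bundle_coact (tensor_map2 (*) \<tau> s t)"])
    show "cbilinear (\<lambda>(s :: 'g \<otimes>\<^sub>C 'w) t. tensor_map id bundle_coact (tensor_map2 (*) \<tau> s t))"
      "cbilinear (\<lambda>s t. M (tensor_map id (form_coact \<Omega>) s) (tensor_map id (coact F) t))"
      by (intro clin)+
  qed (simp only: tensor_map2_tens[OF ct tb] tensor_map_id_tens[OF bundle_coact_linear]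
      tensor_map_id_tens[OF form_coact_linear] tensor_map_id_tens[OF coact_linear] bundle_coact_tau Mtens)
  have coassoc: "tensor_assoc (tensor_map (comult G) id (form_coact \<Omega> \<omega>)) = tensor_map id (form_coact \<Omega>) (form_coact \<Omega> \<omega>)"
    "tensor_assoc (tensor_map (comult G) id (coact F f)) = tensor_map id (coact F) (coact F f)"
    and cou: "tlift (\<lambda>g w. counit G g *\<^sub>C w) (form_coact \<Omega> \<omega>) = \<omega>" "tlift (\<lambda>g w. counit G g *\<^sub>C w) (coact F f) = f" for \<omega> f
    using form_comodule F.coact_comodule by (simp_all add: comodule_def)
  show "tensor_assoc (tensor_map (comult G) id (bundle_coact e)) = tensor_map id bundle_coact (bundle_coact e)" for e
  proof (rule clinear_eq_tau[of "\<lambda>e. tensor_assoc (tensor_map (comult G) id (bundle_coact e))"])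
    show "clinear (\<lambda>e. tensor_assoc (tensor_map (comult G) id (bundle_coact e)))"
      "clinear (\<lambda>e. tensor_map id bundle_coact (bundle_coact e))" by (intro clin)+
  qed (simp only: bundle_coact_tau L R coassoc)
  have E: "tlift (\<lambda>g w. counit G g *\<^sub>C w) (tensor_map2 (*) \<tau> s t)
    = \<tau> (tlift (\<lambda>g w. counit G g *\<^sub>C w) s) (tlift (\<lambda>g w. counit G g *\<^sub>C w) t)" for s t
  proof (rule cbilinear_eq_tensors[of "\<lambda>s t. tlift (\<lambda>g w. counit G g *\<^sub>C w) (tensor_map2 (*) \<tau> s t)"])
    show "cbilinear (\<lambda>s t. tlift (\<lambda>g w. counit G g *\<^sub>C w) (tensor_map2 (*) \<tau> s t))"
      "cbilinear (\<lambda>s t. \<tau> (tlift (\<lambda>g w. counit G g *\<^sub>C w) s) (tlift (\<lambda>g w. counit G g *\<^sub>C w) t))"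
      by (intro clin)+
    fix a \<omega> b f
    have "slice (counit G) ((a * b) \<otimes> \<tau> \<omega> f) = \<tau> (slice (counit G) (a \<otimes> \<omega>)) (slice (counit G) (b \<otimes> f))"
      by (simp add: slice_tens G.counit_linear G.counit_mult tau_simps scaleC_scaleC)
    then show "tlift (\<lambda>g w. counit G g *\<^sub>C w) (tensor_map2 (*) \<tau> (a \<otimes> \<omega>) (b \<otimes> f))
      = \<tau> (tlift (\<lambda>g w. counit G g *\<^sub>C w) (a \<otimes> \<omega>)) (tlift (\<lambda>g w. counit G g *\<^sub>C w) (b \<otimes> f))"
      by (simp add: slice_def tensor_map2_tens[OF ct tb])
  qed
  show "tlift (\<lambda>g w. counit G g *\<^sub>C w) (bundle_coact e) = e" for e
  proof (rule clinear_eq_tau[of "\<lambda>e. tlift (\<lambda>g w. counit G g *\<^sub>C w) (bundle_coact e)" "\<lambda>e. e"])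
    show "clinear (\<lambda>e. tlift (\<lambda>g w. counit G g *\<^sub>C w) (bundle_coact e))" "clinear (\<lambda>e. e)" by (intro clin)+
  qed (simp only: bundle_coact_tau E cou)
qed

lemma act_tau:
  assumes "clinear p" "coact F f = (\<Sum>j\<in>J. b j \<otimes> y j)"
  shows "act bundle_coact p (\<tau> \<omega> f) = (\<Sum>j\<in>J. \<tau> (act (form_coact \<Omega>) (\<lambda>g. p (g * b j)) \<omega>) (y j))"
  unfolding act_def bundle_coact_tau assms(2) by (rule slice_tensor_map2[OF assms(1) tau_bilinear])

lemma bundle_coact_wedge:
  "bundle_coact (wedge \<omega> e) = tensor_map2 (*) wedge (form_coact \<Omega> \<omega>) (bundle_coact e)"
proof (rule clinear_eq_tau[of "\<lambda>e. bundle_coact (wedge \<omega> e)"])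
  note ct = cbilinear_times and tb = tau_bilinear and wb = wedge_bilinear
  note [clin] = clinear_tensor_map2_right[OF ct wb] clinear_tensor_map2_right[OF ct tb] clinear_tensor_map2_left[OF ct tb]
    clinear_tensor_map2_right[OF ct ct]
  show "clinear (\<lambda>e. bundle_coact (wedge \<omega> e))" "clinear (\<lambda>e. tensor_map2 (*) wedge (form_coact \<Omega> \<omega>) (bundle_coact e))"
    by (intro clin)+
  obtain I a x where \<omega>: "form_coact \<Omega> \<omega> = (\<Sum>i\<in>(I::nat set). a i \<otimes> x i)" by (rule tensor_finite_sum)
  have "tensor_map2 (*) \<tau> (tensor_map2 (*) (*) s u) t = tensor_map2 (*) wedge s (tensor_map2 (*) \<tau> u t)"
    if s: "s = (\<Sum>i\<in>I. a i \<otimes> x i)" for s u t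
  proof (rule cbilinear_eq_tensors[of "\<lambda>u t. tensor_map2 (*) \<tau> (tensor_map2 (*) (*) s u) t"])
    show "cbilinear (\<lambda>u. tensor_map2 (*) \<tau> (tensor_map2 (*) (*) s u))"
      "cbilinear (\<lambda>u t. tensor_map2 (*) wedge s (tensor_map2 (*) \<tau> u t))" by (intro clin)+
  qed (simp add: s tensor_map2_tens[OF ct tb] tensor_map2_tens[OF ct ct] tensor_map2_tens[OF ct wb] wedge_tau mult.assoc
      clinear_sum[OF clinear_tensor_map2_left[OF ct ct clinear_ident]] clinear_sum[OF clinear_tensor_map2_left[OF ct tb clinear_ident]]
      clinear_sum[OF clinear_tensor_map2_left[OF ct wb clinear_ident]])
  from this[OF \<omega>] show "bundle_coact (wedge \<omega> (\<tau> \<nu> f)) = tensor_map2 (*) wedge (form_coact \<Omega> \<omega>) (bundle_coact (\<tau> \<nu> f))" for \<nu> f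
    by (simp add: wedge_tau bundle_coact_tau form_coact_mult)
qed

section \<open>The extended Dolbeault operator\<close>

text \<open>The sign (-1)^k as a linear operator; it makes the defining formula of the extended
  Dolbeault operator bilinear in \<omega> and f, so that it can be lifted to the tensor
  product.\<close>

definition degree_sign :: "'w \<Rightarrow> 'w" where
  "degree_sign \<omega> = (\<Sum>k\<le>2 * n. (- 1) ^ k *\<^sub>C degree_component k \<omega>)"

lemma degree_sign_linear: "clinear degree_sign"
  unfolding degree_sign_def[abs_def] by (intro clin clinear_degree_component)

lemma degree_sign_deg:
  assumes "\<omega> \<in> deg \<Omega> k"
  shows "degree_sign \<omega> = (- 1) ^ k *\<^sub>C \<omega>"
proof (cases "k \<le> 2 * n")
  case True
  have "degree_sign \<omega> = (\<Sum>j\<le>2 * n. if j = k then (- 1) ^ k *\<^sub>C \<omega> else 0)"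
    unfolding degree_sign_def degree_component_deg[OF assms] by (rule sum.cong) auto
  then show ?thesis using True by simp
next
  case False
  then have "\<omega> = 0" using above_top_zero[of k] assms by auto
  then show ?thesis by (simp add: clinear_0[OF degree_sign_linear])
qed

abbreviation dolbeault :: "'e \<Rightarrow> 'e" where
  "dolbeault \<equiv> delbar_extension \<Omega> C \<tau> D"

lemma D_linear: "clinear D"
  and D_coact: "bundle_coact (D f) = tensor_map id D (coact F f)"
  using hol.equivariant by (simp_all add: comodule_map_def)

lemma clinear_eq_tau_deg:
  assumes S: "clinear S" and R: "clinear R"
    and eq: "\<And>k \<omega> f. \<omega> \<in> deg \<Omega> k \<Longrightarrow> S (\<tau> \<omega> f) = R (\<tau> \<omega> f)"
  shows "S e = R e"
proof (rule clinear_eq_tau[OF S R])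
  fix \<omega> f
  have l: "clinear (\<lambda>\<omega>. S (\<tau> \<omega> f))" "clinear (\<lambda>\<omega>. R (\<tau> \<omega> f))"
    using clinear_comp[OF S cbilinear_left[OF tau_bilinear]] clinear_comp[OF R cbilinear_left[OF tau_bilinear]] .
  show "S (\<tau> \<omega> f) = R (\<tau> \<omega> f)"
  proof (rule cvp.linear_eq_on_span[OF l, of "\<Union>k. deg \<Omega> k"])
    show "S (\<tau> \<nu> f) = R (\<tau> \<nu> f)" if "\<nu> \<in> (\<Union>k. deg \<Omega> k)" for \<nu> using that eq by blast
  qed (simp add: span_deg)
qed

text \<open>The formula is balanced over M because the extra term in \<open>delbar_mult_emb\<close>,
  with its sign (-1)^k, is the one that the Leibniz rule of \<open>D\<close> produces.\<close>

lemma dolbeault_spec: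
  "clinear dolbeault \<and> (\<forall>k. \<forall>\<omega> \<in> deg \<Omega> k. \<forall>f.
     dolbeault (\<tau> \<omega> f) = \<tau> (delbar C \<omega>) f + (- 1) ^ k *\<^sub>C wedge \<omega> (D f))"
proof -
  define \<beta> where "\<beta> \<omega> f = \<tau> (delbar C \<omega>) f + wedge (degree_sign \<omega>) (D f)" for \<omega> f
  note [clin] = clinear_comp[OF delbar_linear] clinear_comp[OF degree_sign_linear] clinear_comp[OF D_linear]
  have \<beta>: "cbilinear \<beta>" unfolding \<beta>_def by (intro clin)
  have "\<beta> (\<omega> * emb \<Omega> m) f = \<beta> \<omega> (lact F m f)" for \<omega> m f
  proof -
    have l: "clinear (\<lambda>\<omega>. \<beta> (\<omega> * emb \<Omega> m) f)" "clinear (\<lambda>\<omega>. \<beta> \<omega> (lact F m f))"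
      unfolding \<beta>_def by (intro clin)+
    show ?thesis
    proof (rule cvp.linear_eq_on_span[OF l, of "\<Union>k. deg \<Omega> k"])
      fix \<nu> assume "\<nu> \<in> (\<Union>k. deg \<Omega> k)"
      then obtain k where k: "\<nu> \<in> deg \<Omega> k" by blast
      then have k': "\<nu> * emb \<Omega> m \<in> deg \<Omega> k"
        using deg_mult[OF k, of "emb \<Omega> m" 0] emb_range by auto
      show "\<beta> (\<nu> * emb \<Omega> m) f = \<beta> \<nu> (lact F m f)"
        by (simp add: \<beta>_def degree_sign_deg[OF k] degree_sign_deg[OF k'] delbar_mult_emb[OF k] hol.leibniz
            tau_simps clinear_simps[OF cbilinear_left[OF wedge_bilinear]] clinear_simps[OF wedge_linear]
            wedge_tau wedge_mult tau_balanced scaleC_add_right mult_scaleC_left)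
    qed (simp add: span_deg)
  qed
  from tau_lift[OF \<beta> this] obtain S where S: "clinear S \<and> (\<forall>\<omega> f. S (\<tau> \<omega> f) = \<beta> \<omega> f)" by (elim exE)
  have val: "S (\<tau> \<omega> f) = \<tau> (delbar C \<omega>) f + (- 1) ^ k *\<^sub>C wedge \<omega> (D f)" if "\<omega> \<in> deg \<Omega> k" for k \<omega> f
    using S by (simp add: \<beta>_def degree_sign_deg[OF that] clinear_scale[OF cbilinear_left[OF wedge_bilinear]])
  have "\<exists>!T. clinear T \<and> (\<forall>k. \<forall>\<omega> \<in> deg \<Omega> k. \<forall>f. T (\<tau> \<omega> f) = \<tau> (delbar C \<omega>) f + (- 1) ^ k *\<^sub>C wedge \<omega> (D f))"
  proof (rule ex1I[of _ S])
    show "clinear S \<and> (\<forall>k. \<forall>\<omega> \<in> deg \<Omega> k. \<forall>f. S (\<tau> \<omega> f) = \<tau> (delbar C \<omega>) f + (- 1) ^ k *\<^sub>C wedge \<omega> (D f))"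
      by (intro conjI conjunct1[OF S] allI ballI val)
  next
    fix R assume R: "clinear R \<and> (\<forall>k. \<forall>\<omega> \<in> deg \<Omega> k. \<forall>f. R (\<tau> \<omega> f) = \<tau> (delbar C \<omega>) f + (- 1) ^ k *\<^sub>C wedge \<omega> (D f))"
    show "R = S"
    proof (rule ext, rule clinear_eq_tau_deg[OF conjunct1[OF R] conjunct1[OF S]])
      fix k \<omega> f assume \<omega>: "\<omega> \<in> deg \<Omega> k"
      show "R (\<tau> \<omega> f) = S (\<tau> \<omega> f)"
        unfolding val[OF \<omega>] by (rule conjunct2[OF R, rule_format, OF \<omega>])
    qed
  qed
  from theI'[OF this] show ?thesis unfolding delbar_extension_def .
qed

lemma dolbeault_linear: "clinear dolbeault"
  by (rule conjunct1[OF dolbeault_spec])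

lemma dolbeault_tau:
  "\<omega> \<in> deg \<Omega> k \<Longrightarrow> dolbeault (\<tau> \<omega> f) = \<tau> (delbar C \<omega>) f + (- 1) ^ k *\<^sub>C wedge \<omega> (D f)"
  by (rule conjunct2[OF dolbeault_spec, rule_format])

lemma act_dolbeault:
  assumes p: "clinear p"
  shows "act bundle_coact p (dolbeault e) = dolbeault (act bundle_coact p e)"
proof (rule clinear_eq_tau_deg[of "\<lambda>e. act bundle_coact p (dolbeault e)"])
  have act: "clinear (act bundle_coact p)" by (rule clinear_act[OF bundle_coact_linear p clinear_ident])
  show "clinear (\<lambda>e. act bundle_coact p (dolbeault e))" "clinear (\<lambda>e. dolbeault (act bundle_coact p e))"
    by (rule clinear_comp[OF act dolbeault_linear], rule clinear_comp[OF dolbeault_linear act])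
  fix k \<omega> f assume \<omega>: "\<omega> \<in> deg \<Omega> k"
  obtain J b y where f: "coact F f = (\<Sum>j\<in>(J::nat set). b j \<otimes> y j)" by (rule tensor_finite_sum)
  \<comment> \<open>The legs of f are absorbed into the functional; both terms of the Dolbeault
    operator meet the same functionals \<open>q j\<close>.\<close>
  define q where "q j = (\<lambda>g. p (g * b j))" for j
  have q: "clinear (q j)" for j
    unfolding q_def by (intro clinear_comp[OF p] clin)
  have qdeg: "act (form_coact \<Omega>) (q j) \<omega> \<in> deg \<Omega> k" for j
    by (rule bideg_preserving_deg[OF clinear_act[OF form_coact_linear q clinear_ident] act_bideg[OF q] \<omega>])
  have "bundle_coact (D f) = (\<Sum>j\<in>J. b j \<otimes> D (y j))"
    unfolding D_coact f by (simp add: tensor_map_sum D_linear clin)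
  then have wedge: "act bundle_coact p (wedge \<omega> (D f)) = (\<Sum>j\<in>J. wedge (act (form_coact \<Omega>) (q j) \<omega>) (D (y j)))"
    unfolding act_def bundle_coact_wedge q_def by (simp add: slice_tensor_map2[OF p wedge_bilinear])
  have "act bundle_coact p (dolbeault (\<tau> \<omega> f)) = (\<Sum>j\<in>J. \<tau> (act (form_coact \<Omega>) (q j) (delbar C \<omega>)) (y j))
    + (- 1) ^ k *\<^sub>C (\<Sum>j\<in>J. wedge (act (form_coact \<Omega>) (q j) \<omega>) (D (y j)))"
    unfolding dolbeault_tau[OF \<omega>] clinear_add[OF act] clinear_scale[OF act] wedge act_tau[OF p f, folded q_def] ..
  also have "\<dots> = (\<Sum>j\<in>J. dolbeault (\<tau> (act (form_coact \<Omega>) (q j) \<omega>) (y j)))"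
    by (simp add: dolbeault_tau[OF qdeg] act_delbar[OF q] sum.distrib cvec.scale_sum_right)
  also have "\<dots> = dolbeault (act bundle_coact p (\<tau> \<omega> f))"
    by (simp add: act_tau[OF p f, folded q_def] clinear_sum[OF dolbeault_linear])
  finally show "act bundle_coact p (dolbeault (\<tau> \<omega> f)) = dolbeault (act bundle_coact p (\<tau> \<omega> f))" .
qed

end

section \<open>The inner product\<close>

context kaehler_bundle
begin

lemma base_star_0 [simp]: "base_star G \<iota> 0 = 0"
  by (rule antilinear_0[OF base_star_antilinear])

lemma form_star_emb_left: "form_star \<Omega> (emb \<Omega> m * \<omega>) = form_star \<Omega> \<omega> * emb \<Omega> (base_star G \<iota> m)"
  and form_star_emb_right: "form_star \<Omega> (\<omega> * emb \<Omega> m) = emb \<Omega> (base_star G \<iota> m) * form_star \<Omega> \<omega>"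
proof -
  have e: "emb \<Omega> m \<in> deg \<Omega> 0" using emb_range by blast
  have l: "clinear (\<lambda>\<omega>. Conj (form_star \<Omega> (emb \<Omega> m * \<omega>)))" "clinear (\<lambda>\<omega>. Conj (form_star \<Omega> \<omega> * emb \<Omega> (base_star G \<iota> m)))"
    "clinear (\<lambda>\<omega>. Conj (form_star \<Omega> (\<omega> * emb \<Omega> m)))" "clinear (\<lambda>\<omega>. Conj (emb \<Omega> (base_star G \<iota> m) * form_star \<Omega> \<omega>))"
    using form_star_antilinear
    by (auto intro!: clinear_Conj_antilinear simp: antilinear_def distrib_left distrib_right mult_scaleC_left mult_scaleC_right)
  have s: "\<omega> \<in> cvec.span (\<Union>k. deg \<Omega> k)" by (simp add: span_deg)
  have "Conj (form_star \<Omega> (emb \<Omega> m * \<omega>)) = Conj (form_star \<Omega> \<omega> * emb \<Omega> (base_star G \<iota> m))"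
    by (rule cvp.linear_eq_on_span[OF l(1,2) _ s]) (use form_star_mult[OF e] in \<open>auto simp: form_star_emb\<close>)
  then show "form_star \<Omega> (emb \<Omega> m * \<omega>) = form_star \<Omega> \<omega> * emb \<Omega> (base_star G \<iota> m)" by simp
  have "Conj (form_star \<Omega> (\<omega> * emb \<Omega> m)) = Conj (emb \<Omega> (base_star G \<iota> m) * form_star \<Omega> \<omega>)"
    by (rule cvp.linear_eq_on_span[OF l(3,4) _ s]) (use form_star_mult[OF _ e] in \<open>auto simp: form_star_emb\<close>)
  then show "form_star \<Omega> (\<omega> * emb \<Omega> m) = emb \<Omega> (base_star G \<iota> m) * form_star \<Omega> \<omega>" by simp
qed

definition form_pairing :: "'w \<Rightarrow> 'w \<Rightarrow> 'm" where
  "form_pairing \<omega> \<nu> = vol_map (\<omega> * hodge_map (form_star \<Omega> \<nu>))"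

lemma form_pairing_linear: "clinear (\<lambda>\<omega>. form_pairing \<omega> \<nu>)"
  unfolding form_pairing_def by (intro clin)

lemma form_pairing_antilinear: "antilinear (form_pairing \<omega>)"
  using clinear_antilinear_comp[OF _ form_star_antilinear, of "\<lambda>x. vol_map (\<omega> * hodge_map x)"]
  by (simp add: form_pairing_def[abs_def] clin)

lemma form_pairing_positive: "\<omega> \<noteq> 0 \<Longrightarrow> form_pairing \<omega> \<omega> \<in> base_pos G \<iota>"
  using kaehler_positive by (simp add: kaehler_positive_definite_def form_pairing_def)

text \<open>Obtained from positivity by polarisation, because elements of
  \<open>base_pos G \<iota>\<close> are self-adjoint; the Hodge coefficients never enter.\<close>

lemma form_pairing_star: "base_star G \<iota> (form_pairing \<omega> \<nu>) = form_pairing \<nu> \<omega>"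
proof (rule sesquilinear_polarisation[OF form_pairing_linear form_pairing_antilinear base_star_antilinear])
  fix \<omega>
  show "base_star G \<iota> (form_pairing \<omega> \<omega>) = form_pairing \<omega> \<omega>"
    by (cases "\<omega> = 0") (simp_all add: clinear_0[OF form_pairing_linear] base_pos_props(2) form_pairing_positive)
qed

lemma form_pairing_emb: "form_pairing \<omega> (\<nu> * emb \<Omega> m) = form_pairing (\<omega> * emb \<Omega> (base_star G \<iota> m)) \<nu>"
  by (simp add: form_pairing_def form_star_emb_right hodge_lmult mult.assoc)

lemma form_pairing_lmult: "form_pairing \<omega> (emb \<Omega> m * \<nu>) = form_pairing \<omega> \<nu> * base_star G \<iota> m"
  by (simp add: form_pairing_def form_star_emb_left hodge_rmult mult.assoc[symmetric] vol_rmult)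

abbreviation bundle_ev :: "'e \<Rightarrow> 'd \<Rightarrow> 'w" where
  "bundle_ev \<equiv> ev_wedge \<Omega> F \<tau> \<tau>'"

lemma dual_module_subspace: "cvec.subspace (dual_module F)"
  unfolding dual_module_def cvec.subspace_def
  by (auto simp: clinear_iff distrib_left mult_scaleC_right scaleC_add_right algebra_simps scaleC_scaleC)

text \<open>Two lifts: for fixed \<omega> and f the formula descends along \<tau>', and the
  resulting map, which depends on \<omega> and f in a balanced bilinear way, descends along
  \<tau>.\<close>

lemma bundle_ev_spec:
  "cbilinear bundle_ev \<and> (\<forall>\<omega> f \<nu>. \<forall>\<phi> \<in> dual_module F. bundle_ev (\<tau> \<omega> f) (\<tau>' \<phi> \<nu>) = \<omega> * emb \<Omega> (\<phi> f) * \<nu>)"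
proof -
  have "\<exists>R. clinear R \<and> (\<forall>\<phi>\<in>dual_module F. \<forall>\<nu>\<in>UNIV. R (\<tau>' \<phi> \<nu>) = \<omega> * emb \<Omega> (\<phi> f) * \<nu>)" for \<omega> f
  proof (rule T'.lift[OF dual_module_subspace])
    have "clinear (\<lambda>\<phi> :: 'f \<Rightarrow> 'm. \<phi> f)" by (simp add: clinear_iff)
    then show "cbilinear (\<lambda>\<phi> \<nu>. \<omega> * emb \<Omega> (\<phi> f) * \<nu>)"
      by (intro clin)
  qed (simp add: dual_ract_def emb_mult mult.assoc)
  then obtain R where R: "\<And>\<omega> f. clinear (R \<omega> f)"
    "\<And>\<omega> f \<phi> \<nu>. \<phi> \<in> dual_module F \<Longrightarrow> R \<omega> f (\<tau>' \<phi> \<nu>) = \<omega> * emb \<Omega> (\<phi> f) * \<nu>"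
    by (metis UNIV_I)
  have Req: "S x = R' x" if "clinear S" "clinear R'" "\<And>\<phi> \<nu>. \<phi> \<in> dual_module F \<Longrightarrow> S (\<tau>' \<phi> \<nu>) = R' (\<tau>' \<phi> \<nu>)" for S R' :: "'d \<Rightarrow> 'w" and x
    using that by (rule T'.lift_unique)
  have "\<exists>S. clinear S \<and> (\<forall>\<omega> f. S (\<tau> \<omega> f) = R \<omega> f)"
  proof (rule tau_lift)
    note [clin] = R(1)
    show "cbilinear R"
    proof (rule cbilinearI; rule clinearI; rule ext)
      show "R a (x + y) d = (R a x + R a y) d" for a x y d
        using Req[of "R a (x + y)" "\<lambda>d. R a x d + R a y d" d]
        by (simp add: R clin dual_module_linear clinear_add[OF emb_linear] clinear_add[OF dual_module_linear] distrib_left distrib_right)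
      show "R a (c *\<^sub>C x) d = (c *\<^sub>C R a x) d" for a c x d
        using Req[of "R a (c *\<^sub>C x)" "\<lambda>d. c *\<^sub>C R a x d" d]
        by (simp add: R clin clinear_scale[OF emb_linear] clinear_scale[OF dual_module_linear] mult_scaleC_left mult_scaleC_right)
      show "R (x + y) b d = (R x b + R y b) d" for b x y d
        using Req[of "R (x + y) b" "\<lambda>d. R x b d + R y b d" d]
        by (simp add: R clin distrib_right)
      show "R (c *\<^sub>C x) b d = (c *\<^sub>C R x b) d" for b c x d
        using Req[of "R (c *\<^sub>C x) b" "\<lambda>d. c *\<^sub>C R x b d" d]
        by (simp add: R clin mult_scaleC_left)
    qed
    show "R (\<omega> * emb \<Omega> m) f = R \<omega> (lact F m f)" for \<omega> m f
    proof
      fix d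
      show "R (\<omega> * emb \<Omega> m) f d = R \<omega> (lact F m f) d"
        using Req[of "R (\<omega> * emb \<Omega> m) f" "R \<omega> (lact F m f)" d]
        by (simp add: R dual_module_lact emb_mult mult.assoc)
    qed
  qed
  then obtain S where S: "clinear S" "\<And>\<omega> f. S (\<tau> \<omega> f) = R \<omega> f" by blast
  have Sr: "clinear (S e)" for e
  proof -
    obtain N :: nat and \<omega> f where "e = (\<Sum>i<N. \<tau> (\<omega> i) (f i))" by (rule bundle_form_sum[of e])
    then have e: "S e = (\<Sum>i<N. R (\<omega> i) (f i))" by (simp add: clinear_sum[OF S(1)] S(2))
    have ev: "(\<Sum>i<N. R (\<omega> i) (f i)) d = (\<Sum>i<N. R (\<omega> i) (f i) d)" for d N
      by (induction N) simp_all
    have "S e = (\<lambda>d. \<Sum>i<N. R (\<omega> i) (f i) d)" by (rule ext) (simp only: e ev)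
    then show ?thesis by (simp add: clinear_setsum R(1))
  qed
  have Sb: "cbilinear S"
    using Sr S(1) by (simp add: cbilinear_def clinear_iff)
  have Sval: "S (\<tau> \<omega> f) (\<tau>' \<phi> \<nu>) = \<omega> * emb \<Omega> (\<phi> f) * \<nu>" if "\<phi> \<in> dual_module F" for \<omega> f \<phi> \<nu>
    using that by (simp add: S(2) R(2))
  have "\<exists>!\<beta>. cbilinear \<beta> \<and> (\<forall>\<omega> f \<nu>. \<forall>\<phi> \<in> dual_module F. \<beta> (\<tau> \<omega> f) (\<tau>' \<phi> \<nu>) = \<omega> * emb \<Omega> (\<phi> f) * \<nu>)"
  proof (rule ex1I[of _ S])
    show "cbilinear S \<and> (\<forall>\<omega> f \<nu>. \<forall>\<phi> \<in> dual_module F. S (\<tau> \<omega> f) (\<tau>' \<phi> \<nu>) = \<omega> * emb \<Omega> (\<phi> f) * \<nu>)"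
      by (intro conjI Sb allI ballI Sval)
  next
    fix R' assume R': "cbilinear R' \<and> (\<forall>\<omega> f \<nu>. \<forall>\<phi> \<in> dual_module F. R' (\<tau> \<omega> f) (\<tau>' \<phi> \<nu>) = \<omega> * emb \<Omega> (\<phi> f) * \<nu>)"
    have "R' e d = S e d" for e d
    proof (rule clinear_eq_tau[OF cbilinear_left[OF conjunct1[OF R']] cbilinear_left[OF Sb]])
      fix \<omega> f
      show "R' (\<tau> \<omega> f) d = S (\<tau> \<omega> f) d"
      proof (rule Req[OF cbilinear_right[OF conjunct1[OF R']] cbilinear_right[OF Sb]])
        fix \<phi> \<nu> assume \<phi>: "\<phi> \<in> dual_module F"
        show "R' (\<tau> \<omega> f) (\<tau>' \<phi> \<nu>) = S (\<tau> \<omega> f) (\<tau>' \<phi> \<nu>)"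
          unfolding Sval[OF \<phi>] by (rule conjunct2[OF R', rule_format, OF \<phi>])
      qed
    qed
    then show "R' = S" by (intro ext)
  qed
  from theI'[OF this] show ?thesis unfolding ev_wedge_def .
qed

lemma bundle_ev_bilinear: "cbilinear bundle_ev"
  by (rule conjunct1[OF bundle_ev_spec])

lemma bundle_ev_tau: "\<phi> \<in> dual_module F \<Longrightarrow> bundle_ev (\<tau> \<omega> f) (\<tau>' \<phi> \<nu>) = \<omega> * emb \<Omega> (\<phi> f) * \<nu>"
  by (rule conjunct2[OF bundle_ev_spec, rule_format])

lemma tau'_simps:
  assumes "\<phi> \<in> dual_module F"
  shows "\<psi> \<in> dual_module F \<Longrightarrow> \<tau>' (\<phi> + \<psi>) \<nu> = \<tau>' \<phi> \<nu> + \<tau>' \<psi> \<nu>" "\<tau>' \<phi> (\<nu> + \<mu>) = \<tau>' \<phi> \<nu> + \<tau>' \<phi> \<mu>"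
    "\<tau>' (c *\<^sub>C \<phi>) \<nu> = c *\<^sub>C \<tau>' \<phi> \<nu>" "\<tau>' \<phi> (c *\<^sub>C \<nu>) = c *\<^sub>C \<tau>' \<phi> \<nu>"
  using assms T'.add_left T'.add_right T'.scale_left T'.scale_right by auto

lemma tau'_balanced:
  assumes \<phi>: "\<phi> \<in> dual_module F"
  shows "\<tau>' (dual_ract \<phi> m) \<nu> = \<tau>' \<phi> (emb \<Omega> m * \<nu>)"
proof -
  have r: "dual_ract \<phi> m \<in> dual_module F"
    using \<phi> by (simp add: dual_module_def dual_ract_def mult.assoc clin clinear_mult_left)
  let ?ps = "[(dual_ract \<phi> m, \<nu>), ((- 1) *\<^sub>C \<phi>, emb \<Omega> m * \<nu>)]"
  have sub: "set ?ps \<subseteq> dual_module F \<times> UNIV"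
    using r \<phi> dual_module_subspace by (auto intro: cvec.subspace_neg)
  have "(\<Sum>(a, b)\<leftarrow>?ps. a \<otimes> b) = dual_ract \<phi> m \<otimes> \<nu> - \<phi> \<otimes> (emb \<Omega> m * \<nu>)"
    by (simp add: clinear_neg[OF clinear_tens_left[OF clinear_ident]])
  also have "\<dots> \<in> cvec.span {dual_ract a m \<otimes> b - a \<otimes> (emb \<Omega> m * b) | a b m. a \<in> dual_module F \<and> b \<in> UNIV}"
    using \<phi> by (intro cvec.span_base) blast
  finally have "(\<Sum>(a, b)\<leftarrow>?ps. \<tau>' a b) = 0"
    by (subst T'.kernel[OF sub])
  then show ?thesis using T'.scale_left[OF \<phi> UNIV_I, of "- 1" "emb \<Omega> m * \<nu>"] by simp
qed

abbreviation bundle_hodge :: "'e \<Rightarrow> 'd" where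
  "bundle_hodge \<equiv> hodge_bundle \<Omega> C n \<kappa> \<tau> \<tau>' h"

text \<open>The lifting lemma is about linear maps, hence the detour through
  \<open>Conj\<close>.\<close>

lemma bundle_hodge_spec:
  "antilinear bundle_hodge \<and> (\<forall>\<omega> f. bundle_hodge (\<tau> \<omega> f) = \<tau>' (h (Conj f)) (hodge_map (form_star \<Omega> \<omega>)))"
proof -
  define \<beta> where "\<beta> \<omega> f = Conj (\<tau>' (h (Conj f)) (hodge_map (form_star \<Omega> \<omega>)))" for \<omega> f
  have hs: "h (Conj (f + g)) = h (Conj f) + h (Conj g)" "h (Conj (c *\<^sub>C f)) = cnj c *\<^sub>C h (Conj f)" for f g c
    using clinear_antilinear_comp[OF h_linear antilinear_Conj] by (simp_all add: antilinear_def)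
  have fs: "form_star \<Omega> (x + y) = form_star \<Omega> x + form_star \<Omega> y" "form_star \<Omega> (c *\<^sub>C x) = cnj c *\<^sub>C form_star \<Omega> x" for x y c
    using form_star_antilinear by (simp_all add: antilinear_def)
  have b: "cbilinear \<beta>"
    unfolding cbilinear_def clinear_iff \<beta>_def
    by (simp add: hs fs tau'_simps h_dual clinear_add[OF hodge_linear] clinear_scale[OF hodge_linear]
        plus_conj_space_def scaleC_conj_space_def)
  have "\<beta> (\<omega> * emb \<Omega> m) f = \<beta> \<omega> (lact F m f)" for \<omega> m f
  proof -
    have "h (Conj (lact F m f)) = dual_ract (h (Conj f)) (base_star G \<iota> m)"
      using herm.right_linear[of "Conj f" "base_star G \<iota> m"] by (simp add: conj_ract_def)
    then show ?thesis
      by (simp add: \<beta>_def form_star_emb_right hodge_lmult tau'_balanced h_dual)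
  qed
  from tau_lift[OF b this] obtain S where S: "clinear S" "\<And>\<omega> f. S (\<tau> \<omega> f) = \<beta> \<omega> f" by blast
  have Sa: "antilinear (\<lambda>e. unConj (S e))"
    by (simp add: antilinear_def clinear_add[OF S(1)] clinear_scale[OF S(1)])
  have Sv: "unConj (S (\<tau> \<omega> f)) = \<tau>' (h (Conj f)) (hodge_map (form_star \<Omega> \<omega>))" for \<omega> f
    by (simp add: S(2) \<beta>_def)
  have "\<exists>!T. antilinear T \<and> (\<forall>\<omega> f. T (\<tau> \<omega> f) = \<tau>' (h (Conj f)) (hodge_map (form_star \<Omega> \<omega>)))"
  proof (rule ex1I[of _ "\<lambda>e. unConj (S e)"])
    show "antilinear (\<lambda>e. unConj (S e)) \<and> (\<forall>\<omega> f. unConj (S (\<tau> \<omega> f)) = \<tau>' (h (Conj f)) (hodge_map (form_star \<Omega> \<omega>)))"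
      by (intro conjI Sa allI Sv)
  next
    fix R assume R: "antilinear R \<and> (\<forall>\<omega> f. R (\<tau> \<omega> f) = \<tau>' (h (Conj f)) (hodge_map (form_star \<Omega> \<omega>)))"
    show "R = (\<lambda>e. unConj (S e))"
      by (rule ext, rule antilinear_eq_tau[OF conjunct1[OF R] Sa]) (simp add: R Sv)
  qed
  from theI'[OF this] show ?thesis unfolding hodge_bundle_def .
qed

definition bundle_pairing :: "'e \<Rightarrow> 'e \<Rightarrow> 'm" where
  "bundle_pairing \<alpha> \<beta> = vol_map (bundle_ev \<alpha> (bundle_hodge \<beta>))"

lemma bundle_pairing_linear: "clinear (\<lambda>\<alpha>. bundle_pairing \<alpha> \<beta>)"
  unfolding bundle_pairing_def by (intro clin cbilinear_comp_left[OF bundle_ev_bilinear])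

lemma bundle_pairing_antilinear: "antilinear (bundle_pairing \<alpha>)"
proof -
  have "clinear (\<lambda>d. vol_map (bundle_ev \<alpha> d))"
    by (rule clinear_comp[OF vol_linear cbilinear_right[OF bundle_ev_bilinear]])
  from clinear_antilinear_comp[OF this conjunct1[OF bundle_hodge_spec]]
  show ?thesis by (simp add: bundle_pairing_def[abs_def])
qed

lemma bundle_pairing_tau: "bundle_pairing (\<tau> \<omega> f) (\<tau> \<nu> g) = form_pairing (\<omega> * emb \<Omega> (pairing f g)) \<nu>"
  using bundle_hodge_spec by (simp add: bundle_pairing_def bundle_ev_tau h_dual pairing_def form_pairing_def)

lemma bundle_pairing_star: "base_star G \<iota> (bundle_pairing \<alpha> \<beta>) = bundle_pairing \<beta> \<alpha>"
proof -
  have a1: "antilinear (\<lambda>\<alpha>. base_star G \<iota> (bundle_pairing \<alpha> \<beta>))" for \<beta>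
    by (rule antilinear_comp_clinear[OF base_star_antilinear bundle_pairing_linear])
  have l1: "clinear (\<lambda>\<beta>. base_star G \<iota> (bundle_pairing \<alpha> \<beta>))" for \<alpha>
    using base_star_antilinear bundle_pairing_antilinear by (simp add: clinear_iff antilinear_def)
  have 1: "base_star G \<iota> (bundle_pairing (\<tau> \<omega> f) (\<tau> \<nu> g)) = bundle_pairing (\<tau> \<nu> g) (\<tau> \<omega> f)" for \<omega> f \<nu> g
    by (simp add: bundle_pairing_tau form_pairing_star form_pairing_emb pairing_star)
  have 2: "base_star G \<iota> (bundle_pairing (\<tau> \<omega> f) \<beta>) = bundle_pairing \<beta> (\<tau> \<omega> f)" for \<omega> f \<beta>
    by (rule clinear_eq_tau[OF l1 bundle_pairing_linear]) (rule 1)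
  show ?thesis
    by (rule antilinear_eq_tau[OF a1 bundle_pairing_antilinear]) (rule 2)
qed

lemma bundle_pairing_lmult: "bundle_pairing \<alpha> (\<tau> (emb \<Omega> m * \<nu>) g) = bundle_pairing \<alpha> (\<tau> \<nu> g) * base_star G \<iota> m"
  by (rule clinear_eq_tau[of "\<lambda>\<alpha>. bundle_pairing \<alpha> (\<tau> (emb \<Omega> m * \<nu>) g)"])
    ((intro clin bundle_pairing_linear)+, simp add: bundle_pairing_tau form_pairing_lmult)

lemma form_coact_hodge: "form_coact \<Omega> (hodge_map \<omega>) = tensor_map id hodge_map (form_coact \<Omega> \<omega>)"
  by (rule tensor_eqI)
    (use act_hodge in \<open>simp add: slice_tensor_map clin hodge_linear act_def\<close>)

lemma base_coaction_vol: "base_coaction G \<iota> (vol_map \<omega>) = tensor_map id vol_map (form_coact \<Omega> \<omega>)"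
proof (rule tensor_eqI)
  fix p :: "'g \<Rightarrow> complex" assume p: "clinear p"
  have act: "clinear (act (form_coact \<Omega>) p)" by (rule clinear_act[OF form_coact_linear p clinear_ident])
  have "emb \<Omega> (slice p (base_coaction G \<iota> (vol_map \<omega>))) = act (form_coact \<Omega>) p (emb \<Omega> (vol_map \<omega>))"
    by (simp add: act_def form_coact_emb slice_tensor_map p clin emb_linear)
  also have "\<dots> = hodge_map (degree_component (2 * n) (act (form_coact \<Omega>) p \<omega>))"
    by (simp add: emb_vol act_hodge[OF p] bideg_preserving_component[OF act act_bideg[OF p]])
  also have "\<dots> = emb \<Omega> (vol_map (act (form_coact \<Omega>) p \<omega>))" by (simp add: emb_vol)
  finally show "slice p (base_coaction G \<iota> (vol_map \<omega>)) = slice p (tensor_map id vol_map (form_coact \<Omega> \<omega>))"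
    by (simp add: emb_eq_iff slice_tensor_map p clin vol_linear act_def)
qed

text \<open>\<open>R\<close> expresses the right-hand side without reference to the chosen
  expansions. Both sides are then linear in \<alpha> and antilinear in \<beta>, so pure tensors
  suffice; there the equivariance of the pairing of sections, of the involution, of the Hodge map
  and of the volume combine.\<close>

lemma bundle_pairing_coaction:
  assumes \<alpha>: "bundle_coact \<alpha> = (\<Sum>i\<in>I. a i \<otimes> x i)" and \<beta>: "bundle_coact \<beta> = (\<Sum>j\<in>J. b j \<otimes> y j)"
  shows "base_coaction G \<iota> (bundle_pairing \<alpha> \<beta>) = (\<Sum>i\<in>I. \<Sum>j\<in>J. (a i * star G (b j)) \<otimes> bundle_pairing (x i) (y j))"
proof -
  note ct = cbilinear_times
  define K where "K x z = bundle_pairing x (unConj z)" for x z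
  have K: "cbilinear K"
    using bundle_pairing_antilinear bundle_pairing_linear
    by (simp add: cbilinear_def K_def clinear_iff antilinear_def)
  define R where "R \<alpha> \<beta> = tensor_map2 (*) K (bundle_coact \<alpha>) (tensor_antimap (star G) Conj (bundle_coact \<beta>))" for \<alpha> \<beta>
  have sums: "R \<alpha> \<beta> = (\<Sum>i\<in>I. \<Sum>j\<in>J. (a i * star G (b j)) \<otimes> bundle_pairing (x i) (y j))"
    if "bundle_coact \<alpha> = (\<Sum>i\<in>I. a i \<otimes> x i)" "bundle_coact \<beta> = (\<Sum>j\<in>J. b j \<otimes> y j)"
    for \<alpha> \<beta> and I :: "'i set" and J :: "'j set" and a x b y
    unfolding R_def that tensor_antimap_sum[OF G.star_antilinear antilinear_Conj] tensor_map2_sums[OF ct K]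
    by (simp add: K_def)
  have Rl: "clinear (\<lambda>\<alpha>. R \<alpha> \<beta>)" for \<beta>
    unfolding R_def by (rule clinear_tensor_map2_left[OF ct K bundle_coact_linear])
  have Ra: "antilinear (R \<alpha>)" for \<alpha>
  proof -
    have "antilinear (\<lambda>\<beta>. tensor_antimap (star G) Conj (bundle_coact \<beta>))"
      by (rule antilinear_comp_clinear[OF antilinear_tensor_antimap[OF G.star_antilinear antilinear_Conj] bundle_coact_linear])
    from clinear_antilinear_comp[OF cbilinear_right[OF cbilinear_tensor_map2[OF ct K]] this]
    show ?thesis by (simp add: R_def[abs_def])
  qed
  have Ll: "clinear (\<lambda>\<alpha>. base_coaction G \<iota> (bundle_pairing \<alpha> \<beta>))" for \<beta>
    by (rule clinear_comp[OF base_coaction_linear bundle_pairing_linear])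
  have La: "antilinear (\<lambda>\<beta>. base_coaction G \<iota> (bundle_pairing \<alpha> \<beta>))" for \<alpha>
    by (rule clinear_antilinear_comp[OF base_coaction_linear bundle_pairing_antilinear])
  have gen: "base_coaction G \<iota> (bundle_pairing (\<tau> \<omega> f) (\<tau> \<nu> g)) = R (\<tau> \<omega> f) (\<tau> \<nu> g)" for \<omega> f \<nu> g
  proof -
    obtain I a x where \<omega>: "form_coact \<Omega> \<omega> = (\<Sum>i\<in>(I::nat set). a i \<otimes> x i)" by (rule tensor_finite_sum)
    obtain J b y where f: "coact F f = (\<Sum>i\<in>(J::nat set). b i \<otimes> y i)" by (rule tensor_finite_sum)
    obtain K' c u where \<nu>: "form_coact \<Omega> \<nu> = (\<Sum>i\<in>(K'::nat set). c i \<otimes> u i)" by (rule tensor_finite_sum)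
    obtain L e v where g: "coact F g = (\<Sum>i\<in>(L::nat set). e i \<otimes> v i)" by (rule tensor_finite_sum)
    have t1: "bundle_coact (\<tau> \<omega> f) = (\<Sum>ij\<in>I \<times> J. (a (fst ij) * b (snd ij)) \<otimes> \<tau> (x (fst ij)) (y (snd ij)))"
      by (simp add: bundle_coact_tau \<omega> f tensor_map2_sums[OF ct tau_bilinear] sum.cartesian_product case_prod_unfold)
    have t2: "bundle_coact (\<tau> \<nu> g) = (\<Sum>kl\<in>K' \<times> L. (c (fst kl) * e (snd kl)) \<otimes> \<tau> (u (fst kl)) (v (snd kl)))"
      by (simp add: bundle_coact_tau \<nu> g tensor_map2_sums[OF ct tau_bilinear] sum.cartesian_product case_prod_unfold)
    have "R (\<tau> \<omega> f) (\<tau> \<nu> g) = (\<Sum>i\<in>I. \<Sum>j\<in>J. \<Sum>k\<in>K'. \<Sum>l\<in>L.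
        (a i * b j * star G (c k * e l)) \<otimes> bundle_pairing (\<tau> (x i) (y j)) (\<tau> (u k) (v l)))"
      by (simp add: sums[OF t1 t2] sum.cartesian_product')
    \<comment> \<open>The involution reverses products, so the legs of g come before those of
      \<nu>.\<close>
    also have "\<dots> = (\<Sum>i\<in>I. \<Sum>j\<in>J. \<Sum>l\<in>L. \<Sum>k\<in>K'.
        (a i * b j * star G (c k * e l)) \<otimes> bundle_pairing (\<tau> (x i) (y j)) (\<tau> (u k) (v l)))"
      by (intro sum.cong[OF refl]) (rule sum.swap)
    also have "\<dots> = (\<Sum>i\<in>I. \<Sum>j\<in>J. \<Sum>l\<in>L. \<Sum>k\<in>K'. (a i * (b j * star G (e l)) * star G (c k))
        \<otimes> vol_map (x i * emb \<Omega> (pairing (y j) (v l)) * hodge_map (form_star \<Omega> (u k))))"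
      by (simp add: bundle_pairing_tau form_pairing_def G.star_mult mult.assoc)
    also have "\<dots> = base_coaction G \<iota> (bundle_pairing (\<tau> \<omega> f) (\<tau> \<nu> g))"
    proof -
      have m: "form_coact \<Omega> (emb \<Omega> (pairing f g)) = (\<Sum>jl\<in>J \<times> L. (b (fst jl) * star G (e (snd jl))) \<otimes> emb \<Omega> (pairing (y (fst jl)) (v (snd jl))))"
        unfolding form_coact_emb pairing_coaction[OF f g]
        by (simp add: sum.cartesian_product case_prod_unfold tensor_map_sum clinear_id_const emb_linear)
      have \<eta>: "form_coact \<Omega> (hodge_map (form_star \<Omega> \<nu>)) = (\<Sum>k\<in>K'. star G (c k) \<otimes> hodge_map (form_star \<Omega> (u k)))"
        unfolding form_coact_hodge form_coact_star \<nu> tensor_antimap_sum[OF G.star_antilinear form_star_antilinear]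
        by (simp add: tensor_map_sum clinear_id_const hodge_linear)
      have "form_coact \<Omega> (\<omega> * emb \<Omega> (pairing f g)) = (\<Sum>q\<in>I \<times> (J \<times> L). (a (fst q) * (b (fst (snd q)) * star G (e (snd (snd q)))))
          \<otimes> (x (fst q) * emb \<Omega> (pairing (y (fst (snd q))) (v (snd (snd q))))))"
        unfolding form_coact_mult \<omega> m tensor_map2_sums[OF ct ct] by (simp add: sum.cartesian_product case_prod_unfold)
      then have "form_coact \<Omega> (\<omega> * emb \<Omega> (pairing f g) * hodge_map (form_star \<Omega> \<nu>))
        = (\<Sum>q\<in>I \<times> (J \<times> L). \<Sum>k\<in>K'. (a (fst q) * (b (fst (snd q)) * star G (e (snd (snd q)))) * star G (c k))
          \<otimes> (x (fst q) * emb \<Omega> (pairing (y (fst (snd q))) (v (snd (snd q)))) * hodge_map (form_star \<Omega> (u k))))"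
        by (simp add: form_coact_mult[of "\<omega> * emb \<Omega> (pairing f g)"] \<eta> tensor_map2_sums[OF ct ct])
      then show ?thesis
        unfolding bundle_pairing_tau form_pairing_def base_coaction_vol
        by (simp add: clinear_sum[OF clinear_tensor_map[OF clinear_id_const vol_linear clinear_ident]]
            tensor_map_id_tens[OF vol_linear] sum.cartesian_product')
    qed
    finally show ?thesis ..
  qed
  have 1: "base_coaction G \<iota> (bundle_pairing (\<tau> \<omega> f) \<beta>) = R (\<tau> \<omega> f) \<beta>" for \<omega> f \<beta>
    by (rule antilinear_eq_tau[OF La Ra]) (rule gen)
  have "base_coaction G \<iota> (bundle_pairing \<alpha> \<beta>) = R \<alpha> \<beta>"
    by (rule clinear_eq_tau[OF Ll Rl]) (rule 1)
  then show ?thesis by (simp add: sums[OF \<alpha> \<beta>])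
qed

end

section \<open>Positivity and definiteness\<close>

context kaehler_bundle
begin

definition fibre_form_pairing :: "'w \<Rightarrow> 'w \<Rightarrow> complex" where
  "fibre_form_pairing \<omega> \<nu> = counit G (\<iota> (form_pairing \<omega> \<nu>))"

sublocale fibre_forms: psd_form fibre_form_pairing
proof (intro psd_form.intro)
  show l: "clinear (\<lambda>\<omega>. fibre_form_pairing \<omega> \<nu>)" for \<nu>
    unfolding fibre_form_pairing_def by (rule clinear_comp[OF base_counit_linear form_pairing_linear])
  show "fibre_form_pairing \<nu> \<omega> = cnj (fibre_form_pairing \<omega> \<nu>)" for \<omega> \<nu>
    unfolding fibre_form_pairing_def form_pairing_star[of \<omega> \<nu>, symmetric] by (rule base_counit_star)
  show "0 \<le> Re (fibre_form_pairing \<omega> \<omega>)" for \<omega>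
  proof (cases "\<omega> = 0")
    case True
    then show ?thesis by (simp add: clinear_0[OF l])
  next
    case False
    then show ?thesis
      unfolding fibre_form_pairing_def by (rule base_pos_props(3)[OF form_pairing_positive])
  qed
qed

text \<open>In the fibre over the counit, functions in the middle of a product of forms can be pulled out:
  this is what the condition \<open>\<Omega> M\<^sup>+ \<subseteq> M\<^sup>+ \<Omega>\<close> is for.\<close>

lemma counit_vol_middle:
  "counit G (\<iota> (vol_map (\<omega> * emb \<Omega> m * \<eta>))) = counit G (\<iota> m) * counit G (\<iota> (vol_map (\<omega> * \<eta>)))"
proof -
  define q where "q \<omega> = counit G (\<iota> (vol_map (\<omega> * \<eta>)))" for \<omega>
  have q: "clinear q" unfolding q_def by (intro clin)
  define m' where "m' = m - counit G (\<iota> m) *\<^sub>C 1"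
  have m': "m' \<in> base_plus G \<iota>"
    by (simp add: base_plus_def m'_def clinear_diff[OF base_counit_linear] clinear_scale[OF base_counit_linear]
        incl_one G.counit_one scaleC_complex)
  have "\<omega> * emb \<Omega> m' \<in> cvec.span {\<omega> * emb \<Omega> x | \<omega> x. x \<in> base_plus G \<iota>}"
    by (rule cvec.span_base) (use m' in blast)
  also have "\<dots> \<subseteq> cvec.span {emb \<Omega> x * \<nu> | x \<nu>. x \<in> base_plus G \<iota>}"
    using covariant_bimodule.plus_condition[OF form_bimodule] by (simp add: form_bimodule_def)
  finally have "q (\<omega> * emb \<Omega> m') = 0"
  proof (induction rule: cvec.span_induct_alt)
    case base
    show ?case by (rule clinear_0[OF q])
  next
    case (step c x y)
    then have "q x = 0"
      by (auto simp: q_def mult.assoc vol_lmult base_counit_mult base_plus_def)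
    with step show ?case by (simp add: clinear_add[OF q] clinear_scale[OF q])
  qed
  moreover have "\<omega> * emb \<Omega> m' = \<omega> * emb \<Omega> m - counit G (\<iota> m) *\<^sub>C \<omega>"
    by (simp add: m'_def clinear_diff[OF emb_linear] clinear_scale[OF emb_linear] emb_one right_diff_distrib mult_scaleC_right)
  ultimately have "q (\<omega> * emb \<Omega> m) = counit G (\<iota> m) * q \<omega>"
    by (simp add: clinear_diff[OF q] clinear_scale[OF q] scaleC_complex)
  then show ?thesis by (simp add: q_def)
qed

definition bundle_fibre_form :: "'e \<Rightarrow> 'e \<Rightarrow> complex" where
  "bundle_fibre_form \<alpha> \<beta> = counit G (\<iota> (bundle_pairing \<alpha> \<beta>))"

lemma bundle_fibre_form_tau:
  "bundle_fibre_form (\<tau> \<omega> f) (\<tau> \<nu> g) = fibre_form f g * fibre_form_pairing \<omega> \<nu>"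
  by (simp add: bundle_fibre_form_def bundle_pairing_tau form_pairing_def counit_vol_middle
      fibre_form_def fibre_form_pairing_def)

text \<open>Schur's product argument: expanding the form on F in its orthonormal frame writes the
  value at \<alpha> as the sum over v of the square norms of \<open>z v\<close>, the contraction of
  \<alpha> with v.\<close>

sublocale bundle_fibre: psd_form bundle_fibre_form
proof (intro psd_form.intro)
  show l: "clinear (\<lambda>\<alpha>. bundle_fibre_form \<alpha> \<beta>)" for \<beta>
    unfolding bundle_fibre_form_def by (rule clinear_comp[OF base_counit_linear bundle_pairing_linear])
  show herm: "bundle_fibre_form \<beta> \<alpha> = cnj (bundle_fibre_form \<alpha> \<beta>)" for \<alpha> \<beta>
    unfolding bundle_fibre_form_def bundle_pairing_star[of \<alpha> \<beta>, symmetric] by (rule base_counit_star)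
  have a: "antilinear (bundle_fibre_form \<alpha>)" for \<alpha>
    using clinear_antilinear_comp[OF base_counit_linear bundle_pairing_antilinear]
    by (simp add: bundle_fibre_form_def[abs_def])
  show "0 \<le> Re (bundle_fibre_form \<alpha> \<alpha>)" for \<alpha>
  proof -
    obtain N :: nat and \<omega> f where \<alpha>: "\<alpha> = (\<Sum>i<N. \<tau> (\<omega> i) (f i))" by (rule bundle_form_sum[of \<alpha>])
    define z where "z v = (\<Sum>i<N. fibre_form (f i) v *\<^sub>C \<omega> i)" for v
    have "bundle_fibre_form \<alpha> \<alpha> = (\<Sum>i<N. \<Sum>j<N. fibre_form (f i) (f j) * fibre_form_pairing (\<omega> i) (\<omega> j))"
      unfolding \<alpha> clinear_sum[OF l] antilinear_sum[OF a] bundle_fibre_form_tau by (rule sum.swap)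
    also have "\<dots> = (\<Sum>i<N. \<Sum>j<N. \<Sum>v\<in>fibre_frame. fibre_form (f i) v * fibre_form v (f j) * fibre_form_pairing (\<omega> i) (\<omega> j))"
      by (subst fibre_expansion) (simp only: sum_distrib_right)
    also have "\<dots> = (\<Sum>i<N. \<Sum>v\<in>fibre_frame. \<Sum>j<N. fibre_form (f i) v * fibre_form v (f j) * fibre_form_pairing (\<omega> i) (\<omega> j))"
      by (rule sum.cong[OF refl]) (rule sum.swap)
    also have "\<dots> = (\<Sum>v\<in>fibre_frame. \<Sum>i<N. \<Sum>j<N. fibre_form (f i) v * fibre_form v (f j) * fibre_form_pairing (\<omega> i) (\<omega> j))"
      by (rule sum.swap)
    also have "\<dots> = (\<Sum>v\<in>fibre_frame. fibre_form_pairing (z v) (z v))"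
    proof (rule sum.cong[OF refl])
      fix v
      have "fibre_form_pairing (z v) (z v)
        = (\<Sum>j<N. \<Sum>i<N. fibre_form v (f j) * (fibre_form (f i) v * fibre_form_pairing (\<omega> i) (\<omega> j)))"
        by (simp add: z_def fibre_forms.left_simps fibre_forms.sum_right fibre_forms.scale_right fibre.cnj_swap
            scaleC_complex sum_distrib_left)
      also have "\<dots> = (\<Sum>i<N. \<Sum>j<N. fibre_form (f i) v * fibre_form v (f j) * fibre_form_pairing (\<omega> i) (\<omega> j))"
        by (subst sum.swap) (simp add: mult_ac)
      finally show "(\<Sum>i<N. \<Sum>j<N. fibre_form (f i) v * fibre_form v (f j) * fibre_form_pairing (\<omega> i) (\<omega> j))
        = fibre_form_pairing (z v) (z v)" ..
    qed
    finally show ?thesis by (simp add: sum_nonneg fibre_forms.nonneg)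
  qed
qed

definition bundle_inner_form :: "'e \<Rightarrow> 'e \<Rightarrow> complex" where
  "bundle_inner_form \<alpha> \<beta> = haar G (\<iota> (bundle_pairing \<alpha> \<beta>))"

lemma base_haar_linear: "clinear (\<lambda>m. haar G (\<iota> m))"
  by (intro clin)

text \<open>By \<open>incl_from_coaction\<close> the inner product is the sum of the fibre form of
  x(i), x(j) times the Haar form of the legs a(i), a(j), to which the same product argument
  applies.\<close>

sublocale total: psd_form bundle_inner_form
proof (intro psd_form.intro)
  show "clinear (\<lambda>\<alpha>. bundle_inner_form \<alpha> \<beta>)" for \<beta>
    unfolding bundle_inner_form_def by (rule clinear_comp[OF base_haar_linear bundle_pairing_linear])
  show "bundle_inner_form \<beta> \<alpha> = cnj (bundle_inner_form \<alpha> \<beta>)" for \<alpha> \<beta>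
    unfolding bundle_inner_form_def bundle_pairing_star[of \<alpha> \<beta>, symmetric] incl_base_star by (rule G.haar_star)
  fix \<alpha>
  obtain I a x where \<alpha>: "bundle_coact \<alpha> = (\<Sum>i\<in>(I::nat set). a i \<otimes> x i)" and I: "finite I"
    by (rule tensor_finite_sum)
  obtain V where "finite V" and
    V: "\<forall>s\<in>cvec.span (x ` I). \<forall>y. bundle_fibre_form s y = (\<Sum>v\<in>V. bundle_fibre_form s v * bundle_fibre_form v y)"
    using bundle_fibre.frame[OF finite_imageI[OF I, of x]] by (elim exE conjE)
  define z where "z v = (\<Sum>i\<in>I. bundle_fibre_form (x i) v *\<^sub>C a i)" for v
  have sz: "star G (z v) = (\<Sum>j\<in>I. bundle_fibre_form v (x j) *\<^sub>C star G (a j))" for v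
    using G.star_antilinear by (simp add: z_def antilinear_sum) (simp add: antilinear_def bundle_fibre.cnj_swap)
  have "base_coaction G \<iota> (bundle_pairing \<alpha> \<alpha>)
    = (\<Sum>ij\<in>I \<times> I. (a (fst ij) * star G (a (snd ij))) \<otimes> bundle_pairing (x (fst ij)) (x (snd ij)))"
    by (simp add: bundle_pairing_coaction[OF \<alpha> \<alpha>] sum.cartesian_product')
  from incl_from_coaction[OF this]
  have "bundle_inner_form \<alpha> \<alpha> = (\<Sum>i\<in>I. \<Sum>j\<in>I. bundle_fibre_form (x i) (x j) * haar G (a i * star G (a j)))"
    by (simp add: bundle_inner_form_def sum.cartesian_product' bundle_fibre_form_def clinear_simps[OF G.haar_linear] scaleC_complex)
  also have "\<dots> = (\<Sum>i\<in>I. \<Sum>j\<in>I. \<Sum>v\<in>V. bundle_fibre_form (x i) v * bundle_fibre_form v (x j) * haar G (a i * star G (a j)))"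
  proof (intro sum.cong[OF refl])
    fix i j assume "i \<in> I"
    then have "bundle_fibre_form (x i) (x j) = (\<Sum>v\<in>V. bundle_fibre_form (x i) v * bundle_fibre_form v (x j))"
      using V cvec.span_base by blast
    then show "bundle_fibre_form (x i) (x j) * haar G (a i * star G (a j))
      = (\<Sum>v\<in>V. bundle_fibre_form (x i) v * bundle_fibre_form v (x j) * haar G (a i * star G (a j)))"
      by (simp only: sum_distrib_right)
  qed
  also have "\<dots> = (\<Sum>i\<in>I. \<Sum>v\<in>V. \<Sum>j\<in>I. bundle_fibre_form (x i) v * bundle_fibre_form v (x j) * haar G (a i * star G (a j)))"
    by (rule sum.cong[OF refl]) (rule sum.swap)
  also have "\<dots> = (\<Sum>v\<in>V. \<Sum>i\<in>I. \<Sum>j\<in>I. bundle_fibre_form (x i) v * bundle_fibre_form v (x j) * haar G (a i * star G (a j)))"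
    by (rule sum.swap)
  also have "\<dots> = (\<Sum>v\<in>V. haar G (z v * star G (z v)))"
    unfolding sz unfolding z_def
    by (simp add: sum_product clinear_simps[OF G.haar_linear] mult_scaleC_left mult_scaleC_right scaleC_complex mult_ac)
  finally show "0 \<le> Re (bundle_inner_form \<alpha> \<alpha>)"
    by (simp add: sum_nonneg G.haar_form.nonneg)
qed

text \<open>For a null \<alpha> the following vanish in turn: its M-valued pairings with all
  \<open>\<tau> \<nu> g\<close>, by faithfulness of the Haar functional; the forms \<Sum>
  \<omega>(i) (f(i), g), by positivity of the pairing of forms; and \<alpha> itself, by the dual
  basis of F, whose functionals all come from \<open>h\<close>.\<close>

lemma bundle_inner_definite:
  assumes "bundle_inner_form \<alpha> \<alpha> = 0"
  shows "\<alpha> = 0"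
proof -
  have 1: "bundle_pairing \<alpha> (\<tau> \<nu> g) = 0" for \<nu> g
  proof -
    define x where "x = bundle_pairing \<alpha> (\<tau> \<nu> g)"
    \<comment> \<open>Multiplying the second argument by x turns the value into the Haar form of
      \<open>\<iota> x\<close> with itself.\<close>
    have "bundle_inner_form \<alpha> (\<tau> (emb \<Omega> x * \<nu>) g) = 0"
      by (rule total.null) (simp add: assms)
    then have "haar G (\<iota> x * star G (\<iota> x)) = 0"
      by (simp add: bundle_inner_form_def bundle_pairing_lmult x_def[symmetric] incl_mult)
    then have "\<iota> x = 0" using G.haar_form.definite by blast
    then have "\<iota> x = \<iota> 0" by (simp add: clinear_0[OF incl_linear])
    then show ?thesis by (simp add: incl_eq_iff x_def)
  qed
  obtain N :: nat and \<omega> f where \<alpha>: "\<alpha> = (\<Sum>i<N. \<tau> (\<omega> i) (f i))" by (rule bundle_form_sum[of \<alpha>])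
  have 2: "(\<Sum>i<N. \<omega> i * emb \<Omega> (pairing (f i) g)) = 0" for g
  proof (rule ccontr)
    define y where "y = (\<Sum>i<N. \<omega> i * emb \<Omega> (pairing (f i) g))"
    assume "(\<Sum>i<N. \<omega> i * emb \<Omega> (pairing (f i) g)) \<noteq> 0"
    then have "form_pairing y y \<noteq> 0"
      unfolding y_def by (intro base_pos_props(1)[OF form_pairing_positive])
    moreover have "form_pairing y \<nu> = bundle_pairing \<alpha> (\<tau> \<nu> g)" for \<nu>
      by (simp add: \<alpha> y_def clinear_sum[OF bundle_pairing_linear] bundle_pairing_tau clinear_sum[OF form_pairing_linear])
    ultimately show False by (simp add: 1)
  qed
  have 3: "(\<Sum>i<N. \<omega> i * emb \<Omega> (\<phi> (f i))) = 0" if \<phi>: "\<phi> \<in> dual_module F" for \<phi>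
  proof -
    have "\<phi> \<in> range h" using \<phi> herm.bijective by (simp add: bij_betw_def)
    then obtain x where "\<phi> = h x" by blast
    then have "\<phi> f = pairing f (unConj x)" for f by (simp add: pairing_def)
    then show ?thesis by (simp add: 2)
  qed
  from dual_basis obtain K :: "('f \<times> nat \<times> nat) set" and \<phi> w where
    K: "finite K \<and> (\<forall>k\<in>K. \<phi> k \<in> dual_module F) \<and> (\<forall>f. f = (\<Sum>k\<in>K. lact F (\<phi> k f) (w k)))"
    by (elim exE)
  have exp: "f = (\<Sum>k\<in>K. lact F (\<phi> k f) (w k))" for f using K by blast
  have "\<alpha> = (\<Sum>i<N. \<Sum>k\<in>K. \<tau> (\<omega> i * emb \<Omega> (\<phi> k (f i))) (w k))"
    unfolding \<alpha> by (subst exp) (simp add: tau_simps tau_balanced)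
  also have "\<dots> = (\<Sum>k\<in>K. \<tau> (\<Sum>i<N. \<omega> i * emb \<Omega> (\<phi> k (f i))) (w k))"
    by (subst sum.swap) (simp add: tau_simps)
  also have "\<dots> = 0"
    by (rule sum.neutral) (use 3 K in \<open>auto simp: tau_simps\<close>)
  finally show ?thesis .
qed

sublocale total: inner_form bundle_inner_form
  by unfold_locales (use bundle_inner_definite in blast)

section \<open>Invariance of the inner product and the main theorem\<close>

text \<open>By invariance of h, the map \<alpha> \<mapsto> \<alpha>(-1) Z(\<alpha>(0)) is 1 times
  the inner product of \<alpha> with \<beta>; cancelling the antipode solves for Z.\<close>

lemma inner_invariant:
  assumes \<beta>: "bundle_coact \<beta> = (\<Sum>j\<in>J. b j \<otimes> y j)"
  shows "tlift (\<lambda>a x. bundle_inner_form x \<beta> *\<^sub>C antipode G a) (bundle_coact \<alpha>)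
    = (\<Sum>j\<in>J. bundle_inner_form \<alpha> (y j) *\<^sub>C star G (b j))"
proof -
  define Z where "Z x = (\<Sum>j\<in>J. bundle_inner_form x (y j) *\<^sub>C star G (b j))" for x
  have Z: "clinear Z"
    unfolding Z_def[abs_def] by (intro clin total.linear_left)
  have inv: "tlift (\<lambda>a x. a * Z x) (bundle_coact \<alpha>) = bundle_inner_form \<alpha> \<beta> *\<^sub>C 1" for \<alpha>
  proof -
    obtain I a x where \<alpha>: "bundle_coact \<alpha> = (\<Sum>i\<in>(I::nat set). a i \<otimes> x i)" by (rule tensor_finite_sum)
    have b1: "cbilinear (\<lambda>a x. a * Z x)" by (intro clin clinear_comp[OF Z])
    have b2: "cbilinear (\<lambda>x y. haar G (\<iota> y) *\<^sub>C x)" by (intro clin)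
    have "bundle_inner_form \<alpha> \<beta> *\<^sub>C 1 = tlift (\<lambda>x y. haar G y *\<^sub>C x) (tensor_map id \<iota> (base_coaction G \<iota> (bundle_pairing \<alpha> \<beta>)))"
      by (simp add: bundle_inner_form_def base_coaction G.haar_left)
    also have "\<dots> = tlift (\<lambda>x y. haar G (\<iota> y) *\<^sub>C x) (base_coaction G \<iota> (bundle_pairing \<alpha> \<beta>))"
      by (subst tlift_tensor_map) ((intro clin)+, simp)
    also have "\<dots> = (\<Sum>i\<in>I. \<Sum>j\<in>J. bundle_inner_form (x i) (y j) *\<^sub>C (a i * star G (b j)))"
      unfolding bundle_pairing_coaction[OF \<alpha> \<beta>] tlift_sum[OF b2] tlift_tens[OF b2] bundle_inner_form_def ..
    also have "\<dots> = tlift (\<lambda>a x. a * Z x) (bundle_coact \<alpha>)"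
      unfolding \<alpha> tlift_sum[OF b1] tlift_tens[OF b1] by (simp add: Z_def sum_distrib_left mult_scaleC_right)
    finally show ?thesis ..
  qed
  have "Z \<alpha> = tlift (\<lambda>a x. antipode G a * tlift (\<lambda>b y. b * Z y) (bundle_coact x)) (bundle_coact \<alpha>)"
    by (rule G.antipode_cancel_left[OF bundle_comodule cbilinear_times mult.assoc mult_1_left Z, symmetric])
  then show ?thesis unfolding inv by (simp add: mult_scaleC_right Z_def)
qed

text \<open>Apply the linear functional \<open>\<lambda>g. cnj (p (star G g))\<close> to
  \<open>inner_invariant\<close>: on the left it meets the antipode, on the right the involutions
  cancel.\<close>

lemma act_adjoint:
  assumes p: "clinear p"
  shows "clinear (\<lambda>g. cnj (p (star G (antipode G g))))"
    and "bundle_inner_form (act bundle_coact (\<lambda>g. cnj (p (star G (antipode G g)))) \<alpha>) \<beta>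
      = bundle_inner_form \<alpha> (act bundle_coact p \<beta>)"
proof -
  define r where "r g = cnj (p (star G g))" for g
  have r: "clinear r"
    using G.star_antilinear by (simp add: clinear_iff r_def antilinear_def clinear_add[OF p] clinear_scale[OF p] scaleC_complex)
  have "clinear (\<lambda>g. r (antipode G g))" by (rule clinear_comp[OF r G.antipode_linear])
  then show "clinear (\<lambda>g. cnj (p (star G (antipode G g))))" by (simp add: r_def)
  obtain J b y where \<beta>: "bundle_coact \<beta> = (\<Sum>j\<in>(J::nat set). b j \<otimes> y j)" by (rule tensor_finite_sum)
  have "bundle_inner_form (act bundle_coact (\<lambda>g. r (antipode G g)) \<alpha>) \<beta>
    = r (tlift (\<lambda>a x. bundle_inner_form x \<beta> *\<^sub>C antipode G a) (bundle_coact \<alpha>))"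
    unfolding act_def slice_def clinear_tlift_push[OF r] clinear_tlift_push[OF total.linear_left]
    by (simp add: clinear_scale[OF r] total.left_simps scaleC_complex mult.commute)
  also have "\<dots> = (\<Sum>j\<in>J. bundle_inner_form \<alpha> (y j) * r (star G (b j)))"
    by (simp add: inner_invariant[OF \<beta>] clinear_simps[OF r] scaleC_complex)
  also have "\<dots> = bundle_inner_form \<alpha> (act bundle_coact p \<beta>)"
    by (simp add: act_def \<beta> slice_sum p total.sum_right total.scale_right r_def G.star_star mult.commute)
  finally show "bundle_inner_form (act bundle_coact (\<lambda>g. cnj (p (star G (antipode G g)))) \<alpha>) \<beta>
      = bundle_inner_form \<alpha> (act bundle_coact p \<beta>)"
    by (simp add: r_def)
qed

text \<open>Sections are expanded over the generators, so that their coefficients move into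
  \<Omega>; there the legs c(j) of a generator are absorbed into b, and
  \<open>bimodule_act_finite_rank\<close> applies to the functionals h(. c(j) b).\<close>

lemma bundle_act_finite_rank:
  "\<exists>S. finite S \<and> range (act bundle_coact (\<lambda>g. haar G (g * b))) \<subseteq> cvec.span S"
proof -
  let ?p = "\<lambda>g. haar G (g * b)"
  have p: "clinear ?p" by (intro clin)
  have act: "clinear (act bundle_coact ?p)" by (rule clinear_act[OF bundle_coact_linear p clinear_ident])
  obtain A where A: "finite A" "\<And>f. \<exists>m. f = (\<Sum>a\<in>A. lact F (m a) a)"
    using F.finitely_generated by blast
  have "\<forall>c. \<exists>S. finite S \<and> (\<forall>\<omega>. act (form_coact \<Omega>) (\<lambda>g. haar G (g * c)) \<omega> \<in> cvec.span S)"
    using bimodule_act_finite_rank[OF form_bimodule] by (simp add: form_bimodule_def)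
  then obtain R where R: "\<And>c. finite (R c)" "\<And>c \<omega>. act (form_coact \<Omega>) (\<lambda>g. haar G (g * c)) \<omega> \<in> cvec.span (R c)"
    by metis
  have "\<exists>S. finite S \<and> (\<forall>\<omega>. act bundle_coact ?p (\<tau> \<omega> f) \<in> cvec.span S)" for f
  proof -
    obtain J c y where J: "finite (J::nat set)" and f: "coact F f = (\<Sum>j\<in>J. c j \<otimes> y j)" by (rule tensor_finite_sum)
    define S where "S = (\<Union>j\<in>J. (\<lambda>s. \<tau> s (y j)) ` R (c j * b))"
    have "act bundle_coact ?p (\<tau> \<omega> f) \<in> cvec.span S" for \<omega>
      unfolding act_tau[OF p f]
    proof (rule cvec.span_sum)
      fix j assume j: "j \<in> J"
      have "\<tau> (act (form_coact \<Omega>) (\<lambda>g. haar G (g * c j * b)) \<omega>) (y j) \<in> (\<lambda>s. \<tau> s (y j)) ` cvec.span (R (c j * b))"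
        using R(2)[of "c j * b" \<omega>] by (simp add: mult.assoc)
      also have "\<dots> = cvec.span ((\<lambda>s. \<tau> s (y j)) ` R (c j * b))"
        by (rule cvp.linear_span_image[OF cbilinear_left[OF tau_bilinear], symmetric])
      also have "\<dots> \<subseteq> cvec.span S" by (rule cvec.span_mono) (use j in \<open>auto simp: S_def\<close>)
      finally show "\<tau> (act (form_coact \<Omega>) (\<lambda>g. haar G (g * c j * b)) \<omega>) (y j) \<in> cvec.span S" .
    qed
    moreover have "finite S" using J R(1) by (simp add: S_def)
    ultimately show ?thesis by (intro exI[of _ S] conjI allI)
  qed
  then have "\<forall>f. \<exists>S. finite S \<and> (\<forall>\<omega>. act bundle_coact ?p (\<tau> \<omega> f) \<in> cvec.span S)" ..
  then obtain S where S: "\<forall>f. finite (S f) \<and> (\<forall>\<omega>. act bundle_coact ?p (\<tau> \<omega> f) \<in> cvec.span (S f))"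
    by (rule choice[THEN exE])
  define S' where "S' = (\<Union>a\<in>A. S a)"
  have "act bundle_coact ?p e \<in> cvec.span S'" for e
  proof -
    have gen: "act bundle_coact ?p (\<tau> \<omega> f) \<in> cvec.span S'" for \<omega> f
    proof -
      obtain m where f: "f = (\<Sum>a\<in>A. lact F (m a) a)" using A(2) by blast
      have "act bundle_coact ?p (\<tau> \<omega> f) = (\<Sum>a\<in>A. act bundle_coact ?p (\<tau> (\<omega> * emb \<Omega> (m a)) a))"
        by (simp add: f tau_simps clinear_sum[OF act] tau_balanced)
      also have "\<dots> \<in> cvec.span S'"
      proof (rule cvec.span_sum)
        fix a assume "a \<in> A"
        then have "cvec.span (S a) \<subseteq> cvec.span S'" by (intro cvec.span_mono) (auto simp: S'_def)
        then show "act bundle_coact ?p (\<tau> (\<omega> * emb \<Omega> (m a)) a) \<in> cvec.span S'" using S by blast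
      qed
      finally show ?thesis .
    qed
    obtain N :: nat and \<omega> f where e: "e = (\<Sum>i<N. \<tau> (\<omega> i) (f i))" by (rule bundle_form_sum[of e])
    show ?thesis unfolding e clinear_sum[OF act] by (rule cvec.span_sum) (rule gen)
  qed
  moreover have "finite S'" using A(1) S by (simp add: S'_def)
  ultimately show ?thesis by (intro exI[of _ S'] conjI) auto
qed

theorem diagonalisable_dirac:
  "diagonalisable (\<lambda>e. dolbeault e + adjoint_op bundle_inner_form dolbeault e)"
proof (rule total.diagonalisable_plus_adjoint[OF dolbeault_linear])
  fix e
  obtain I a x where e: "bundle_coact e = (\<Sum>i\<in>(I::nat set). a i \<otimes> x i)" and I: "finite I"
    by (rule tensor_finite_sum)
  \<comment> \<open>Only the finitely many legs a(i) of e matter: on their span h(. b) is the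
    counit, so its action fixes e.\<close>
  obtain b where b: "\<forall>c\<in>cvec.span (a ` I). haar G (c * b) = counit G c"
    using G.haar_represents_counit[of "a ` I"] I by auto
  define p where "p g = haar G (g * b)" for g
  have p: "clinear p" unfolding p_def by (intro clin)
  define q where "q g = cnj (p (star G (antipode G g)))" for g
  have q: "clinear q" unfolding q_def by (rule act_adjoint(1)[OF p])
  obtain S where S: "finite S" "range (act bundle_coact p) \<subseteq> cvec.span S"
    using bundle_act_finite_rank[of b] unfolding p_def by (elim exE conjE)
  have pa: "p (a i) = counit G (a i)" if "i \<in> I" for i
    using b cvec.span_base[of "a i" "a ` I"] that by (simp add: p_def)
  have "act bundle_coact p e = (\<Sum>i\<in>I. counit G (a i) *\<^sub>C x i)"
    unfolding act_def e slice_sum[OF p] by (rule sum.cong[OF refl]) (simp add: pa)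
  also have "\<dots> = slice (counit G) (bundle_coact e)"
    by (simp add: e slice_sum[OF G.counit_linear])
  also have "\<dots> = e"
    using bundle_comodule by (simp add: comodule_def slice_def)
  finally have Pe: "act bundle_coact p e = e" .
  show "\<exists>P Q S. clinear P \<and> finite S \<and> range P \<subseteq> cvec.span S \<and> P e = e
      \<and> (\<forall>x. dolbeault (P x) = P (dolbeault x)) \<and> (\<forall>x. dolbeault (Q x) = Q (dolbeault x))
      \<and> (\<forall>x y. bundle_inner_form (Q x) y = bundle_inner_form x (P y))"
    by (intro exI[of _ "act bundle_coact p"] exI[of _ "act bundle_coact q"] exI[of _ S] conjI allI S Pe
        act_dolbeault[OF p, symmetric] act_dolbeault[OF q, symmetric] act_adjoint(2)[OF p, folded q_def]
        clinear_act[OF bundle_coact_linear p clinear_ident])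
qed

end

theorem corollary6p12:
  fixes G :: "'g::complex_algebra_1 hopf"
    and H :: "'h::complex_algebra_1 hopf"
    and \<pi> :: "'g \<Rightarrow> 'h"
    and \<iota> :: "'m::complex_algebra_1 \<Rightarrow> 'g"
    and \<Omega> :: "('g, 'm, 'w::complex_algebra_1) calculus"
    and C :: "'w complex_str"
    and n :: nat
    and \<kappa> :: 'w
    and F :: "('g, 'm, 'f::complex_vector) bimodule"
    and \<tau> :: "'w \<Rightarrow> 'f \<Rightarrow> 'e::complex_vector"
    and \<tau>' :: "('f \<Rightarrow> 'm) \<Rightarrow> 'w \<Rightarrow> 'd::complex_vector"
    and D :: "'f \<Rightarrow> 'e"
    and h :: "'f conj_space \<Rightarrow> ('f \<Rightarrow> 'm)"
  assumes "quantum_homogeneous_space G H \<pi> \<iota>"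
    and "kaehler_structure G \<iota> \<Omega> C n \<kappa>"
    and "kaehler_positive_definite G \<iota> \<Omega> C n \<kappa>"
    and "integral_closed G \<iota> \<Omega> C n \<kappa>"
    and "covariant_bimodule G \<iota> F"
    and "form_tensor_product \<Omega> F \<tau>"
    and "dual_tensor_product \<Omega> F \<tau>'"
    and "holomorphic_structure \<Omega> C F \<tau> D"
    and "hermitian_structure G \<iota> F h"
    and "hermitian_positive_definite G \<iota> h"
  shows "diagonalisable (dirac G \<iota> \<Omega> C n \<kappa> F \<tau> \<tau>' h D)"
proof -
  interpret kaehler_bundle G H \<pi> \<iota> F h \<Omega> C n \<kappa> \<tau> \<tau>' D
    using assms
    by (intro kaehler_bundle.intro hermitian_bundle.intro hermitian_bundle_axioms.intro
        kaehler_bundle_axioms.intro) (simp_all add: form_tensor_product_def dual_tensor_product_def)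
  have "dirac G \<iota> \<Omega> C n \<kappa> F \<tau> \<tau>' h D = (\<lambda>e. dolbeault e + adjoint_op bundle_inner_form dolbeault e)"
    by (simp add: dirac_def[abs_def] bundle_inner_def[abs_def] bundle_inner_form_def[abs_def] bundle_pairing_def)
  then show ?thesis by (simp only: diagonalisable_dirac)
qed

end
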